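(* Let $\Theta\in\mathbf S(\mathfrak M,\mathfrak N)$ and let $\{\Gamma_k\}_{k\ge0}$ be its Schur parameters. Suppose that, for some $n\ge0$, $\mathfrak D_{\Gamma_{2n}}\ne\{0\}$ and $\mathfrak D_{\Gamma_{2n}^*}\ne\{0\}$. Then $\Theta$ and the $(2n+1)$-th associated function $\Theta_{2n+1}$ are connected by the relations $$\begin{aligned}\Theta(z)&=\theta_n^{(0)}(z)+c_n(z)\left(I_{\mathfrak D_{\Gamma^*_{2n}}}-\Theta_{2n+1}(z)a_n(z)\right)^{-1}\Theta_{2n+1}(z)b_n(z)\\ &=\theta_n^{(0)}(z)+c_n(z)\Theta_{2n+1}(z)\left(I_{\mathfrak D_{\Gamma_{2n}}}-a_n(z)\Theta_{2n+1}(z)\right)^{-1}b_n(z),\quad z\in\mathbb D,\end{aligned}$$ where $\theta_n^{(0)},c_n,b_n,a_n$ are the entries of the Schur class function $q_n(z)=\begin{bmatrix}\theta^{(0)}_n(z)&c_n(z)\\ b_n(z)&a_n(z)\end{bmatrix}:\mathfrak M\oplus\mathfrak D_{\Gamma^*_{2n}}\to\mathfrak N\oplus\mathfrak D_{\Gamma_{2n}}$ defined, with $\widehat R(z)=(I_{\widehat{\mathcal K}_n}-z\widehat{\mathcal S}_{n,0})^{-1}$, by $$\begin{aligned}\theta^{(0)}_n(z)&=\begin{bmatrix}\Gamma_0&D_{\Gamma_0^*}\end{bmatrix}\left(P_{\widehat{\mathcal H}_1}\widehat R(z)\upharpoonright\mathfrak M\right),\\ a_n(z)&=z\begin{bmatrix}D_{\Gamma_{2n}}&-\Gamma^*_{2n}\end{bmatrix}\left(P_{\widehat{\mathcal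 H}_{n+1}}\widehat R(z)\upharpoonright\mathfrak D_{\Gamma^*_{2n}}\right),\\ b_n(z)&=z\begin{bmatrix}D_{\Gamma_{2n}}&-\Gamma^*_{2n}\end{bmatrix}\left(P_{\widehat{\mathcal H}_{n+1}}\widehat R(z)\upharpoonright\mathfrak M\right),\\ c_n(z)&=\begin{bmatrix}\Gamma_0&D_{\Gamma_0^*}\end{bmatrix}\left(P_{\widehat{\mathcal H}_1}\widehat R(z)\upharpoonright\mathfrak D_{\Gamma^*_{2n}}\right).\end{aligned}$$
   Context: All Hilbert spaces are complex (infinite-dimensional ones are separable). $\mathbf L(H_1,H_2)$ denotes the bounded operators; $P_L$ is the orthogonal projection onto a subspace $L$ (regarded as a map into $L$), $X\upharpoonright L$ is restriction. For a contraction $T$: $D_T=(I-T^*T)^{1/2}$, $\mathfrak D_T=\overline{\operatorname{ran}}\,D_T$. $\mathbf S(\mathfrak M,\mathfrak N)$ is the Schur class: holomorphic $\Theta:\mathbb D\to\mathbf L(\mathfrak M,\mathfrak N)$ with $\|\Theta(z)\|\le1$. Schur algorithm: $\Theta_0=\Theta$, $\Gamma_k=\Theta_k(0)$, and $\Theta_{k+1}\in\mathbf S(\mathfrak D_{\Gamma_k},\mathfrak D_{\Gamma_k^*})$ is the unique function with $\Theta_k(z)=\Gamma_k+zD_{\Gamma_k^*}\Theta_{k+1}(z)(I+z\Gamma_k^*\Theta_{k+1}(z))^{-1}D_{\Gamma_k}$, $z\in\mathbb D$. The $\Gamma_k$ are the Schur parameters of $\Theta$ and $\Theta_k$ is the $k$-th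 associated function; $\Gamma_0\in\mathbf L(\mathfrak M,\mathfrak N)$, $\Gamma_k\in\mathbf L(\mathfrak D_{\Gamma_{k-1}},\mathfrak D_{\Gamma_{k-1}^*})$, $k\ge1$. Elementary rotations (with $\mathfrak D_{\Gamma_{-1}}:=\mathfrak M$, $\mathfrak D_{\Gamma_{-1}^*}:=\mathfrak N$) are the unitary operators $$\mathbf J_{\Gamma_k}=\begin{bmatrix}\Gamma_k&D_{\Gamma_k^*}\\ D_{\Gamma_k}&-\Gamma_k^*\end{bmatrix}:\mathfrak D_{\Gamma_{k-1}}\oplus\mathfrak D_{\Gamma_k^*}\to\mathfrak D_{\Gamma_{k-1}^*}\oplus\mathfrak D_{\Gamma_k}.$$ Put $\widehat{\mathcal H}_1=\mathfrak M\oplus\mathfrak D_{\Gamma_0^*}$, $\widehat{\mathcal H}_k=\mathfrak D_{\Gamma_{2k-3}}\oplus\mathfrak D_{\Gamma_{2k-2}^*}$ ($2\le k\le n+1$), $\widehat{\mathcal K}_n=\bigoplus_{k=1}^{n+1}\widehat{\mathcal H}_k$. The operator $\widehat{\mathcal S}_{n,0}$ on $\widehat{\mathcal K}_n$ is $$\widehat{\mathcal S}_{n,0}=\Bigl(0\oplus\bigoplus_{k=1}^n\mathbf J_{\Gamma_{2k-1}}\oplus0\Bigr)\Bigl(\bigoplus_{k=1}^{n+1}\mathbf J_{\Gamma_{2k-2}}\Bigr),$$ where the right factor maps $\widehat{\mathcal K}_n$ to $\bigoplus_{k=1}^{n+1}(\mathfrak D_{\Gamma^*_{2k-3}}\oplus\mathfrak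 D_{\Gamma_{2k-2}})=\mathfrak N\oplus\bigoplus_{k=1}^n(\mathfrak D_{\Gamma_{2k-2}}\oplus\mathfrak D_{\Gamma_{2k-1}^*})\oplus\mathfrak D_{\Gamma_{2n}}$, and the left factor maps the latter to $\mathfrak M\oplus\bigoplus_{k=1}^n(\mathfrak D_{\Gamma_{2k-2}^*}\oplus\mathfrak D_{\Gamma_{2k-1}})\oplus\mathfrak D_{\Gamma_{2n}^*}=\widehat{\mathcal K}_n$ (its first zero block maps $\mathfrak N\to\mathfrak M$, its last $\mathfrak D_{\Gamma_{2n}}\to\mathfrak D_{\Gamma_{2n}^*}$). The rows $\begin{bmatrix}\Gamma_0&D_{\Gamma_0^*}\end{bmatrix}$ and $\begin{bmatrix}D_{\Gamma_{2n}}&-\Gamma^*_{2n}\end{bmatrix}$ act from $\widehat{\mathcal H}_1$ to $\mathfrak N$ and from $\widehat{\mathcal H}_{n+1}$ to $\mathfrak D_{\Gamma_{2n}}$, respectively. *)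

theory Defs
  imports "HOL-Analysis.Analysis"
begin

section \<open>Complex inner product spaces and Hilbert spaces\<close>

class scaleC =
  fixes scaleC :: "complex \<Rightarrow> 'a \<Rightarrow> 'a"  (infixr \<open>*\<^sub>C\<close> 75)

text \<open>The complex inner product is linear in the first argument; its real part is the inner
  product of the underlying real space, so that norm, topology and bounded operators are the ones
  of the library.\<close>

class complex_inner = real_inner + scaleC +
  fixes cinner :: "'a \<Rightarrow> 'a \<Rightarrow> complex"
  assumes scaleC_add_right: "a *\<^sub>C (x + y) = a *\<^sub>C x + a *\<^sub>C y"
    and scaleC_add_left: "(a + b) *\<^sub>C x = a *\<^sub>C x + b *\<^sub>C x"
    and scaleC_scaleC: "a *\<^sub>C b *\<^sub>C x = (a * b) *\<^sub>C x"
    and scaleC_of_real: "complex_of_real r *\<^sub>C x = r *\<^sub>R x"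
    and cinner_commute: "cinner x y = cnj (cinner y x)"
    and cinner_add_left: "cinner (x + y) z = cinner x z + cinner y z"
    and cinner_scaleC_left: "cinner (a *\<^sub>C x) y = a * cinner x y"
    and Re_cinner: "Re (cinner x y) = inner x y"

class separable_chilbert_space = complex_inner + polish_space

lemma cinner_self: "cinner x x = complex_of_real ((norm x)\<^sup>2)"
proof -
  have "Im (cinner x x) = 0"
    using arg_cong[OF cinner_commute[of x x], of Im] by simp
  moreover have "Re (cinner x x) = (norm x)\<^sup>2"
    by (simp add: Re_cinner power2_norm_eq_inner)
  ultimately show ?thesis
    by (simp add: complex_eq_iff)
qed

lemma norm_scaleC: "norm (a *\<^sub>C x) = cmod a * norm (x::'a::complex_inner)"
proof -
  have "cinner (a *\<^sub>C x) (a *\<^sub>C x) = a * cnj (a * cinner x x)"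
    by (simp only: cinner_scaleC_left cinner_commute[of x "a *\<^sub>C x"])
  also have "\<dots> = complex_of_real ((cmod a * norm x)\<^sup>2)"
    by (simp add: cinner_self power_mult_distrib flip: complex_norm_square mult.assoc)
  finally have "(norm (a *\<^sub>C x))\<^sup>2 = (cmod a * norm x)\<^sup>2"
    unfolding cinner_self by (simp only: of_real_eq_iff)
  then show ?thesis
    by (simp add: power2_eq_iff_nonneg)
qed

lemma bounded_linear_scaleC: "bounded_linear (\<lambda>x::'a::complex_inner. a *\<^sub>C x)"
proof (rule bounded_linear_intro[where K = "cmod a"])
  show "a *\<^sub>C (r *\<^sub>R x) = r *\<^sub>R (a *\<^sub>C x)" for r and x :: 'a
    by (simp add: scaleC_scaleC mult.commute flip: scaleC_of_real)
qed (simp_all add: scaleC_add_right norm_scaleC mult.commute)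

instantiation complex :: separable_chilbert_space
begin

definition scaleC_complex :: "complex \<Rightarrow> complex \<Rightarrow> complex"
  where "scaleC_complex a x = a * x"

definition cinner_complex :: "complex \<Rightarrow> complex \<Rightarrow> complex"
  where "cinner_complex x y = x * cnj y"

instance
  by standard (simp_all add: scaleC_complex_def cinner_complex_def algebra_simps
      scaleR_conv_of_real inner_complex_def)

end

instantiation prod :: (complex_inner, complex_inner) complex_inner
begin

definition scaleC_prod :: "complex \<Rightarrow> 'a \<times> 'b \<Rightarrow> 'a \<times> 'b"
  where "scaleC_prod a x = (a *\<^sub>C fst x, a *\<^sub>C snd x)"

definition cinner_prod :: "'a \<times> 'b \<Rightarrow> 'a \<times> 'b \<Rightarrow> complex"
  where "cinner_prod x y = cinner (fst x) (fst y) + cinner (snd x) (snd y)"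

instance
proof
  fix x y :: "'a \<times> 'b"
  show "cinner x y = cnj (cinner y x)"
    unfolding cinner_prod_def complex_cnj_add by (simp flip: cinner_commute)
qed (simp_all add: scaleC_prod_def cinner_prod_def scaleC_add_right scaleC_add_left
    scaleC_scaleC scaleC_of_real cinner_add_left cinner_scaleC_left Re_cinner
    inner_prod_def algebra_simps plus_prod_def scaleR_prod_def)

end


section \<open>Square-summable sequences\<close>

text \<open>The ambient space for direct sums with a variable number of summands.\<close>

typedef (overloaded) 'a ell2 = "{f :: nat \<Rightarrow> 'a::complex_inner. summable (\<lambda>k. (norm (f k))\<^sup>2)}"
  morphisms ell2_nth Abs_ell2
  by (rule exI[of _ "\<lambda>_. 0"]) simp

setup_lifting type_definition_ell2

lemma summable_ell2: "summable (\<lambda>k. (norm (ell2_nth x k))\<^sup>2)"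
  using ell2_nth[of x] by simp

lemma summable_ell2_add:
  fixes f g :: "nat \<Rightarrow> 'a::complex_inner"
  assumes "summable (\<lambda>k. (norm (f k))\<^sup>2)" "summable (\<lambda>k. (norm (g k))\<^sup>2)"
  shows "summable (\<lambda>k. (norm (f k + g k))\<^sup>2)"
proof (rule summable_comparison_test')
  show "summable (\<lambda>k. 2 * (norm (f k))\<^sup>2 + 2 * (norm (g k))\<^sup>2)"
    using assms by (intro summable_add summable_mult)
  show "norm ((norm (f k + g k))\<^sup>2) \<le> 2 * (norm (f k))\<^sup>2 + 2 * (norm (g k))\<^sup>2" for k
  proof -
    have "(norm (f k + g k))\<^sup>2 \<le> (norm (f k) + norm (g k))\<^sup>2"
      by (intro power_mono norm_triangle_ineq) simp
    also have "\<dots> \<le> 2 * (norm (f k))\<^sup>2 + 2 * (norm (g k))\<^sup>2"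
      using zero_le_power2[of "norm (f k) - norm (g k)"]
      by (simp add: power2_eq_square algebra_simps)
    finally show ?thesis by simp
  qed
qed

lemma norm_cinner_le: "cmod (cinner x y) \<le> norm x * norm (y::'a::complex_inner)"
proof (cases "cinner x y = 0")
  case False
  define a where "a = cnj (cinner x y) / cmod (cinner x y)"
  have "a * cinner x y = complex_of_real (cmod (cinner x y))"
    using False complex_norm_square[of "cinner x y"]
    by (simp add: a_def field_simps power2_eq_square)
  then have "cmod (cinner x y) = inner (a *\<^sub>C x) y"
    by (simp flip: Re_cinner add: cinner_scaleC_left)
  also have "\<dots> \<le> norm (a *\<^sub>C x) * norm y"
    by (rule norm_cauchy_schwarz)
  also have "\<dots> = norm x * norm y"
    using False by (simp add: norm_scaleC a_def norm_divide)
  finally show ?thesis .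
qed simp

lemma summable_ell2_cinner: "summable (\<lambda>k. cinner (ell2_nth x k) (ell2_nth y k))"
proof (rule summable_comparison_test')
  show "summable (\<lambda>k. (norm (ell2_nth x k))\<^sup>2 + (norm (ell2_nth y k))\<^sup>2)"
    by (intro summable_add summable_ell2)
  show "norm (cinner (ell2_nth x k) (ell2_nth y k))
      \<le> (norm (ell2_nth x k))\<^sup>2 + (norm (ell2_nth y k))\<^sup>2" for k
  proof -
    have "cmod (cinner (ell2_nth x k) (ell2_nth y k)) \<le> norm (ell2_nth x k) * norm (ell2_nth y k)"
      by (rule norm_cinner_le)
    also have "\<dots> \<le> (norm (ell2_nth x k))\<^sup>2 + (norm (ell2_nth y k))\<^sup>2"
      using zero_le_power2[of "norm (ell2_nth x k) - norm (ell2_nth y k)"]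
        zero_le_power2[of "norm (ell2_nth x k)"] zero_le_power2[of "norm (ell2_nth y k)"]
      by (simp only: power2_diff)
    finally show ?thesis .
  qed
qed

lemma summable_ell2_inner: "summable (\<lambda>k. inner (ell2_nth x k) (ell2_nth y k))"
  using summable_Re[OF summable_ell2_cinner[of x y]] by (simp add: Re_cinner)

instantiation ell2 :: (complex_inner) real_vector
begin

lift_definition zero_ell2 :: "'a ell2" is "\<lambda>_. 0"
  by simp

lift_definition plus_ell2 :: "'a ell2 \<Rightarrow> 'a ell2 \<Rightarrow> 'a ell2" is "\<lambda>f g k. f k + g k"
  by (rule summable_ell2_add)

lift_definition uminus_ell2 :: "'a ell2 \<Rightarrow> 'a ell2" is "\<lambda>f k. - f k"
  by simp

definition minus_ell2 :: "'a ell2 \<Rightarrow> 'a ell2 \<Rightarrow> 'a ell2"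
  where "minus_ell2 x y = x + (- y)"

lift_definition scaleR_ell2 :: "real \<Rightarrow> 'a ell2 \<Rightarrow> 'a ell2" is "\<lambda>r f k. r *\<^sub>R f k"
  by (simp add: power_mult_distrib summable_mult)

instance
proof
  fix x y z :: "'a ell2" and r s :: real
  show "x + y + z = x + (y + z)" by transfer (simp add: add.assoc)
  show "x + y = y + x" by transfer (simp add: add.commute)
  show "0 + x = x" by transfer simp
  show "- x + x = 0" by transfer simp
  show "x - y = x + - y" by (rule minus_ell2_def)
  show "r *\<^sub>R (x + y) = r *\<^sub>R x + r *\<^sub>R y" by transfer (simp add: scaleR_add_right)
  show "(r + s) *\<^sub>R x = r *\<^sub>R x + s *\<^sub>R x" by transfer (simp add: scaleR_add_left)
  show "r *\<^sub>R s *\<^sub>R x = (r * s) *\<^sub>R x" by transfer simp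
  show "1 *\<^sub>R x = x" by transfer simp
qed

end

instantiation ell2 :: (complex_inner) complex_inner
begin

lift_definition scaleC_ell2 :: "complex \<Rightarrow> 'a ell2 \<Rightarrow> 'a ell2" is "\<lambda>a f k. a *\<^sub>C f k"
  by (simp add: norm_scaleC power_mult_distrib summable_mult)

definition cinner_ell2 :: "'a ell2 \<Rightarrow> 'a ell2 \<Rightarrow> complex"
  where "cinner_ell2 x y = (\<Sum>k. cinner (ell2_nth x k) (ell2_nth y k))"

definition inner_ell2 :: "'a ell2 \<Rightarrow> 'a ell2 \<Rightarrow> real"
  where "inner_ell2 x y = (\<Sum>k. inner (ell2_nth x k) (ell2_nth y k))"

definition norm_ell2 :: "'a ell2 \<Rightarrow> real"
  where "norm_ell2 x = sqrt (inner x x)"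

definition sgn_ell2 :: "'a ell2 \<Rightarrow> 'a ell2"
  where "sgn_ell2 x = x /\<^sub>R norm x"

definition dist_ell2 :: "'a ell2 \<Rightarrow> 'a ell2 \<Rightarrow> real"
  where "dist_ell2 x y = norm (x - y)"

definition uniformity_ell2 :: "('a ell2 \<times> 'a ell2) filter"
  where "uniformity_ell2 = (INF e\<in>{0 <..}. principal {(x, y). dist x y < e})"

definition open_ell2 :: "'a ell2 set \<Rightarrow> bool"
  where "open_ell2 U = (\<forall>x\<in>U. \<forall>\<^sub>F (x', y) in uniformity. x' = x \<longrightarrow> y \<in> U)"

instance
proof
  fix x y z :: "'a ell2" and r s :: real and a b :: complex
  note nth = zero_ell2.rep_eq plus_ell2.rep_eq uminus_ell2.rep_eq scaleR_ell2.rep_eq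
    scaleC_ell2.rep_eq
  show "sgn x = x /\<^sub>R norm x" by (rule sgn_ell2_def)
  show "dist x y = norm (x - y)" by (rule dist_ell2_def)
  show "(uniformity :: ('a ell2 \<times> 'a ell2) filter) = (INF e\<in>{0 <..}. principal {(x, y). dist x y < e})"
    by (rule uniformity_ell2_def)
  show "open U = (\<forall>x\<in>U. \<forall>\<^sub>F (x', y) in uniformity. x' = x \<longrightarrow> y \<in> U)" for U :: "'a ell2 set"
    by (rule open_ell2_def)
  show "inner x y = inner y x"
    by (simp add: inner_ell2_def inner_commute)
  show "inner (x + y) z = inner x z + inner y z"
    by (simp add: inner_ell2_def nth inner_add_left suminf_add summable_ell2_inner)
  show "inner (r *\<^sub>R x) y = r * inner x y"
    by (simp add: inner_ell2_def nth suminf_mult summable_ell2_inner)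
  show "0 \<le> inner x x"
    by (simp add: inner_ell2_def suminf_nonneg summable_ell2_inner)
  show "inner x x = 0 \<longleftrightarrow> x = 0"
  proof -
    have "inner x x = 0 \<longleftrightarrow> (\<forall>k. inner (ell2_nth x k) (ell2_nth x k) = 0)"
      unfolding inner_ell2_def by (rule suminf_eq_zero_iff) (simp_all add: summable_ell2_inner)
    also have "\<dots> \<longleftrightarrow> x = 0"
      by (simp add: ell2_nth_inject[symmetric] nth fun_eq_iff)
    finally show ?thesis .
  qed
  show "norm x = sqrt (inner x x)" by (rule norm_ell2_def)
  show "a *\<^sub>C (x + y) = a *\<^sub>C x + a *\<^sub>C y" by transfer (simp add: scaleC_add_right)
  show "(a + b) *\<^sub>C x = a *\<^sub>C x + b *\<^sub>C x" by transfer (simp add: scaleC_add_left)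
  show "a *\<^sub>C b *\<^sub>C x = (a * b) *\<^sub>C x" by transfer (simp add: scaleC_scaleC)
  show "complex_of_real r *\<^sub>C x = r *\<^sub>R x" by transfer (simp add: scaleC_of_real)
  show "cinner x y = cnj (cinner y x)"
  proof -
    have "(\<lambda>k. cnj (cinner (ell2_nth y k) (ell2_nth x k))) sums cnj (cinner y x)"
      unfolding cinner_ell2_def sums_cnj by (rule summable_sums[OF summable_ell2_cinner])
    then show ?thesis
      by (simp add: cinner_ell2_def sums_iff flip: cinner_commute)
  qed
  show "cinner (x + y) z = cinner x z + cinner y z"
    by (simp add: cinner_ell2_def nth cinner_add_left suminf_add summable_ell2_cinner)
  show "cinner (a *\<^sub>C x) y = a * cinner x y"
    by (simp add: cinner_ell2_def nth cinner_scaleC_left suminf_mult summable_ell2_cinner)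
  show "Re (cinner x y) = inner x y"
    by (simp add: cinner_ell2_def inner_ell2_def Re_suminf summable_ell2_cinner Re_cinner)
qed

end

lemma norm_ell2_nth_le: "norm (ell2_nth x k) \<le> norm x"
proof -
  have "inner (ell2_nth x k) (ell2_nth x k) \<le> (\<Sum>k. inner (ell2_nth x k) (ell2_nth x k))"
    using sum_le_suminf[OF summable_ell2_inner[of x x], of "{k}"] by simp
  then show ?thesis
    by (simp add: norm_eq_sqrt_inner inner_ell2_def)
qed

lift_definition ell2_coord :: "nat \<Rightarrow> 'a::complex_inner ell2 \<Rightarrow>\<^sub>L 'a" is "\<lambda>k x. ell2_nth x k"
  by (rule bounded_linear_intro[where K = 1])
    (simp_all add: plus_ell2.rep_eq scaleR_ell2.rep_eq norm_ell2_nth_le)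

lift_definition ell2_single :: "nat \<Rightarrow> 'a::complex_inner \<Rightarrow> 'a ell2"
  is "\<lambda>k a j. if j = k then a else 0"
  by (rule summable_finite[where N = "{k}" for k]) auto

lift_definition ell2_embed :: "nat \<Rightarrow> 'a::complex_inner \<Rightarrow>\<^sub>L 'a ell2" is ell2_single
proof (rule bounded_linear_intro[where K = 1])
  fix k and x y :: 'a and r
  show "ell2_single k (x + y) = ell2_single k x + ell2_single k y"
    by transfer auto
  show "ell2_single k (r *\<^sub>R x) = r *\<^sub>R ell2_single k x"
    by transfer auto
  have "inner (ell2_single k x) (ell2_single k x) = (\<Sum>j. if j = k then inner x x else 0)"
    unfolding inner_ell2_def ell2_single.rep_eq by (intro suminf_cong) simp
  also have "\<dots> = inner x x"
    by (subst suminf_finite[of "{k}"]) auto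
  finally show "norm (ell2_single k x) \<le> norm x * 1"
    by (simp add: norm_eq_sqrt_inner)
qed


section \<open>Operators between closed subspaces\<close>

instantiation blinfun :: (real_normed_vector, complex_inner) scaleC
begin

lift_definition scaleC_blinfun :: "complex \<Rightarrow> 'a \<Rightarrow>\<^sub>L 'b \<Rightarrow> 'a \<Rightarrow>\<^sub>L 'b" is "\<lambda>a f x. a *\<^sub>C f x"
  by (rule bounded_linear_compose[OF bounded_linear_scaleC])

instance ..

end

text \<open>A bounded operator from a closed subspace \<open>L\<^sub>1\<close> to a closed subspace \<open>L\<^sub>2\<close> is represented by
  its extension by zero to the orthogonal complement of \<open>L\<^sub>1\<close>, with \<open>L\<^sub>2\<close> included into its ambient
  space. Norms, composition and adjoints are preserved by this, and the identity operator of
  \<open>L\<close> is represented by the orthogonal projection \<open>proj L\<close>.\<close>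

definition operators ::
    "'a::complex_inner set \<Rightarrow> 'b::complex_inner set \<Rightarrow> ('a \<Rightarrow>\<^sub>L 'b) set" where
  "operators L\<^sub>1 L\<^sub>2 = {X. (\<forall>c x. blinfun_apply X (c *\<^sub>C x) = c *\<^sub>C blinfun_apply X x)
      \<and> (\<forall>x\<in>L\<^sub>1. blinfun_apply X x \<in> L\<^sub>2)
      \<and> (\<forall>x. (\<forall>y\<in>L\<^sub>1. cinner x y = 0) \<longrightarrow> blinfun_apply X x = 0)}"

definition proj :: "'a::complex_inner set \<Rightarrow> 'a \<Rightarrow>\<^sub>L 'a" where
  "proj L = (THE P. \<forall>x. blinfun_apply P x \<in> L \<and> (\<forall>y\<in>L. cinner (x - blinfun_apply P x) y = 0))"

definition adj :: "('a::complex_inner \<Rightarrow>\<^sub>L 'b::complex_inner) \<Rightarrow> 'b \<Rightarrow>\<^sub>L 'a" where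
  "adj X = (THE Y. \<forall>x y. cinner (blinfun_apply X x) y = cinner x (blinfun_apply Y y))"

definition positive_op :: "('a::complex_inner \<Rightarrow>\<^sub>L 'a) \<Rightarrow> bool" where
  "positive_op X \<longleftrightarrow> (\<forall>x y. cinner (blinfun_apply X x) y = cinner x (blinfun_apply X y))
      \<and> (\<forall>x. 0 \<le> Re (cinner (blinfun_apply X x) x))"

definition sqrt_op :: "('a::complex_inner \<Rightarrow>\<^sub>L 'a) \<Rightarrow> 'a \<Rightarrow>\<^sub>L 'a" where
  "sqrt_op X = (THE R. positive_op R \<and> R o\<^sub>L R = X)"

definition is_inverse_on ::
    "'a::complex_inner set \<Rightarrow> ('a \<Rightarrow>\<^sub>L 'a) \<Rightarrow> ('a \<Rightarrow>\<^sub>L 'a) \<Rightarrow> bool" where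
  "is_inverse_on L X Y \<longleftrightarrow> Y \<in> operators L L \<and> X o\<^sub>L Y = proj L \<and> Y o\<^sub>L X = proj L"

definition invertible_on :: "'a::complex_inner set \<Rightarrow> ('a \<Rightarrow>\<^sub>L 'a) \<Rightarrow> bool" where
  "invertible_on L X \<longleftrightarrow> X \<in> operators L L \<and> (\<exists>Y. is_inverse_on L X Y)"

definition inverse_on :: "'a::complex_inner set \<Rightarrow> ('a \<Rightarrow>\<^sub>L 'a) \<Rightarrow> 'a \<Rightarrow>\<^sub>L 'a" where
  "inverse_on L X = (THE Y. is_inverse_on L X Y)"

definition row_op ::
    "('a::complex_inner \<Rightarrow>\<^sub>L 'c::complex_inner) \<Rightarrow> ('b::complex_inner \<Rightarrow>\<^sub>L 'c) \<Rightarrow> ('a \<times> 'b) \<Rightarrow>\<^sub>L 'c" where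
  "row_op A B = (A o\<^sub>L fst_blinfun) + (B o\<^sub>L snd_blinfun)"

lift_definition inl_op :: "'a::complex_inner \<Rightarrow>\<^sub>L ('a \<times> 'b::complex_inner)" is "\<lambda>x. (x, 0)"
  by (intro bounded_linear_Pair bounded_linear_ident bounded_linear_zero)

lift_definition inr_op :: "'b::complex_inner \<Rightarrow>\<^sub>L ('a::complex_inner \<times> 'b)" is "\<lambda>y. (0, y)"
  by (intro bounded_linear_Pair bounded_linear_ident bounded_linear_zero)

text \<open>The block operator with rows \<open>(A, B)\<close> and \<open>(C, D)\<close>.\<close>

definition block_op ::
    "('a::complex_inner \<Rightarrow>\<^sub>L 'c::complex_inner) \<Rightarrow> ('b::complex_inner \<Rightarrow>\<^sub>L 'c)
      \<Rightarrow> ('a \<Rightarrow>\<^sub>L 'd::complex_inner) \<Rightarrow> ('b \<Rightarrow>\<^sub>L 'd) \<Rightarrow> ('a \<times> 'b) \<Rightarrow>\<^sub>L ('c \<times> 'd)" where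
  "block_op A B C D = (inl_op o\<^sub>L row_op A B) + (inr_op o\<^sub>L row_op C D)"

lemma block_op_apply:
  "blinfun_apply (block_op A B C D) (x, y) =
    (blinfun_apply A x + blinfun_apply B y, blinfun_apply C x + blinfun_apply D y)"
  by (simp add: block_op_def row_op_def blinfun.add_left inl_op.rep_eq inr_op.rep_eq)

text \<open>The defect operator \<open>D\<^sub>T = (I - T\<^sup>* T)\<^sup>1\<^sup>/\<^sup>2\<close> and the defect space of a contraction \<open>T\<close> whose domain
  is the subspace \<open>L\<close>; it depends on \<open>L\<close>, as \<open>I\<close> is the identity of \<open>L\<close>.\<close>

definition defect_op ::
    "'a::complex_inner set \<Rightarrow> ('a \<Rightarrow>\<^sub>L 'b::complex_inner) \<Rightarrow> 'a \<Rightarrow>\<^sub>L 'a" where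
  "defect_op L T = sqrt_op (proj L - (adj T o\<^sub>L T))"

definition defect_space ::
    "'a::complex_inner set \<Rightarrow> ('a \<Rightarrow>\<^sub>L 'b::complex_inner) \<Rightarrow> 'a set" where
  "defect_space L T = closure (range (blinfun_apply (defect_op L T)))"


section \<open>Schur class and Schur algorithm\<close>

text \<open>Holomorphy is complex differentiability in operator norm. Values outside the open unit disk
  are irrelevant.\<close>

definition schur_class ::
    "'a::complex_inner set \<Rightarrow> 'b::complex_inner set \<Rightarrow> (complex \<Rightarrow> 'a \<Rightarrow>\<^sub>L 'b) set" where
  "schur_class L\<^sub>1 L\<^sub>2 = {\<Theta>. \<forall>z\<in>ball 0 1. \<Theta> z \<in> operators L\<^sub>1 L\<^sub>2 \<and> norm (\<Theta> z) \<le> 1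
      \<and> (\<exists>D. ((\<lambda>w. inverse (w - z) *\<^sub>C (\<Theta> w - \<Theta> z)) \<longlongrightarrow> D) (at z))}"

text \<open>For Schur parameters \<open>\<Gamma>\<close>, all defect spaces lie in the spaces \<open>M\<close> and \<open>N\<close>, which are the types
  \<open>'m\<close> and \<open>'n\<close>. The operator \<open>\<Gamma> k\<close> maps \<open>dom_space \<Gamma> k\<close> to \<open>cod_space \<Gamma> k\<close>; hence
  \<open>dom_space \<Gamma> (Suc k)\<close> is the defect space of \<open>\<Gamma> k\<close> and \<open>cod_space \<Gamma> (Suc k)\<close> that of its adjoint.\<close>

primrec dom_space :: "(nat \<Rightarrow> 'm::complex_inner \<Rightarrow>\<^sub>L 'n::complex_inner) \<Rightarrow> nat \<Rightarrow> 'm set" where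
  "dom_space \<Gamma> 0 = UNIV"
| "dom_space \<Gamma> (Suc k) = defect_space (dom_space \<Gamma> k) (\<Gamma> k)"

primrec cod_space :: "(nat \<Rightarrow> 'm::complex_inner \<Rightarrow>\<^sub>L 'n::complex_inner) \<Rightarrow> nat \<Rightarrow> 'n set" where
  "cod_space \<Gamma> 0 = UNIV"
| "cod_space \<Gamma> (Suc k) = defect_space (cod_space \<Gamma> k) (adj (\<Gamma> k))"

definition defect :: "(nat \<Rightarrow> 'm::complex_inner \<Rightarrow>\<^sub>L 'n::complex_inner) \<Rightarrow> nat \<Rightarrow> 'm \<Rightarrow>\<^sub>L 'm" where
  "defect \<Gamma> k = defect_op (dom_space \<Gamma> k) (\<Gamma> k)"

definition codefect :: "(nat \<Rightarrow> 'm::complex_inner \<Rightarrow>\<^sub>L 'n::complex_inner) \<Rightarrow> nat \<Rightarrow> 'n \<Rightarrow>\<^sub>L 'n" where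
  "codefect \<Gamma> k = defect_op (cod_space \<Gamma> k) (adj (\<Gamma> k))"

text \<open>\<open>\<Theta>s k\<close> is the \<open>k\<close>-th associated function and \<open>\<Gamma> k\<close> the \<open>k\<close>-th Schur parameter of \<open>\<Theta>\<close>;
  these are determined by \<open>\<Theta>\<close> (on the unit disk).\<close>

definition schur_algorithm ::
    "(complex \<Rightarrow> 'm::complex_inner \<Rightarrow>\<^sub>L 'n::complex_inner)
      \<Rightarrow> (nat \<Rightarrow> complex \<Rightarrow> 'm \<Rightarrow>\<^sub>L 'n) \<Rightarrow> (nat \<Rightarrow> 'm \<Rightarrow>\<^sub>L 'n) \<Rightarrow> bool" where
  "schur_algorithm \<Theta> \<Theta>s \<Gamma> \<longleftrightarrow> \<Theta>s 0 = \<Theta>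
    \<and> (\<forall>k. \<Gamma> k = \<Theta>s k 0)
    \<and> (\<forall>k. \<Theta>s (Suc k) \<in> schur_class (dom_space \<Gamma> (Suc k)) (cod_space \<Gamma> (Suc k)))
    \<and> (\<forall>k. \<forall>z\<in>ball 0 1. \<Theta>s k z = \<Gamma> k +
        z *\<^sub>C (codefect \<Gamma> k o\<^sub>L \<Theta>s (Suc k) z
          o\<^sub>L inverse_on (dom_space \<Gamma> (Suc k))
              (proj (dom_space \<Gamma> (Suc k)) + z *\<^sub>C (adj (\<Gamma> k) o\<^sub>L \<Theta>s (Suc k) z))
          o\<^sub>L defect \<Gamma> k))"


section \<open>The truncated CMV-type operator and its transfer functions\<close>

text \<open>The operator \<open>-\<Gamma>\<^sub>k\<^sup>*\<close> in the lower right corner acts on the defect space of \<open>\<Gamma>\<^sub>k\<^sup>*\<close> only.\<close>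

definition neg_adj_restrict ::
    "(nat \<Rightarrow> 'm::complex_inner \<Rightarrow>\<^sub>L 'n::complex_inner) \<Rightarrow> nat \<Rightarrow> 'n \<Rightarrow>\<^sub>L 'm" where
  "neg_adj_restrict \<Gamma> k = - (adj (\<Gamma> k) o\<^sub>L proj (cod_space \<Gamma> (Suc k)))"

definition elementary_rotation ::
    "(nat \<Rightarrow> 'm::complex_inner \<Rightarrow>\<^sub>L 'n::complex_inner) \<Rightarrow> nat \<Rightarrow> ('m \<times> 'n) \<Rightarrow>\<^sub>L ('n \<times> 'm)" where
  "elementary_rotation \<Gamma> k =
    block_op (\<Gamma> k) (codefect \<Gamma> k) (defect \<Gamma> k) (neg_adj_restrict \<Gamma> k)"

text \<open>The summands are numbered from \<open>0\<close> to \<open>n\<close>: \<open>H_space \<Gamma> j\<close> is the summand usually numbered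
  \<open>j + 1\<close>.\<close>

definition H_space ::
    "(nat \<Rightarrow> 'm::complex_inner \<Rightarrow>\<^sub>L 'n::complex_inner) \<Rightarrow> nat \<Rightarrow> ('m \<times> 'n) set" where
  "H_space \<Gamma> j = dom_space \<Gamma> (2 * j) \<times> cod_space \<Gamma> (Suc (2 * j))"

definition K_space ::
    "(nat \<Rightarrow> 'm::complex_inner \<Rightarrow>\<^sub>L 'n::complex_inner) \<Rightarrow> nat \<Rightarrow> ('m \<times> 'n) ell2 set" where
  "K_space \<Gamma> n = {h. (\<forall>j\<le>n. ell2_nth h j \<in> H_space \<Gamma> j) \<and> (\<forall>j>n. ell2_nth h j = 0)}"

definition even_factor ::
    "(nat \<Rightarrow> 'm::complex_inner \<Rightarrow>\<^sub>L 'n::complex_inner) \<Rightarrow> nat \<Rightarrow> ('m \<times> 'n) ell2 \<Rightarrow>\<^sub>L ('n \<times> 'm) ell2" where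
  "even_factor \<Gamma> n =
    (\<Sum>j\<le>n. ell2_embed j o\<^sub>L elementary_rotation \<Gamma> (2 * j) o\<^sub>L ell2_coord j)"

text \<open>The rotation with index \<open>2 k - 1\<close> acts across two neighbouring summands: its arguments are
  the second component at position \<open>k - 1\<close> and the first component at position \<open>k\<close>, and likewise
  for its values. The first component at position \<open>0\<close> and the second component at position \<open>n\<close> are
  mapped to zero.\<close>

definition odd_factor ::
    "(nat \<Rightarrow> 'm::complex_inner \<Rightarrow>\<^sub>L 'n::complex_inner) \<Rightarrow> nat \<Rightarrow> ('n \<times> 'm) ell2 \<Rightarrow>\<^sub>L ('m \<times> 'n) ell2" where
  "odd_factor \<Gamma> n =
    (\<Sum>k\<in>{1..n}.
      row_op (ell2_embed (k - 1) o\<^sub>L inr_op) (ell2_embed k o\<^sub>L inl_op)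
      o\<^sub>L elementary_rotation \<Gamma> (2 * k - 1)
      o\<^sub>L ((inl_op o\<^sub>L snd_blinfun o\<^sub>L ell2_coord (k - 1)) + (inr_op o\<^sub>L fst_blinfun o\<^sub>L ell2_coord k)))"

definition S_op ::
    "(nat \<Rightarrow> 'm::complex_inner \<Rightarrow>\<^sub>L 'n::complex_inner) \<Rightarrow> nat \<Rightarrow> ('m \<times> 'n) ell2 \<Rightarrow>\<^sub>L ('m \<times> 'n) ell2" where
  "S_op \<Gamma> n = odd_factor \<Gamma> n o\<^sub>L even_factor \<Gamma> n"

definition R_op ::
    "(nat \<Rightarrow> 'm::complex_inner \<Rightarrow>\<^sub>L 'n::complex_inner) \<Rightarrow> nat \<Rightarrow> complex
      \<Rightarrow> ('m \<times> 'n) ell2 \<Rightarrow>\<^sub>L ('m \<times> 'n) ell2" where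
  "R_op \<Gamma> n z = inverse_on (K_space \<Gamma> n) (proj (K_space \<Gamma> n) - z *\<^sub>C S_op \<Gamma> n)"

text \<open>Here \<open>ell2_embed 0 o\<^sub>L inl_op\<close> and \<open>ell2_embed n o\<^sub>L inr_op\<close> embed \<open>M\<close> and the defect space of
  \<open>\<Gamma>\<^sub>2\<^sub>n\<^sup>*\<close> as the first and last summand of \<open>K_space \<Gamma> n\<close>, and \<open>ell2_coord\<close> is the projection onto
  a summand.\<close>

definition theta_fun ::
    "(nat \<Rightarrow> 'm::complex_inner \<Rightarrow>\<^sub>L 'n::complex_inner) \<Rightarrow> nat \<Rightarrow> complex \<Rightarrow> 'm \<Rightarrow>\<^sub>L 'n" where
  "theta_fun \<Gamma> n z = row_op (\<Gamma> 0) (codefect \<Gamma> 0)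
    o\<^sub>L (ell2_coord 0 o\<^sub>L R_op \<Gamma> n z o\<^sub>L (ell2_embed 0 o\<^sub>L inl_op))"

definition a_fun ::
    "(nat \<Rightarrow> 'm::complex_inner \<Rightarrow>\<^sub>L 'n::complex_inner) \<Rightarrow> nat \<Rightarrow> complex \<Rightarrow> 'n \<Rightarrow>\<^sub>L 'm" where
  "a_fun \<Gamma> n z = z *\<^sub>C (row_op (defect \<Gamma> (2 * n)) (neg_adj_restrict \<Gamma> (2 * n))
    o\<^sub>L (ell2_coord n o\<^sub>L R_op \<Gamma> n z o\<^sub>L (ell2_embed n o\<^sub>L inr_op)))"

definition b_fun ::
    "(nat \<Rightarrow> 'm::complex_inner \<Rightarrow>\<^sub>L 'n::complex_inner) \<Rightarrow> nat \<Rightarrow> complex \<Rightarrow> 'm \<Rightarrow>\<^sub>L 'm" where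
  "b_fun \<Gamma> n z = z *\<^sub>C (row_op (defect \<Gamma> (2 * n)) (neg_adj_restrict \<Gamma> (2 * n))
    o\<^sub>L (ell2_coord n o\<^sub>L R_op \<Gamma> n z o\<^sub>L (ell2_embed 0 o\<^sub>L inl_op)))"

definition c_fun ::
    "(nat \<Rightarrow> 'm::complex_inner \<Rightarrow>\<^sub>L 'n::complex_inner) \<Rightarrow> nat \<Rightarrow> complex \<Rightarrow> 'n \<Rightarrow>\<^sub>L 'n" where
  "c_fun \<Gamma> n z = row_op (\<Gamma> 0) (codefect \<Gamma> 0)
    o\<^sub>L (ell2_coord 0 o\<^sub>L R_op \<Gamma> n z o\<^sub>L (ell2_embed n o\<^sub>L inr_op))"

definition q_fun ::
    "(nat \<Rightarrow> 'm::complex_inner \<Rightarrow>\<^sub>L 'n::complex_inner) \<Rightarrow> nat \<Rightarrow> complex \<Rightarrow> ('m \<times> 'n) \<Rightarrow>\<^sub>L ('n \<times> 'm)" where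
  "q_fun \<Gamma> n z = block_op (theta_fun \<Gamma> n z) (c_fun \<Gamma> n z) (b_fun \<Gamma> n z) (a_fun \<Gamma> n z)"

end

theory Submission
  imports Defs
begin

text \<open>
  A linear system with state operator \<open>S\<close> lies behind the function \<open>q\<^sub>n(z)\<close>: a pair \<open>g = (h, w)\<close> is
  put into the first component of the first summand and the second component of the last summand
  of \<open>K\<close>, the state \<open>x\<close> solves \<open>x = g + z S x\<close>, and the output consists of the two entries of the
  image of \<open>x\<close> under the even rotations that the odd factor annihilates, the second one multiplied
  by \<open>z\<close> (\<open>q_fun_apply\<close>).

  The rotations are contractive on the whole space. Hence the energy of \<open>S x\<close> and of the two unscaled
  output entries together is at most that of \<open>x\<close> (\<open>S_op_energy\<close>). In particular \<open>S\<close> is a contraction,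
  which makes \<open>I - z S\<close> invertible for \<open>|z| < 1\<close>. As \<open>S x\<close> is orthogonal to the input \<open>g\<close>, the
  energy balance yields that \<open>q\<^sub>n(z)\<close> is a contraction and that \<open>\<parallel>a\<^sub>n(z)\<parallel> \<le> |z|\<close>
  (\<open>output_energy\<close>, \<open>norm_q_fun_le\<close>). Holomorphy comes from the resolvent identity.

  A step of the Schur algorithm is a feedback connection: \<open>\<Theta>\<^sub>k(z)\<close> is obtained from the rotation of
  \<open>\<Gamma>\<^sub>k\<close> by returning its second output through \<open>z \<Theta>\<^sub>k\<^sub>+\<^sub>1(z)\<close> to its second input. Starting with \<open>h\<close>,
  let \<open>x\<^sub>0 = h\<close> and let \<open>x\<^sub>k\<^sub>+\<^sub>1\<close> be this second output when the first input is \<open>x\<^sub>k\<close>; the first output is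
  then \<open>\<Theta>\<^sub>k(z) x\<^sub>k\<close> (\<open>rotation_schur_state\<close>). The vector with the components
  \<open>z\<^sup>j x\<^sub>2\<^sub>j\<close> and \<open>z\<^sup>j\<^sup>+\<^sup>1 \<Theta>\<^sub>2\<^sub>j\<^sub>+\<^sub>1(z) x\<^sub>2\<^sub>j\<^sub>+\<^sub>1\<close> solves the state equation for an input \<open>(h, w)\<close>, and
  the output is \<open>(\<Theta>(z) h, y)\<close> with \<open>w = \<Theta>\<^sub>2\<^sub>n\<^sub>+\<^sub>1(z) y\<close> (\<open>transfer_with_feedback\<close>). So
  \<open>\<Theta>(z) h = \<theta> h + c w\<close> and \<open>y = b h + a w\<close>. Eliminating \<open>w\<close> and \<open>y\<close>, which is possible because
  \<open>\<parallel>a\<parallel> \<le> |z| < 1\<close>, gives both formulas.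

  The operators in the statement are defined by description, so the argument needs the existence and
  uniqueness of orthogonal projections, adjoints and positive square roots. The first two come from
  a Riesz representation lemma on complete subspaces. The root of \<open>I - X\<close> comes from the iteration
  \<open>T \<mapsto> (X + T\<^sup>2) / 2\<close>, which also shows that square roots inherit intertwining relations. These give
  \<open>\<Gamma>\<^sup>* D\<^sub>\<Gamma>\<^sub>* = D\<^sub>\<Gamma> \<Gamma>\<^sup>*\<close>, the reason why the rotations are contractive and respect the defect spaces.
\<close>


section \<open>Complex linearity and orthogonality\<close>

lemma scaleC_one [simp]: "1 *\<^sub>C x = (x::'a::complex_inner)"
  using scaleC_of_real[of 1 x] by simp

lemma scaleC_zero_left [simp]: "0 *\<^sub>C x = (0::'a::complex_inner)"
  using scaleC_of_real[of 0 x] by simp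

lemma scaleC_zero_right [simp]: "a *\<^sub>C 0 = (0::'a::complex_inner)"
  by (metis linear_0 bounded_linear.linear bounded_linear_scaleC)

lemma scaleC_minus_right [simp]: "a *\<^sub>C (- x) = - (a *\<^sub>C (x::'a::complex_inner))"
  by (metis linear_neg bounded_linear.linear bounded_linear_scaleC)

lemma scaleC_diff_right: "a *\<^sub>C (x - y) = a *\<^sub>C x - a *\<^sub>C (y::'a::complex_inner)"
  by (metis linear_diff bounded_linear.linear bounded_linear_scaleC)

lemma scaleC_minus_left [simp]: "(- a) *\<^sub>C x = - (a *\<^sub>C (x::'a::complex_inner))"
  using scaleC_add_left[of a "- a" x] by (simp add: eq_neg_iff_add_eq_0 add.commute)

lemma scaleC_diff_left: "(a - b) *\<^sub>C x = a *\<^sub>C x - b *\<^sub>C (x::'a::complex_inner)"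
  using scaleC_add_left[of a "- b" x] by simp

lemma cinner_add_right: "cinner x (y + z) = cinner x y + cinner x z"
  by (metis cinner_add_left cinner_commute complex_cnj_add)

lemma cinner_scaleC_right: "cinner x (a *\<^sub>C y) = cnj a * cinner x y"
  by (metis cinner_scaleC_left cinner_commute complex_cnj_mult)

lemma cinner_zero_left [simp]: "cinner 0 y = 0"
  using cinner_add_left[of 0 0 y] by simp

lemma cinner_zero_right [simp]: "cinner x 0 = 0"
  using cinner_add_right[of x 0 0] by simp

lemma cinner_minus_left: "cinner (- x) y = - cinner x y"
  using cinner_add_left[of x "- x" y] by (simp add: eq_neg_iff_add_eq_0 add.commute)

lemma cinner_minus_right: "cinner x (- y) = - cinner x y"
  using cinner_add_right[of x y "- y"] by (simp add: eq_neg_iff_add_eq_0 add.commute)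

lemma cinner_diff_left: "cinner (x - y) z = cinner x z - cinner y z"
  using cinner_add_left[of x "- y" z] by (simp add: cinner_minus_left)

lemma cinner_diff_right: "cinner x (y - z) = cinner x y - cinner x z"
  using cinner_add_right[of x y "- z"] by (simp add: cinner_minus_right)

lemma cinner_self_eq_zero [simp]: "cinner x x = 0 \<longleftrightarrow> x = 0"
  by (simp add: cinner_self)

lemma eq_if_cinner_eq:
  assumes "\<And>z. cinner z x = cinner z y"
  shows "x = y"
  using assms[of "x - y"] by (metis cinner_diff_right cinner_self_eq_zero eq_iff_diff_eq_0)

lemma Im_cinner: "Im (cinner x y) = inner (- \<i> *\<^sub>C x) y"
  by (simp add: Re_cinner[symmetric] cinner_minus_left cinner_scaleC_left)

definition complex_linear :: "('a::complex_inner \<Rightarrow>\<^sub>L 'b::complex_inner) \<Rightarrow> bool"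
  where "complex_linear X \<longleftrightarrow> (\<forall>c x. X (c *\<^sub>C x) = c *\<^sub>C X x)"

lemma complex_linearD: "complex_linear X \<Longrightarrow> X (c *\<^sub>C x) = c *\<^sub>C X x"
  by (simp add: complex_linear_def)

lemma scaleC_blinfun_apply [simp]: "blinfun_apply (c *\<^sub>C X) x = c *\<^sub>C blinfun_apply X x"
  by (simp add: scaleC_blinfun.rep_eq)

lemma complex_linear_compose:
  "complex_linear X \<Longrightarrow> complex_linear Y \<Longrightarrow> complex_linear (X o\<^sub>L Y)"
  by (simp add: complex_linear_def)

lemma complex_linear_add:
  "complex_linear X \<Longrightarrow> complex_linear Y \<Longrightarrow> complex_linear (X + Y)"
  by (simp add: complex_linear_def blinfun.add_left scaleC_add_right)

lemma complex_linear_diff: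
  "complex_linear X \<Longrightarrow> complex_linear Y \<Longrightarrow> complex_linear (X - Y)"
  by (simp add: complex_linear_def blinfun.diff_left scaleC_diff_right)

lemma complex_linear_minus: "complex_linear X \<Longrightarrow> complex_linear (- X)"
  by (simp add: complex_linear_def blinfun.minus_left)

lemma complex_linear_zero: "complex_linear 0"
  by (simp add: complex_linear_def)

lemma complex_linear_scaleC: "complex_linear X \<Longrightarrow> complex_linear (a *\<^sub>C X)"
  by (simp add: complex_linear_def scaleC_scaleC mult.commute)

lemma complex_linear_sum:
  "(\<And>i. i \<in> I \<Longrightarrow> complex_linear (F i)) \<Longrightarrow> complex_linear (sum F I)"
  by (induction I rule: infinite_finite_induct) (simp_all add: complex_linear_zero complex_linear_add)

lemmas complex_linear_intros = complex_linear_compose complex_linear_add complex_linear_diff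
  complex_linear_minus complex_linear_zero complex_linear_scaleC complex_linear_sum

lemma blinfun_eq_iff: "X = Y \<longleftrightarrow> (\<forall>x. blinfun_apply X x = blinfun_apply Y x)"
  by (auto intro: blinfun_eqI)

text \<open>The class \<open>banach\<close> makes the bounded operators on the space complete in norm.\<close>

class chilbert_space = complex_inner + complete_space
begin

subclass banach ..

end

subclass (in separable_chilbert_space) chilbert_space ..

text \<open>Completeness is required of the subspace itself, so that the notion also covers subspaces of the
  space of square-summable sequences.\<close>

definition hilbert_subspace :: "'a::complex_inner set \<Rightarrow> bool" where
  "hilbert_subspace L \<longleftrightarrow> complete L \<and> 0 \<in> L \<and> (\<forall>x\<in>L. \<forall>y\<in>L. x + y \<in> L) \<and> (\<forall>c. \<forall>x\<in>L. c *\<^sub>C x \<in> L)"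

lemma hilbert_subspace_complete: "hilbert_subspace L \<Longrightarrow> complete L"
  and hilbert_subspace_zero: "hilbert_subspace L \<Longrightarrow> 0 \<in> L"
  and hilbert_subspace_add: "hilbert_subspace L \<Longrightarrow> x \<in> L \<Longrightarrow> y \<in> L \<Longrightarrow> x + y \<in> L"
  and hilbert_subspace_scaleC: "hilbert_subspace L \<Longrightarrow> x \<in> L \<Longrightarrow> c *\<^sub>C x \<in> L"
  by (simp_all add: hilbert_subspace_def)

lemma hilbert_subspace_subspace:
  assumes "hilbert_subspace L"
  shows "subspace L"
  unfolding subspace_def
  using assms by (metis hilbert_subspace_def scaleC_of_real)

lemma hilbert_subspace_minus: "hilbert_subspace L \<Longrightarrow> x \<in> L \<Longrightarrow> - x \<in> L"
  by (simp add: hilbert_subspace_subspace subspace_neg)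

lemma hilbert_subspace_diff: "hilbert_subspace L \<Longrightarrow> x \<in> L \<Longrightarrow> y \<in> L \<Longrightarrow> x - y \<in> L"
  by (simp add: hilbert_subspace_subspace subspace_diff)

lemma hilbert_subspace_UNIV:
  "hilbert_subspace (UNIV :: 'a::chilbert_space set)"
  by (simp add: hilbert_subspace_def complete_UNIV)

lemma hilbert_subspace_closure_range:
  fixes X :: "'a::complex_inner \<Rightarrow>\<^sub>L 'b::chilbert_space"
  assumes X: "complex_linear X"
  shows "hilbert_subspace (closure (range X))"
proof -
  have "x + y \<in> closure (range X)" if xy: "x \<in> closure (range X)" "y \<in> closure (range X)" for x y
  proof -
    obtain f g where f: "\<And>k. f k \<in> range X" "f \<longlonglongrightarrow> x" and g: "\<And>k. g k \<in> range X" "g \<longlonglongrightarrow> y"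
      using xy unfolding closure_sequential by blast
    have "f k + g k \<in> range X" for k
      using f(1)[of k] g(1)[of k] by (auto simp flip: blinfun.add_right)
    moreover have "(\<lambda>k. f k + g k) \<longlonglongrightarrow> x + y"
      by (intro tendsto_add f g)
    ultimately show ?thesis unfolding closure_sequential by (intro exI[of _ "\<lambda>k. f k + g k"]) blast
  qed
  moreover have "c *\<^sub>C x \<in> closure (range X)" if "x \<in> closure (range X)" for c x
  proof -
    have "(\<lambda>x. c *\<^sub>C x) ` closure (range X) \<subseteq> closure ((\<lambda>x. c *\<^sub>C x) ` range X)"
      by (rule closure_bounded_linear_image_subset[OF bounded_linear_scaleC])
    also have "\<dots> \<subseteq> closure (range X)"
      by (rule closure_mono) (auto simp flip: complex_linearD[OF X])
    finally show ?thesis using that by blast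
  qed
  moreover have "0 \<in> closure (range X)"
    using closure_subset[of "range X"] by (metis blinfun.zero_right rangeI subsetD)
  ultimately show ?thesis
    by (simp add: hilbert_subspace_def complete_eq_closed)
qed

text \<open>A subspace that is closed under multiplication by \<open>\<i>\<close> does not distinguish between
  orthogonality for the complex inner product and for its real part.\<close>

lemma cinner_zero_if_inner_zero:
  assumes L: "hilbert_subspace L" and x: "\<And>y. y \<in> L \<Longrightarrow> inner x y = 0" and y: "y \<in> L"
  shows "cinner x y = 0"
proof (rule complex_eqI)
  show "Re (cinner x y) = Re 0"
    using x[OF y] by (simp add: Re_cinner)
  have "Im (cinner x y) = Re (cinner x (\<i> *\<^sub>C y))"
    by (simp add: cinner_scaleC_right)
  also have "\<dots> = 0"
    using x[OF hilbert_subspace_scaleC[OF L y]] by (simp add: Re_cinner)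
  finally show "Im (cinner x y) = Im 0" by simp
qed


section \<open>Orthogonal projections and adjoints\<close>

lemma linear_term_zero_if_quadratic_nonneg:
  fixes s N :: real
  assumes "\<And>t. 0 \<le> 2 * t * s + t\<^sup>2 * N"
  shows "s = 0"
proof (rule ccontr)
  assume s: "s \<noteq> 0"
  define N' where "N' = \<bar>N\<bar> + 1"
  have N': "N' > 0" "N \<le> N'" by (auto simp: N'_def)
  define t where "t = - s / N'"
  have "0 \<le> 2 * t * s + t\<^sup>2 * N" by (rule assms)
  also have "\<dots> \<le> 2 * t * s + t\<^sup>2 * N'"
    using N' by (intro add_left_mono mult_left_mono) auto
  also have "\<dots> = - (s\<^sup>2 / N')"
    using N' by (simp add: t_def field_simps power2_eq_square)
  also have "\<dots> < 0" using s N' by simp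
  finally show False by simp
qed

text \<open>The functional \<open>\<parallel>x\<parallel>\<^sup>2 - 2 f x\<close> is strongly convex, so by the parallelogram law minimizing
  sequences are Cauchy; the minimizer represents \<open>f\<close>. Both the projection theorem and the
  existence of adjoints are instances.\<close>

lemma riesz_on_complete_subspace:
  fixes f :: "'a::real_inner \<Rightarrow> real"
  assumes f: "bounded_linear f" and sub: "subspace L" and L: "complete L"
  obtains a where "a \<in> L" "\<And>x. x \<in> L \<Longrightarrow> inner x a = f x"
proof -
  interpret f: bounded_linear f by (rule f)
  define J where "J x = (norm x)\<^sup>2 - 2 * f x" for x
  obtain K where K: "\<And>x. norm (f x) \<le> norm x * K"
    using f.pos_bounded by blast
  have lower: "- K\<^sup>2 \<le> J x" for x
  proof -
    have "f x \<le> norm x * K" using K[of x] by simp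
    moreover have "0 \<le> (norm x - K)\<^sup>2" by simp
    ultimately show ?thesis by (simp add: J_def power2_diff)
  qed
  define m where "m = Inf (J ` L)"
  have m_le: "m \<le> J x" if "x \<in> L" for x
    unfolding m_def using that lower by (intro cInf_lower bdd_belowI2[where m = "- K\<^sup>2"]) auto
  have "\<exists>x\<in>L. J x < m + inverse (real (Suc k))" for k
    using cInf_lessD[of "J ` L" "m + inverse (real (Suc k))"] subspace_0[OF sub]
    by (force simp: m_def)
  then obtain x where xL: "\<And>k. x k \<in> L" and Jx: "\<And>k. J (x k) < m + inverse (real (Suc k))"
    by metis
  have dist_le: "(norm (u - v))\<^sup>2 \<le> 2 * (J u + J v - 2 * m)" if "u \<in> L" "v \<in> L" for u v
  proof -
    have "(1/2) *\<^sub>R (u + v) \<in> L"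
      using that sub by (simp add: subspace_add subspace_scale)
    then have "m \<le> J ((1/2) *\<^sub>R (u + v))" by (rule m_le)
    moreover have "J u + J v - 2 * J ((1/2) *\<^sub>R (u + v)) = (norm (u - v))\<^sup>2 / 2"
      unfolding J_def power2_norm_eq_inner
      by (simp add: inner_add inner_diff inner_commute f.add f.scaleR field_simps)
    ultimately show ?thesis by (simp add: field_simps)
  qed
  have "Cauchy x"
  proof (rule CauchyI)
    fix e :: real assume e: "0 < e"
    then obtain N where N: "inverse (real (Suc N)) < e\<^sup>2 / 4"
      using reals_Archimedean[of "e\<^sup>2 / 4"] by auto
    have "norm (x k - x l) < e" if "k \<ge> N" "l \<ge> N" for k l
    proof -
      have small: "J (x i) < m + e\<^sup>2 / 4" if "i \<ge> N" for i
      proof -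
        have "inverse (real (Suc i)) \<le> inverse (real (Suc N))"
          using that by (intro le_imp_inverse_le) auto
        then show ?thesis using Jx[of i] N by linarith
      qed
      have "(norm (x k - x l))\<^sup>2 \<le> 2 * (J (x k) + J (x l) - 2 * m)"
        by (rule dist_le[OF xL xL])
      also have "\<dots> < e\<^sup>2" using small[OF that(1)] small[OF that(2)] by (simp add: field_simps)
      finally show ?thesis using e by (simp add: power_less_imp_less_base)
    qed
    then show "\<exists>M. \<forall>k\<ge>M. \<forall>l\<ge>M. norm (x k - x l) < e" by blast
  qed
  then obtain a where a: "a \<in> L" "x \<longlonglongrightarrow> a"
    using L xL unfolding complete_def by blast
  have "(\<lambda>k. J (x k)) \<longlonglongrightarrow> J a"
    unfolding J_def by (intro tendsto_intros a f.tendsto)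
  moreover have "(\<lambda>k. m + inverse (real (Suc k))) \<longlonglongrightarrow> m"
    using tendsto_add[OF tendsto_const LIMSEQ_inverse_real_of_nat, of m] by simp
  ultimately have Ja: "J a \<le> m"
    by (rule LIMSEQ_le) (use Jx in \<open>auto intro: less_imp_le\<close>)
  have "inner y a = f y" if y: "y \<in> L" for y
  proof -
    have "inner y a - f y = 0"
    proof (rule linear_term_zero_if_quadratic_nonneg)
      fix t :: real
      have "a + t *\<^sub>R y \<in> L" using y a sub by (simp add: subspace_add subspace_scale)
      then have "J a \<le> J (a + t *\<^sub>R y)" using m_le Ja by force
      moreover have "J (a + t *\<^sub>R y) = J a + (2 * t * (inner y a - f y) + t\<^sup>2 * (norm y)\<^sup>2)"
        unfolding J_def power2_norm_eq_inner
        by (simp add: inner_add inner_commute f.add f.scaleR algebra_simps power2_eq_square)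
      ultimately show "0 \<le> 2 * t * (inner y a - f y) + t\<^sup>2 * (norm y)\<^sup>2" by simp
    qed
    then show ?thesis by simp
  qed
  with a show ?thesis using that by blast
qed

lemma orthogonal_decomposition_unique:
  assumes L: "hilbert_subspace L" and ab: "a \<in> L" "b \<in> L"
    and a: "\<And>y. y \<in> L \<Longrightarrow> cinner (x - a) y = 0" and b: "\<And>y. y \<in> L \<Longrightarrow> cinner (x - b) y = 0"
  shows "a = b"
proof -
  have "a - b \<in> L" by (rule hilbert_subspace_diff[OF L ab])
  then have "cinner (x - b) (a - b) - cinner (x - a) (a - b) = 0" using a b by simp
  then have "cinner (a - b) (a - b) = 0" by (simp flip: cinner_diff_left)
  then show ?thesis by simp
qed

lemma proj_spec:
  assumes L: "hilbert_subspace L"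
  shows "\<forall>x. proj L x \<in> L \<and> (\<forall>y\<in>L. cinner (x - proj L x) y = 0)"
proof -
  have "\<exists>a\<in>L. \<forall>y\<in>L. cinner (x - a) y = 0" for x
  proof -
    obtain a where a: "a \<in> L" "\<And>y. y \<in> L \<Longrightarrow> inner y a = inner y x"
      using riesz_on_complete_subspace[OF bounded_linear_inner_left
          hilbert_subspace_subspace[OF L] hilbert_subspace_complete[OF L]] by metis
    have "inner (x - a) y = 0" if "y \<in> L" for y
      using a(2)[OF that] by (simp add: inner_diff_right inner_commute[of _ y])
    then show ?thesis using a(1) cinner_zero_if_inner_zero[OF L] by blast
  qed
  then obtain p where p: "\<And>x. p x \<in> L" "\<And>x y. y \<in> L \<Longrightarrow> cinner (x - p x) y = 0"
    by metis
  have "bounded_linear p"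
  proof (rule bounded_linear_intro[where K = 1])
    show "p (x + y) = p x + p y" for x y
    proof (rule orthogonal_decomposition_unique[OF L p(1), where x = "x + y"])
      show "p x + p y \<in> L" by (intro hilbert_subspace_add L p)
      show "cinner (x + y - (p x + p y)) z = 0" if "z \<in> L" for z
        using p(2)[OF that, of x] p(2)[OF that, of y]
        by (simp add: cinner_diff_left cinner_add_left)
    qed (rule p)
    show "p (r *\<^sub>R x) = r *\<^sub>R p x" for r x
    proof (rule orthogonal_decomposition_unique[OF L p(1), where x = "r *\<^sub>R x"])
      show "r *\<^sub>R p x \<in> L" by (metis hilbert_subspace_scaleC L p(1) scaleC_of_real)
      show "cinner (r *\<^sub>R x - r *\<^sub>R p x) z = 0" if "z \<in> L" for z
        using p(2)[OF that, of x]
        by (simp add: cinner_diff_left cinner_scaleC_left flip: scaleC_of_real)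
    qed (rule p)
    show "norm (p x) \<le> norm x * 1" for x
    proof -
      have "inner (x - p x) (p x) = 0"
        using arg_cong[OF p(2)[OF p(1)], of Re] by (simp add: Re_cinner)
      then have "(norm (p x))\<^sup>2 = inner x (p x)"
        by (simp add: inner_diff_left power2_norm_eq_inner)
      also have "\<dots> \<le> norm x * norm (p x)" by (rule norm_cauchy_schwarz)
      finally show ?thesis
        by (cases "p x = 0") (simp_all add: power2_eq_square)
    qed
  qed
  then have P: "blinfun_apply (Blinfun p) = p" by (rule bounded_linear_Blinfun_apply)
  show ?thesis
    unfolding proj_def
  proof (rule theI)
    show "\<forall>x. blinfun_apply (Blinfun p) x \<in> L \<and> (\<forall>y\<in>L. cinner (x - blinfun_apply (Blinfun p) x) y = 0)"
      using p by (simp add: P)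
    show "Q = Blinfun p" if Q: "\<forall>x. blinfun_apply Q x \<in> L \<and> (\<forall>y\<in>L. cinner (x - blinfun_apply Q x) y = 0)" for Q
      by (rule blinfun_eqI) (use Q p in \<open>auto intro!: orthogonal_decomposition_unique[OF L] simp: P\<close>)
  qed
qed

lemma proj_in: "hilbert_subspace L \<Longrightarrow> proj L x \<in> L"
  and proj_orthogonal: "hilbert_subspace L \<Longrightarrow> y \<in> L \<Longrightarrow> cinner (x - proj L x) y = 0"
  using proj_spec by blast+

lemma proj_eqI:
  assumes "hilbert_subspace L" "a \<in> L" "\<And>y. y \<in> L \<Longrightarrow> cinner (x - a) y = 0"
  shows "proj L x = a"
  by (rule orthogonal_decomposition_unique[OF assms(1)]) (use assms in \<open>auto intro: proj_in proj_orthogonal\<close>)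

lemma proj_ident: "hilbert_subspace L \<Longrightarrow> x \<in> L \<Longrightarrow> proj L x = x"
  by (rule proj_eqI) simp_all

lemma proj_proj [simp]: "hilbert_subspace L \<Longrightarrow> proj L (proj L x) = proj L x"
  by (simp add: proj_ident proj_in)

lemma proj_eq_zero: "hilbert_subspace L \<Longrightarrow> (\<And>y. y \<in> L \<Longrightarrow> cinner x y = 0) \<Longrightarrow> proj L x = 0"
  by (rule proj_eqI) (simp_all add: hilbert_subspace_zero)

lemma proj_self_adjoint:
  assumes L: "hilbert_subspace L"
  shows "cinner (proj L x) y = cinner x (proj L y)"
proof -
  have "cinner (proj L x) (y - proj L y) = 0"
    using proj_orthogonal[OF L proj_in[OF L]] by (metis cinner_commute complex_cnj_zero)
  moreover have "cinner (x - proj L x) (proj L y) = 0"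
    by (rule proj_orthogonal[OF L proj_in[OF L]])
  ultimately show ?thesis by (simp add: cinner_diff_left cinner_diff_right)
qed

lemma norm_proj_pythagoras:
  assumes L: "hilbert_subspace L"
  shows "(norm x)\<^sup>2 = (norm (proj L x))\<^sup>2 + (norm (x - proj L x))\<^sup>2"
proof -
  have "inner (x - proj L x) (proj L x) = 0"
    using arg_cong[OF proj_orthogonal[OF L proj_in[OF L]], of Re] by (simp add: Re_cinner)
  then show ?thesis
    by (simp add: power2_norm_eq_inner inner_diff_left inner_diff_right inner_commute)
qed

lemma norm_proj_le: "hilbert_subspace L \<Longrightarrow> norm (proj L x) \<le> norm x"
  using norm_proj_pythagoras[of L x]
  by (metis le_add_same_cancel1 norm_ge_zero power2_le_imp_le zero_le_power2)

lemma complex_linear_if_adjoint_pair: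
  fixes X :: "'a::complex_inner \<Rightarrow>\<^sub>L 'b::complex_inner"
  assumes "\<And>x y. cinner (X x) y = cinner x (Y y)"
  shows "complex_linear X"
  unfolding complex_linear_def
proof (intro allI, rule eq_if_cinner_eq)
  fix c x z
  have "cinner (X (c *\<^sub>C x)) z = cinner (c *\<^sub>C X x) z"
    by (simp add: assms cinner_scaleC_left)
  then show "cinner z (X (c *\<^sub>C x)) = cinner z (c *\<^sub>C X x)"
    by (metis cinner_commute)
qed

lemma complex_linear_proj: "hilbert_subspace L \<Longrightarrow> complex_linear (proj L)"
  by (rule complex_linear_if_adjoint_pair[where Y = "proj L"]) (rule proj_self_adjoint)

lemma adj_spec:
  fixes X :: "'a::chilbert_space \<Rightarrow>\<^sub>L 'b::complex_inner"
  assumes X: "complex_linear X"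
  shows "\<forall>x y. cinner (X x) y = cinner x (adj X y)"
proof -
  have "\<exists>a. \<forall>x. inner x a = inner (X x) y" for y
  proof -
    have "bounded_linear (\<lambda>x. inner (X x) y)"
      by (rule bounded_linear_compose[OF bounded_linear_inner_left blinfun.bounded_linear_right])
    then obtain a where "\<And>x. x \<in> UNIV \<Longrightarrow> inner x a = inner (X x) y"
      using riesz_on_complete_subspace[OF _ subspace_UNIV complete_UNIV] by metis
    then show ?thesis by blast
  qed
  then obtain q where q: "\<And>x y. inner x (q y) = inner (X x) y" by metis
  have qc: "cinner (X x) y = cinner x (q y)" for x y
    by (rule complex_eqI) (simp_all add: Re_cinner Im_cinner q complex_linearD[OF X] blinfun.minus_right)
  have "bounded_linear q"
  proof (rule bounded_linear_intro[where K = "norm X"])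
    show "q (y + z) = q y + q z" for y z
      by (rule eq_if_cinner_eq) (simp add: cinner_add_right flip: qc)
    show "q (r *\<^sub>R y) = r *\<^sub>R q y" for r y
      by (rule eq_if_cinner_eq) (simp add: cinner_scaleC_right flip: qc scaleC_of_real)
    show "norm (q y) \<le> norm y * norm X" for y
    proof -
      have "(norm (q y))\<^sup>2 = inner (X (q y)) y" by (simp add: power2_norm_eq_inner flip: q)
      also have "\<dots> \<le> norm (X (q y)) * norm y" by (rule norm_cauchy_schwarz)
      also have "\<dots> \<le> (norm X * norm (q y)) * norm y"
        by (intro mult_right_mono norm_blinfun) simp
      finally show ?thesis by (cases "q y = 0") (simp_all add: power2_eq_square mult_ac)
    qed
  qed
  then have Q: "blinfun_apply (Blinfun q) = q" by (rule bounded_linear_Blinfun_apply)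
  show ?thesis
    unfolding adj_def
  proof (rule theI)
    show "\<forall>x y. cinner (X x) y = cinner x (blinfun_apply (Blinfun q) y)"
      by (simp add: Q qc)
    show "Z = Blinfun q" if Z: "\<forall>x y. cinner (X x) y = cinner x (blinfun_apply Z y)" for Z
      by (rule blinfun_eqI, rule eq_if_cinner_eq) (metis Q Z qc)
  qed
qed

lemma cinner_adj:
  fixes X :: "'a::chilbert_space \<Rightarrow>\<^sub>L 'b::complex_inner"
  shows "complex_linear X \<Longrightarrow> cinner (X x) y = cinner x (adj X y)"
  using adj_spec by blast

lemma cinner_adj':
  fixes X :: "'a::chilbert_space \<Rightarrow>\<^sub>L 'b::complex_inner"
  shows "complex_linear X \<Longrightarrow> cinner (adj X y) x = cinner y (X x)"
  using cinner_adj by (metis cinner_commute)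

lemma complex_linear_adj:
  fixes X :: "'a::chilbert_space \<Rightarrow>\<^sub>L 'b::complex_inner"
  shows "complex_linear X \<Longrightarrow> complex_linear (adj X)"
  by (rule complex_linear_if_adjoint_pair[where Y = X]) (rule cinner_adj')

lemma norm_adj_le:
  fixes X :: "'a::chilbert_space \<Rightarrow>\<^sub>L 'b::complex_inner"
  assumes X: "complex_linear X"
  shows "norm (adj X) \<le> norm X"
proof (rule norm_blinfun_bound)
  fix y
  have "(norm (adj X y))\<^sup>2 = inner (X (adj X y)) y"
    by (simp add: power2_norm_eq_inner cinner_adj[OF X] flip: Re_cinner)
  also have "\<dots> \<le> norm (X (adj X y)) * norm y" by (rule norm_cauchy_schwarz)
  also have "\<dots> \<le> (norm X * norm (adj X y)) * norm y"
    by (intro mult_right_mono norm_blinfun) simp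
  finally show "norm (adj X y) \<le> norm X * norm y"
    by (cases "adj X y = 0") (simp_all add: power2_eq_square mult_ac)
qed simp

lemma adj_adj:
  fixes X :: "'a::chilbert_space \<Rightarrow>\<^sub>L 'b::chilbert_space"
  assumes X: "complex_linear X"
  shows "adj (adj X) = X"
proof (rule blinfun_eqI, rule eq_if_cinner_eq)
  show "cinner z (adj (adj X) x) = cinner z (X x)" for x z
    by (simp add: cinner_adj'[OF X] flip: cinner_adj[OF complex_linear_adj[OF X]])
qed

lemma operatorsI:
  assumes "complex_linear X" "\<And>x. x \<in> L\<^sub>1 \<Longrightarrow> X x \<in> L\<^sub>2"
    "\<And>x. (\<And>y. y \<in> L\<^sub>1 \<Longrightarrow> cinner x y = 0) \<Longrightarrow> X x = 0"
  shows "X \<in> operators L\<^sub>1 L\<^sub>2"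
  using assms by (simp add: operators_def complex_linear_def)

lemma operators_complex_linear: "X \<in> operators L\<^sub>1 L\<^sub>2 \<Longrightarrow> complex_linear X"
  and operators_in: "X \<in> operators L\<^sub>1 L\<^sub>2 \<Longrightarrow> x \<in> L\<^sub>1 \<Longrightarrow> X x \<in> L\<^sub>2"
  and operators_zero: "X \<in> operators L\<^sub>1 L\<^sub>2 \<Longrightarrow> (\<And>y. y \<in> L\<^sub>1 \<Longrightarrow> cinner x y = 0) \<Longrightarrow> X x = 0"
  by (simp_all add: operators_def complex_linear_def)

lemma operators_proj_right:
  assumes "X \<in> operators L\<^sub>1 L\<^sub>2" "hilbert_subspace L\<^sub>1"
  shows "X (proj L\<^sub>1 x) = X x"
  using operators_zero[OF assms(1) proj_orthogonal[OF assms(2)], of x]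
  by (simp add: blinfun.diff_right)

lemma operators_range:
  assumes "X \<in> operators L\<^sub>1 L\<^sub>2" "hilbert_subspace L\<^sub>1"
  shows "X x \<in> L\<^sub>2"
  using operators_in[OF assms(1) proj_in[OF assms(2)]] operators_proj_right[OF assms] by metis

lemma operatorsI_proj:
  assumes "complex_linear X" "hilbert_subspace L\<^sub>1" "\<And>x. X (proj L\<^sub>1 x) = X x"
    and "\<And>x. x \<in> L\<^sub>1 \<Longrightarrow> X x \<in> L\<^sub>2"
  shows "X \<in> operators L\<^sub>1 L\<^sub>2"
  by (rule operatorsI) (use assms proj_eq_zero in \<open>metis blinfun.zero_right\<close>)+

lemma operators_compose:
  assumes "X \<in> operators L\<^sub>2 L\<^sub>3" "Y \<in> operators L\<^sub>1 L\<^sub>2"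
  shows "X o\<^sub>L Y \<in> operators L\<^sub>1 L\<^sub>3"
  using assms by (simp add: operators_def)

lemma operators_scaleC:
  assumes "X \<in> operators L\<^sub>1 L\<^sub>2" "hilbert_subspace L\<^sub>2"
  shows "a *\<^sub>C X \<in> operators L\<^sub>1 L\<^sub>2"
  using assms by (simp add: operators_def scaleC_scaleC mult.commute hilbert_subspace_scaleC)

lemma operators_minus:
  assumes "X \<in> operators L\<^sub>1 L\<^sub>2" "hilbert_subspace L\<^sub>2"
  shows "- X \<in> operators L\<^sub>1 L\<^sub>2"
  using assms by (simp add: operators_def blinfun.minus_left hilbert_subspace_minus)

lemma operators_diff:
  assumes "X \<in> operators L\<^sub>1 L\<^sub>2" "Y \<in> operators L\<^sub>1 L\<^sub>2" "hilbert_subspace L\<^sub>2"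
  shows "X - Y \<in> operators L\<^sub>1 L\<^sub>2"
  using assms by (simp add: operators_def blinfun.diff_left scaleC_diff_right hilbert_subspace_diff)

lemma operators_proj: "hilbert_subspace L \<Longrightarrow> proj L \<in> operators L L"
  by (rule operatorsI_proj) (simp_all add: complex_linear_proj proj_in)

section \<open>Square roots of positive operators\<close>

text \<open>The fixed point equation \<open>T = (X + T\<^sup>2) / 2\<close> says that \<open>(I - T)\<^sup>2 = I - X\<close>. Its iterates are
  polynomials in \<open>X\<close> without constant term.\<close>

primrec sqrt_iterate :: "('a::real_normed_vector \<Rightarrow>\<^sub>L 'a) \<Rightarrow> nat \<Rightarrow> 'a \<Rightarrow>\<^sub>L 'a" where
  "sqrt_iterate X 0 = 0"
| "sqrt_iterate X (Suc k) = (1/2) *\<^sub>R (X + (sqrt_iterate X k o\<^sub>L sqrt_iterate X k))"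

text \<open>The iteration for the number \<open>1\<close>; it dominates the one for any operator of norm at most \<open>1\<close>.\<close>

primrec sqrt_majorant :: "nat \<Rightarrow> real" where
  "sqrt_majorant 0 = 0"
| "sqrt_majorant (Suc k) = (1 + (sqrt_majorant k)\<^sup>2) / 2"

lemma sqrt_majorant_bounds: "0 \<le> sqrt_majorant k \<and> sqrt_majorant k \<le> 1"
proof (induction k)
  case (Suc k)
  then have "(sqrt_majorant k)\<^sup>2 \<le> 1" by (simp add: power_le_one)
  then show ?case by simp
qed simp

lemma sqrt_majorant_mono: "sqrt_majorant k \<le> sqrt_majorant (Suc k)"
  using zero_le_power2[of "1 - sqrt_majorant k"] by (simp add: power2_eq_square algebra_simps)

lemma Cauchy_sqrt_majorant: "Cauchy sqrt_majorant"
proof -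
  have "incseq sqrt_majorant" by (rule incseq_SucI) (rule sqrt_majorant_mono)
  then have "convergent sqrt_majorant"
    by (rule incseq_convergent[of _ 1]) (use sqrt_majorant_bounds in \<open>auto simp: convergent_def\<close>)
  then show ?thesis by (rule convergent_Cauchy)
qed

lemma sqrt_iterate_commute: "sqrt_iterate X k o\<^sub>L X = X o\<^sub>L sqrt_iterate X k"
proof (induction k)
  case (Suc k)
  then show ?case
    by (intro blinfun_eqI)
      (simp add: blinfun_eq_iff blinfun.add_left blinfun.add_right blinfun.scaleR_left blinfun.scaleR_right)
qed simp

lemma sqrt_iterate_intertwine:
  assumes "G o\<^sub>L X = Y o\<^sub>L G"
  shows "G o\<^sub>L sqrt_iterate X k = sqrt_iterate Y k o\<^sub>L G"
proof (induction k)
  case (Suc k)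
  then show ?case using assms
    by (intro blinfun_eqI)
      (simp add: blinfun_eq_iff blinfun.add_left blinfun.add_right blinfun.scaleR_left blinfun.scaleR_right)
qed simp

lemma norm_sqrt_iterate_le:
  assumes X: "norm X \<le> 1"
  shows "norm (sqrt_iterate X k) \<le> sqrt_majorant k"
proof (induction k)
  case (Suc k)
  have "norm (sqrt_iterate X (Suc k))
      \<le> (norm X + norm (sqrt_iterate X k o\<^sub>L sqrt_iterate X k)) / 2"
    using norm_triangle_ineq[of X "sqrt_iterate X k o\<^sub>L sqrt_iterate X k"] by simp
  also have "norm (sqrt_iterate X k o\<^sub>L sqrt_iterate X k) \<le> (sqrt_majorant k)\<^sup>2"
    using Suc by (metis mult_mono norm_blinfun_compose norm_ge_zero order_trans power2_eq_square)
  finally show ?case using X by simp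
qed simp

text \<open>Since the iterates commute, two successive steps differ by half of
  \<open>(T\<^sub>k\<^sub>+\<^sub>1 + T\<^sub>k) (T\<^sub>k\<^sub>+\<^sub>1 - T\<^sub>k)\<close>, and the same identity holds for the majorant.\<close>

lemma norm_sqrt_iterate_step_le:
  assumes X: "norm X \<le> 1"
  shows "norm (sqrt_iterate X (Suc k) - sqrt_iterate X k) \<le> sqrt_majorant (Suc k) - sqrt_majorant k"
proof (induction k)
  case 0
  then show ?case using X by simp
next
  case (Suc k)
  define S T where "S = sqrt_iterate X k" and "T = sqrt_iterate X (Suc k)"
  define s t where "s = sqrt_majorant k" and "t = sqrt_majorant (Suc k)"
  have ST: "S o\<^sub>L T = T o\<^sub>L S"
    using sqrt_iterate_commute[of X k] by (auto simp: S_def T_def blinfun_eq_iff blinfun.add_left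
      blinfun.add_right blinfun.scaleR_left blinfun.scaleR_right)
  have "sqrt_iterate X (Suc (Suc k)) - T = (1/2) *\<^sub>R ((T o\<^sub>L T) - (S o\<^sub>L S))"
    by (simp add: S_def T_def algebra_simps)
  also have "(T o\<^sub>L T) - (S o\<^sub>L S) = (T + S) o\<^sub>L (T - S)"
    using ST by (auto simp: blinfun_eq_iff blinfun.add_left blinfun.diff_left blinfun.diff_right)
  finally have "norm (sqrt_iterate X (Suc (Suc k)) - T) = norm ((T + S) o\<^sub>L (T - S)) / 2"
    by simp
  also have "\<dots> \<le> (norm (T + S) * norm (T - S)) / 2"
    by (simp add: norm_blinfun_compose)
  also have "norm (T + S) * norm (T - S) \<le> (t + s) * (t - s)"
  proof (rule mult_mono)
    show "norm (T + S) \<le> t + s"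
      unfolding S_def T_def s_def t_def
      by (intro norm_triangle_le add_mono norm_sqrt_iterate_le X)
    show "norm (T - S) \<le> t - s"
      using Suc by (simp add: S_def T_def s_def t_def)
    show "0 \<le> t + s" using sqrt_majorant_bounds by (simp add: s_def t_def del: sqrt_majorant.simps)
  qed simp
  also have "(t + s) * (t - s) / 2 = sqrt_majorant (Suc (Suc k)) - t"
    by (simp add: s_def t_def power2_eq_square field_simps)
  finally show ?case by (simp add: T_def t_def)
qed

lemma norm_sqrt_iterate_diff_le:
  assumes X: "norm X \<le> 1" and kl: "k \<le> l"
  shows "norm (sqrt_iterate X l - sqrt_iterate X k) \<le> sqrt_majorant l - sqrt_majorant k"
  using kl
proof (induction l rule: dec_induct)
  case (step l)
  have "norm (sqrt_iterate X (Suc l) - sqrt_iterate X k)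
      \<le> norm (sqrt_iterate X (Suc l) - sqrt_iterate X l) + norm (sqrt_iterate X l - sqrt_iterate X k)"
    by (metis norm_triangle_ineq diff_add_cancel add_diff_eq)
  then show ?case
    using norm_sqrt_iterate_step_le[OF X, of l] step.IH by linarith
qed simp

definition sqrt_limit :: "('a::banach \<Rightarrow>\<^sub>L 'a) \<Rightarrow> 'a \<Rightarrow>\<^sub>L 'a"
  where "sqrt_limit X = lim (sqrt_iterate X)"

lemma sqrt_iterate_tendsto:
  fixes X :: "'a::banach \<Rightarrow>\<^sub>L 'a"
  assumes X: "norm X \<le> 1"
  shows "sqrt_iterate X \<longlonglongrightarrow> sqrt_limit X"
proof -
  have "Cauchy (sqrt_iterate X)"
  proof (rule CauchyI')
    fix e :: real assume "0 < e"
    then obtain M where M: "\<And>m n. m \<ge> M \<Longrightarrow> n \<ge> M \<Longrightarrow> norm (sqrt_majorant m - sqrt_majorant n) < e"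
      using CauchyD[OF Cauchy_sqrt_majorant] by metis
    have "norm (sqrt_iterate X m - sqrt_iterate X n) < e" if "M \<le> m" "m < n" for m n
    proof -
      have "norm (sqrt_iterate X m - sqrt_iterate X n) \<le> sqrt_majorant n - sqrt_majorant m"
        using norm_sqrt_iterate_diff_le[OF X, of m n] that by (simp add: norm_minus_commute)
      also have "\<dots> < e" using M[of n m] that by simp
      finally show ?thesis .
    qed
    then show "\<exists>M. \<forall>m\<ge>M. \<forall>n>m. dist (sqrt_iterate X m) (sqrt_iterate X n) < e"
      unfolding dist_norm by blast
  qed
  then show ?thesis
    unfolding sqrt_limit_def by (simp add: Cauchy_convergent_iff convergent_LIMSEQ_iff)
qed

lemma sqrt_limit_equation:
  fixes X :: "'a::banach \<Rightarrow>\<^sub>L 'a"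
  assumes X: "norm X \<le> 1"
  shows "2 *\<^sub>R sqrt_limit X = X + (sqrt_limit X o\<^sub>L sqrt_limit X)"
proof -
  note lim = sqrt_iterate_tendsto[OF X]
  have "(\<lambda>k. sqrt_iterate X (Suc k)) \<longlonglongrightarrow> sqrt_limit X"
    using lim by (rule LIMSEQ_Suc)
  moreover have "(\<lambda>k. sqrt_iterate X (Suc k)) \<longlonglongrightarrow> (1/2) *\<^sub>R (X + (sqrt_limit X o\<^sub>L sqrt_limit X))"
    unfolding sqrt_iterate.simps
    by (intro tendsto_intros bounded_bilinear.tendsto[OF bounded_bilinear_blinfun_compose] lim)
  ultimately have "sqrt_limit X = (1/2) *\<^sub>R (X + (sqrt_limit X o\<^sub>L sqrt_limit X))"
    by (rule LIMSEQ_unique)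
  then show ?thesis by (metis scaleR_scaleR scaleR_one nonzero_mult_div_cancel_left times_divide_eq_right mult_1_right mult.right_neutral zero_neq_numeral)
qed

lemma sqrt_limit_intertwine:
  fixes X :: "'a::banach \<Rightarrow>\<^sub>L 'a" and Y :: "'b::banach \<Rightarrow>\<^sub>L 'b"
  assumes X: "norm X \<le> 1" and Y: "norm Y \<le> 1" and GXY: "G o\<^sub>L X = Y o\<^sub>L G"
  shows "G o\<^sub>L sqrt_limit X = sqrt_limit Y o\<^sub>L G"
proof (rule LIMSEQ_unique)
  show "(\<lambda>k. G o\<^sub>L sqrt_iterate X k) \<longlonglongrightarrow> (G o\<^sub>L sqrt_limit X)"
    by (intro bounded_bilinear.tendsto[OF bounded_bilinear_blinfun_compose] tendsto_const
        sqrt_iterate_tendsto X)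
  show "(\<lambda>k. G o\<^sub>L sqrt_iterate X k) \<longlonglongrightarrow> (sqrt_limit Y o\<^sub>L G)"
    unfolding sqrt_iterate_intertwine[OF GXY]
    by (intro bounded_bilinear.tendsto[OF bounded_bilinear_blinfun_compose] tendsto_const
        sqrt_iterate_tendsto Y)
qed

lemma positive_op_symmetric: "positive_op X \<Longrightarrow> cinner (X x) y = cinner x (X y)"
  by (simp add: positive_op_def)

lemma positive_op_nonneg: "positive_op X \<Longrightarrow> 0 \<le> inner (X x) x"
  by (simp add: positive_op_def Re_cinner)

lemma positive_op_inner_symmetric: "positive_op X \<Longrightarrow> inner (X x) y = inner x (X y)"
  by (metis positive_op_symmetric Re_cinner)

lemma complex_linear_positive_op: "positive_op X \<Longrightarrow> complex_linear X"
  by (rule complex_linear_if_adjoint_pair[where Y = X]) (rule positive_op_symmetric)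

text \<open>Moving from \<open>x\<close>, a zero of the nonnegative quadratic form of \<open>X\<close>, in the direction of \<open>X x\<close>
  shows that the linear term \<open>\<parallel>X x\<parallel>\<^sup>2\<close> of the form vanishes.\<close>

lemma positive_op_eq_zero:
  assumes X: "positive_op X" and x: "inner (X x) x = 0"
  shows "X x = 0"
proof -
  have "inner (X x) (X x) = 0"
  proof (rule linear_term_zero_if_quadratic_nonneg)
    fix t :: real
    have "0 \<le> inner (X (x + t *\<^sub>R X x)) (x + t *\<^sub>R X x)"
      by (rule positive_op_nonneg[OF X])
    also have "\<dots> = 2 * t * inner (X x) (X x) + t\<^sup>2 * inner (X (X x)) (X x)"
      using x positive_op_inner_symmetric[OF X, of "X x" x]
      by (simp add: blinfun.add_right blinfun.scaleR_right inner_add inner_commute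
          power2_eq_square algebra_simps)
    finally show "0 \<le> 2 * t * inner (X x) (X x) + t\<^sup>2 * inner (X (X x)) (X x)" .
  qed
  then show ?thesis by simp
qed

lemma sqrt_limit_symmetric:
  fixes X :: "'a::chilbert_space \<Rightarrow>\<^sub>L 'a"
  assumes X: "norm X \<le> 1" and sym: "\<And>x y. cinner (X x) y = cinner x (X y)"
  shows "cinner (sqrt_limit X x) y = cinner x (sqrt_limit X y)"
proof -
  have step: "cinner (sqrt_iterate X k x) y = cinner x (sqrt_iterate X k y)" for k x y
  proof (induction k arbitrary: x y)
    case (Suc k)
    then show ?case
      by (simp add: blinfun.add_left blinfun.scaleR_left cinner_add_left cinner_add_right sym
          cinner_scaleC_left cinner_scaleC_right flip: scaleC_of_real)
  qed simp
  have lim: "(\<lambda>k. inner (sqrt_iterate X k x) y) \<longlonglongrightarrow> inner (sqrt_limit X x) y"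
    "(\<lambda>k. inner y (sqrt_iterate X k x)) \<longlonglongrightarrow> inner y (sqrt_limit X x)" for x y
    by (intro tendsto_intros sqrt_iterate_tendsto X)+
  have inner_sym: "inner (sqrt_limit X x) y = inner x (sqrt_limit X y)" for x y
  proof (rule LIMSEQ_unique[OF lim(1)])
    have "inner (sqrt_iterate X k x) y = inner x (sqrt_iterate X k y)" for k
      using step by (metis Re_cinner)
    then show "(\<lambda>k. inner (sqrt_iterate X k x) y) \<longlonglongrightarrow> inner x (sqrt_limit X y)"
      using lim(2)[of x y] by simp
  qed
  have lin: "complex_linear (sqrt_iterate X k)" for k
    by (rule complex_linear_if_adjoint_pair) (rule step)
  have "sqrt_limit X (c *\<^sub>C x) = c *\<^sub>C sqrt_limit X x" for c x
  proof (rule LIMSEQ_unique)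
    show "(\<lambda>k. sqrt_iterate X k (c *\<^sub>C x)) \<longlonglongrightarrow> sqrt_limit X (c *\<^sub>C x)"
      by (intro tendsto_intros sqrt_iterate_tendsto X)
    show "(\<lambda>k. sqrt_iterate X k (c *\<^sub>C x)) \<longlonglongrightarrow> c *\<^sub>C sqrt_limit X x"
      unfolding complex_linearD[OF lin]
      by (intro bounded_linear.tendsto[OF bounded_linear_scaleC] tendsto_intros sqrt_iterate_tendsto X)
  qed
  then show ?thesis
    by (intro complex_eqI) (simp_all add: Re_cinner Im_cinner inner_sym blinfun.minus_right blinfun.minus_left
      flip: inner_sym)
qed

lemma positive_sqrt_limit:
  fixes A :: "'a::chilbert_space \<Rightarrow>\<^sub>L 'a"
  assumes A: "positive_op A" and le: "norm (id_blinfun - A) \<le> 1"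
  defines "R \<equiv> id_blinfun - sqrt_limit (id_blinfun - A)"
  shows "positive_op R" "R o\<^sub>L R = A"
proof -
  let ?X = "id_blinfun - A"
  let ?T = "sqrt_limit ?X"
  have "cinner (?X x) y = cinner x (?X y)" for x y
    by (simp add: blinfun.diff_left cinner_diff_left cinner_diff_right positive_op_symmetric[OF A])
  note sym = sqrt_limit_symmetric[OF le this]
  have T: "norm (?T x) \<le> norm x" for x
  proof -
    have "norm ?T \<le> 1"
    proof (rule LIMSEQ_le_const2[OF tendsto_norm[OF sqrt_iterate_tendsto[OF le]]])
      show "\<exists>N. \<forall>n\<ge>N. norm (sqrt_iterate ?X n) \<le> 1"
        using norm_sqrt_iterate_le[OF le] sqrt_majorant_bounds by (meson order_trans)
    qed
    then have "norm ?T * norm x \<le> 1 * norm x" by (rule mult_right_mono) simp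
    then show ?thesis using norm_blinfun[of ?T x] by simp
  qed
  show "positive_op R"
    unfolding positive_op_def
  proof safe
    show "cinner (R x) y = cinner x (R y)" for x y
      by (simp add: R_def blinfun.diff_left cinner_diff_left cinner_diff_right sym)
    show "0 \<le> Re (cinner (R x) x)" for x
    proof -
      have "inner (?T x) x \<le> norm (?T x) * norm x" by (rule norm_cauchy_schwarz)
      also have "\<dots> \<le> norm x * norm x" by (intro mult_right_mono T) simp
      finally show ?thesis
        by (simp add: R_def blinfun.diff_left Re_cinner inner_diff_left power2_norm_eq_inner
            flip: power2_eq_square)
    qed
  qed
  have "R o\<^sub>L R = id_blinfun - 2 *\<^sub>R ?T + (?T o\<^sub>L ?T)"
    by (rule blinfun_eqI)
      (simp add: R_def blinfun.diff_left blinfun.diff_right blinfun.add_left blinfun.scaleR_left scaleR_2)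
  then show "R o\<^sub>L R = A"
    by (simp add: sqrt_limit_equation[OF le])
qed

text \<open>If \<open>Q\<close> is another positive root then it commutes with \<open>Q\<^sup>2 = A\<close> and so with \<open>R\<close>; hence
  \<open>(R + Q) (R - Q) = 0\<close>, and by positivity both \<open>R\<close> and \<open>Q\<close> vanish on the range of \<open>R - Q\<close>.\<close>

lemma sqrt_op_eq:
  fixes A :: "'a::chilbert_space \<Rightarrow>\<^sub>L 'a"
  assumes A: "positive_op A" and le: "norm (id_blinfun - A) \<le> 1"
  shows "sqrt_op A = id_blinfun - sqrt_limit (id_blinfun - A)"
  unfolding sqrt_op_def
proof (rule the_equality)
  let ?R = "id_blinfun - sqrt_limit (id_blinfun - A)"
  note R = positive_sqrt_limit[OF A le]
  show "positive_op ?R \<and> ?R o\<^sub>L ?R = A" using R by simp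
  fix Q assume Q: "positive_op Q \<and> Q o\<^sub>L Q = A"
  have "A x = Q (Q x)" for x using Q by auto
  then have "Q o\<^sub>L (id_blinfun - A) = (id_blinfun - A) o\<^sub>L Q"
    by (simp add: blinfun_eq_iff blinfun.diff_left blinfun.diff_right)
  then have "Q o\<^sub>L sqrt_limit (id_blinfun - A) = sqrt_limit (id_blinfun - A) o\<^sub>L Q"
    by (rule sqrt_limit_intertwine[OF le le])
  then have QR: "Q (?R x) = ?R (Q x)" for x
    by (auto simp: blinfun_eq_iff blinfun.diff_left blinfun.diff_right)
  have "Q x = ?R x" for x
  proof -
    define y where "y = ?R x - Q x"
    have "?R y + Q y = ?R (?R x) - Q (Q x)"
      by (simp only: y_def blinfun.diff_right QR) simp
    also have "\<dots> = 0"
      using R(2) Q by (metis blinfun_apply_blinfun_compose diff_self)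
    finally have "inner (?R y) y + inner (Q y) y = 0"
      by (metis inner_add_left inner_zero_left)
    moreover have "0 \<le> inner (?R y) y" "0 \<le> inner (Q y) y"
      using positive_op_nonneg R Q by blast+
    ultimately have "?R y = 0" "Q y = 0"
      using positive_op_eq_zero[OF R(1), of y] positive_op_eq_zero[of Q y] Q by linarith+
    then have "inner (?R y - Q y) x = 0" by simp
    then have "inner y (?R x - Q x) = 0"
      using positive_op_inner_symmetric[OF R(1), of y x] positive_op_inner_symmetric[of Q y x] Q
      by (simp add: inner_diff_left inner_diff_right)
    then show ?thesis by (simp add: y_def)
  qed
  then show "Q = ?R" by (rule blinfun_eqI)
qed

lemma sqrt_op_positive:
  fixes A :: "'a::chilbert_space \<Rightarrow>\<^sub>L 'a"
  assumes "positive_op A" "norm (id_blinfun - A) \<le> 1"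
  shows "positive_op (sqrt_op A)"
  by (simp add: sqrt_op_eq[OF assms] positive_sqrt_limit[OF assms])

lemma sqrt_op_square:
  fixes A :: "'a::chilbert_space \<Rightarrow>\<^sub>L 'a"
  assumes "positive_op A" "norm (id_blinfun - A) \<le> 1"
  shows "sqrt_op A o\<^sub>L sqrt_op A = A"
  by (simp add: sqrt_op_eq[OF assms] positive_sqrt_limit[OF assms])

text \<open>The root is a limit of polynomials in the operator, so it inherits intertwining relations. This
  is what relates the defect operators of a contraction and of its adjoint.\<close>

lemma sqrt_op_intertwine:
  fixes A :: "'a::chilbert_space \<Rightarrow>\<^sub>L 'a" and B :: "'b::chilbert_space \<Rightarrow>\<^sub>L 'b"
  assumes A: "positive_op A" "norm (id_blinfun - A) \<le> 1"
    and B: "positive_op B" "norm (id_blinfun - B) \<le> 1"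
    and GAB: "G o\<^sub>L A = B o\<^sub>L G"
  shows "G o\<^sub>L sqrt_op A = sqrt_op B o\<^sub>L G"
proof -
  have "G o\<^sub>L (id_blinfun - A) = (id_blinfun - B) o\<^sub>L G"
    using GAB by (auto simp: blinfun_eq_iff blinfun.diff_left blinfun.diff_right)
  from sqrt_limit_intertwine[OF A(2) B(2) this] show ?thesis
    by (auto simp: sqrt_op_eq[OF A] sqrt_op_eq[OF B] blinfun_eq_iff blinfun.diff_left blinfun.diff_right)
qed

section \<open>Contractions between subspaces and their defects\<close>

text \<open>A contraction from \<open>L\<^sub>1\<close> to \<open>L\<^sub>2\<close>, extended by zero to the orthogonal complement of \<open>L\<^sub>1\<close>.\<close>

definition subspace_contraction ::
    "'a::chilbert_space set \<Rightarrow> 'b::chilbert_space set \<Rightarrow> ('a \<Rightarrow>\<^sub>L 'b) \<Rightarrow> bool" where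
  "subspace_contraction L\<^sub>1 L\<^sub>2 G \<longleftrightarrow> hilbert_subspace L\<^sub>1 \<and> hilbert_subspace L\<^sub>2
    \<and> G \<in> operators L\<^sub>1 L\<^sub>2 \<and> norm G \<le> 1"

lemma norm_blinfun_apply_le:
  assumes "norm X \<le> 1"
  shows "norm (blinfun_apply X x) \<le> norm x"
  using norm_blinfun[of X x] mult_right_mono[OF assms norm_ge_zero[of x]] by simp

lemma adj_operators:
  fixes G :: "'a::chilbert_space \<Rightarrow>\<^sub>L 'b::chilbert_space"
  assumes L: "hilbert_subspace L\<^sub>1" "hilbert_subspace L\<^sub>2" and G: "G \<in> operators L\<^sub>1 L\<^sub>2"
  shows "adj G \<in> operators L\<^sub>2 L\<^sub>1"
proof (rule operatorsI)
  note lin = operators_complex_linear[OF G]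
  show "complex_linear (adj G)" by (rule complex_linear_adj[OF lin])
  show "adj G y \<in> L\<^sub>1" for y
  proof -
    have "adj G y = proj L\<^sub>1 (adj G y)"
      by (rule eq_if_cinner_eq)
        (simp add: operators_proj_right[OF G L(1)] flip: cinner_adj[OF lin] proj_self_adjoint[OF L(1)])
    then show ?thesis using proj_in[OF L(1)] by metis
  qed
  show "adj G y = 0" if "\<And>x. x \<in> L\<^sub>2 \<Longrightarrow> cinner y x = 0" for y
    using that[OF operators_range[OF G L(1)]] cinner_adj'[OF lin, of y "adj G y"] by simp
qed

lemma subspace_contraction_adj:
  "subspace_contraction L\<^sub>1 L\<^sub>2 G \<Longrightarrow> subspace_contraction L\<^sub>2 L\<^sub>1 (adj G)"
  unfolding subspace_contraction_def
  by (meson adj_operators norm_adj_le operators_complex_linear order_trans)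

context
  fixes L\<^sub>1 :: "'a::chilbert_space set" and L\<^sub>2 :: "'b::chilbert_space set" and G
  assumes contraction: "subspace_contraction L\<^sub>1 L\<^sub>2 G"
begin

private lemma L1: "hilbert_subspace L\<^sub>1" and L2: "hilbert_subspace L\<^sub>2"
  and G: "G \<in> operators L\<^sub>1 L\<^sub>2" and norm_G: "norm G \<le> 1"
  using contraction by (simp_all add: subspace_contraction_def)

private lemma G_linear: "complex_linear G"
  by (rule operators_complex_linear[OF G])

lemma positive_defect_square: "positive_op (proj L\<^sub>1 - (adj G o\<^sub>L G))"
  unfolding positive_op_def
proof safe
  show "cinner ((proj L\<^sub>1 - (adj G o\<^sub>L G)) x) y = cinner x ((proj L\<^sub>1 - (adj G o\<^sub>L G)) y)" for x y
    by (simp add: blinfun.diff_left cinner_diff_left cinner_diff_right proj_self_adjoint[OF L1]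
        cinner_adj[OF G_linear, symmetric] cinner_adj'[OF G_linear])
  show "0 \<le> Re (cinner ((proj L\<^sub>1 - (adj G o\<^sub>L G)) x) x)" for x
  proof -
    have "cinner (proj L\<^sub>1 x) x = cinner (proj L\<^sub>1 x) (proj L\<^sub>1 x)"
      by (metis proj_self_adjoint[OF L1] proj_proj[OF L1])
    then have "Re (cinner ((proj L\<^sub>1 - (adj G o\<^sub>L G)) x) x) = (norm (proj L\<^sub>1 x))\<^sup>2 - (norm (G x))\<^sup>2"
      by (simp add: blinfun.diff_left cinner_diff_left cinner_adj'[OF G_linear] cinner_self)
    moreover have "norm (G x) \<le> norm (proj L\<^sub>1 x)"
      using norm_blinfun_apply_le[OF norm_G, of "proj L\<^sub>1 x"]
      by (simp add: operators_proj_right[OF G L1])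
    ultimately show ?thesis by simp
  qed
qed

text \<open>This operator is \<open>(I - P) + G\<^sup>* G\<close>, a sum of contractions with orthogonal ranges that also act on
  orthogonal subspaces.\<close>

lemma norm_id_minus_defect_square: "norm (id_blinfun - (proj L\<^sub>1 - (adj G o\<^sub>L G))) \<le> 1"
proof (rule norm_blinfun_bound)
  fix x
  define v where "v = adj G (G x)"
  have v: "v \<in> L\<^sub>1"
    unfolding v_def by (rule operators_range[OF adj_operators[OF L1 L2 G] L2])
  have "norm v \<le> norm (G x)"
    unfolding v_def by (rule norm_blinfun_apply_le) (metis norm_adj_le[OF G_linear] norm_G order_trans)
  also have "\<dots> \<le> norm (proj L\<^sub>1 x)"
    using norm_blinfun_apply_le[OF norm_G, of "proj L\<^sub>1 x"] by (simp add: operators_proj_right[OF G L1])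
  finally have "norm v \<le> norm (proj L\<^sub>1 x)" .
  then have "(norm v)\<^sup>2 \<le> (norm (proj L\<^sub>1 x))\<^sup>2" by (simp add: power_mono)
  moreover have "(norm (x - proj L\<^sub>1 x + v))\<^sup>2 = (norm v)\<^sup>2 + (norm (x - proj L\<^sub>1 x))\<^sup>2"
    using norm_proj_pythagoras[OF L1, of "x - proj L\<^sub>1 x + v"]
    by (simp add: blinfun.add_right blinfun.diff_right proj_proj[OF L1] proj_ident[OF L1 v])
  ultimately have "(norm (x - proj L\<^sub>1 x + v))\<^sup>2 \<le> (norm x)\<^sup>2"
    using norm_proj_pythagoras[OF L1, of x] by simp
  then have "norm (x - proj L\<^sub>1 x + v) \<le> norm x" by (rule power2_le_imp_le) simp
  moreover have "(id_blinfun - (proj L\<^sub>1 - (adj G o\<^sub>L G))) x = x - proj L\<^sub>1 x + v"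
    by (simp add: blinfun.diff_left v_def)
  ultimately show "norm ((id_blinfun - (proj L\<^sub>1 - (adj G o\<^sub>L G))) x) \<le> 1 * norm x"
    by simp
qed simp

lemma positive_defect_op: "positive_op (defect_op L\<^sub>1 G)"
  unfolding defect_op_def
  by (rule sqrt_op_positive[OF positive_defect_square norm_id_minus_defect_square])

lemma complex_linear_defect_op: "complex_linear (defect_op L\<^sub>1 G)"
  by (rule complex_linear_positive_op[OF positive_defect_op])

lemma defect_op_square: "defect_op L\<^sub>1 G (defect_op L\<^sub>1 G x) = proj L\<^sub>1 x - adj G (G x)"
  using sqrt_op_square[OF positive_defect_square norm_id_minus_defect_square]
  by (auto simp: defect_op_def blinfun_eq_iff blinfun.diff_left)

text \<open>The column of \<open>G\<close> and its defect operator, the first half of a rotation, is thus isometric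
  on \<open>L\<^sub>1\<close>.\<close>

lemma norm_defect_op: "(norm (G x))\<^sup>2 + (norm (defect_op L\<^sub>1 G x))\<^sup>2 = (norm (proj L\<^sub>1 x))\<^sup>2"
proof -
  have "cinner (defect_op L\<^sub>1 G x) (defect_op L\<^sub>1 G x) = cinner x (proj L\<^sub>1 x) - cinner (G x) (G x)"
    by (simp add: positive_op_symmetric[OF positive_defect_op] defect_op_square cinner_diff_right
        cinner_adj[OF G_linear])
  moreover have "cinner x (proj L\<^sub>1 x) = cinner (proj L\<^sub>1 x) (proj L\<^sub>1 x)"
    by (metis proj_self_adjoint[OF L1] proj_proj[OF L1])
  ultimately have "complex_of_real ((norm (defect_op L\<^sub>1 G x))\<^sup>2)
      = complex_of_real ((norm (proj L\<^sub>1 x))\<^sup>2 - (norm (G x))\<^sup>2)"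
    by (simp add: cinner_self)
  then show ?thesis unfolding of_real_eq_iff by simp
qed

lemma defect_op_proj: "defect_op L\<^sub>1 G (proj L\<^sub>1 x) = defect_op L\<^sub>1 G x"
proof -
  have "defect_op L\<^sub>1 G (x - proj L\<^sub>1 x) = 0"
    using norm_defect_op[of "x - proj L\<^sub>1 x"] by (simp add: blinfun.diff_right proj_proj[OF L1] sum_power2_eq_zero_iff)
  then show ?thesis by (simp add: blinfun.diff_right)
qed

lemma defect_op_range: "defect_op L\<^sub>1 G x \<in> L\<^sub>1"
proof -
  have "defect_op L\<^sub>1 G x = proj L\<^sub>1 (defect_op L\<^sub>1 G x)"
    by (rule eq_if_cinner_eq)
      (simp add: defect_op_proj flip: positive_op_symmetric[OF positive_defect_op] proj_self_adjoint[OF L1])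
  then show ?thesis using proj_in[OF L1] by metis
qed

lemma hilbert_subspace_defect_space: "hilbert_subspace (defect_space L\<^sub>1 G)"
  unfolding defect_space_def by (rule hilbert_subspace_closure_range[OF complex_linear_defect_op])

lemma defect_space_subset: "defect_space L\<^sub>1 G \<subseteq> L\<^sub>1"
  unfolding defect_space_def
  by (rule closure_minimal)
    (use defect_op_range hilbert_subspace_complete[OF L1] in \<open>auto intro: complete_imp_closed\<close>)

lemma defect_op_in_defect_space: "defect_op L\<^sub>1 G x \<in> defect_space L\<^sub>1 G"
  unfolding defect_space_def using closure_subset by fast

lemma defect_op_proj_defect_space: "defect_op L\<^sub>1 G (proj (defect_space L\<^sub>1 G) x) = defect_op L\<^sub>1 G x"
proof -
  let ?D = "defect_op L\<^sub>1 G" and ?y = "x - proj (defect_space L\<^sub>1 G) x"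
  have "cinner (?D ?y) (?D ?y) = cinner ?y (?D (?D ?y))"
    by (rule positive_op_symmetric[OF positive_defect_op])
  also have "\<dots> = 0"
    by (rule proj_orthogonal[OF hilbert_subspace_defect_space defect_op_in_defect_space])
  finally show ?thesis by (simp add: blinfun.diff_right)
qed

end

text \<open>The identity \<open>G (P - G\<^sup>* G) = (P - G G\<^sup>*) G\<close> passes to the square roots.\<close>

lemma defect_op_intertwine:
  assumes contraction: "subspace_contraction L\<^sub>1 L\<^sub>2 G"
  shows "G (defect_op L\<^sub>1 G x) = defect_op L\<^sub>2 (adj G) (G x)"
proof -
  note dual = subspace_contraction_adj[OF contraction]
  have L1: "hilbert_subspace L\<^sub>1" and L2: "hilbert_subspace L\<^sub>2" and G: "G \<in> operators L\<^sub>1 L\<^sub>2"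
    using contraction by (simp_all add: subspace_contraction_def)
  have "G o\<^sub>L (proj L\<^sub>1 - (adj G o\<^sub>L G)) = (proj L\<^sub>2 - (adj (adj G) o\<^sub>L adj G)) o\<^sub>L G"
    by (simp add: adj_adj[OF operators_complex_linear[OF G]] blinfun_eq_iff blinfun.diff_left
        blinfun.diff_right operators_proj_right[OF G L1] proj_ident[OF L2 operators_range[OF G L1]])
  then have "G o\<^sub>L defect_op L\<^sub>1 G = defect_op L\<^sub>2 (adj G) o\<^sub>L G"
    unfolding defect_op_def
    by (rule sqrt_op_intertwine[OF positive_defect_square[OF contraction]
          norm_id_minus_defect_square[OF contraction] positive_defect_square[OF dual]
          norm_id_minus_defect_square[OF dual]])
  then show ?thesis by (simp add: blinfun_eq_iff)
qed

text \<open>By the intertwining relation for \<open>G\<^sup>*\<close>, the adjoint maps the range of one defect operator into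
  that of the other.\<close>

lemma adj_in_defect_space:
  assumes contraction: "subspace_contraction L\<^sub>1 L\<^sub>2 G" and y: "y \<in> defect_space L\<^sub>2 (adj G)"
  shows "adj G y \<in> defect_space L\<^sub>1 G"
proof -
  have "adj (adj G) = G"
    using contraction by (meson adj_adj operators_complex_linear subspace_contraction_def)
  then have "adj G (defect_op L\<^sub>2 (adj G) y) = defect_op L\<^sub>1 G (adj G y)" for y
    using defect_op_intertwine[OF subspace_contraction_adj[OF contraction], of y] by simp
  then have "adj G ` range (defect_op L\<^sub>2 (adj G)) \<subseteq> range (defect_op L\<^sub>1 G)"
    by auto
  then have "adj G ` closure (range (defect_op L\<^sub>2 (adj G))) \<subseteq> closure (range (defect_op L\<^sub>1 G))"
    by (meson closure_bounded_linear_image_subset closure_mono blinfun.bounded_linear_right order_trans)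
  then show ?thesis using y by (auto simp: defect_space_def)
qed


section \<open>Inversion on a subspace\<close>

lemma is_inverse_on_unique:
  assumes L: "hilbert_subspace L" and Y: "is_inverse_on L X Y" and Z: "is_inverse_on L X Z"
  shows "Y = Z"
proof (rule blinfun_eqI)
  fix x
  have YL: "Y \<in> operators L L" and ZL: "Z \<in> operators L L" and XZ: "\<And>x. X (Z x) = proj L x"
    and YX: "\<And>x. Y (X x) = proj L x"
    using Y Z by (simp_all add: is_inverse_on_def blinfun_eq_iff)
  show "Y x = Z x"
    using YX[of "Z x"] by (simp add: XZ operators_proj_right[OF YL L] proj_ident[OF L operators_range[OF ZL L]])
qed

lemma is_inverse_on_inverse_on:
  assumes L: "hilbert_subspace L" and X: "invertible_on L X"
  shows "is_inverse_on L X (inverse_on L X)"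
  unfolding inverse_on_def
  using X is_inverse_on_unique[OF L] by (auto simp: invertible_on_def intro: theI2)

lemma inverse_on_operators:
  "hilbert_subspace L \<Longrightarrow> invertible_on L X \<Longrightarrow> inverse_on L X \<in> operators L L"
  using is_inverse_on_inverse_on by (auto simp: is_inverse_on_def)

lemma inverse_on_right:
  "hilbert_subspace L \<Longrightarrow> invertible_on L X \<Longrightarrow> X (inverse_on L X x) = proj L x"
  using is_inverse_on_inverse_on by (auto simp: is_inverse_on_def blinfun_eq_iff)

lemma inverse_on_eqI:
  assumes L: "hilbert_subspace L" and X: "invertible_on L X" and x: "x \<in> L" "X x = y"
  shows "inverse_on L X y = x"
proof -
  have "inverse_on L X (X x) = proj L x"
    using is_inverse_on_inverse_on[OF L X] by (auto simp: is_inverse_on_def blinfun_eq_iff)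
  then show ?thesis using x by (simp add: proj_ident[OF L])
qed

text \<open>The inverse maps \<open>g\<close> to the fixed point of the contraction \<open>x \<mapsto> P g + X x\<close> of \<open>L\<close>; the
  iteration stays in the complete set \<open>L\<close>.\<close>

lemma invertible_on_proj_diff:
  assumes L: "hilbert_subspace L" and X: "X \<in> operators L L"
    and c: "0 \<le> c" "c < 1" and bound: "\<And>x. norm (X x) \<le> c * norm x"
  shows "invertible_on L (proj L - X)"
    and "norm (inverse_on L (proj L - X) g) \<le> norm g / (1 - c)"
proof -
  have XL: "X x \<in> L" for x by (rule operators_range[OF X L])
  have "\<exists>!x\<in>L. proj L g + X x = x" for g
  proof (rule Banach_fix[OF hilbert_subspace_complete[OF L] _ c])
    show "L \<noteq> {}" using hilbert_subspace_zero[OF L] by blast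
    show "(\<lambda>x. proj L g + X x) ` L \<subseteq> L"
      using XL proj_in[OF L] hilbert_subspace_add[OF L] by blast
    show "dist (proj L g + X x) (proj L g + X y) \<le> c * dist x y" for x y
      using bound[of "x - y"] by (simp add: dist_norm blinfun.diff_right)
  qed
  then obtain r where r: "\<And>g. r g \<in> L" "\<And>g. proj L g + X (r g) = r g"
    and unique: "\<And>x g. x \<in> L \<Longrightarrow> proj L g + X x = x \<Longrightarrow> r g = x"
    by metis
  have r_bound: "norm (r g) \<le> norm g / (1 - c)" for g
  proof -
    have "norm (r g) \<le> norm (proj L g) + norm (X (r g))"
      using norm_triangle_ineq[of "proj L g" "X (r g)"] r(2)[of g] by simp
    also have "\<dots> \<le> norm g + c * norm (r g)"
      by (intro add_mono norm_proj_le L bound)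
    finally show ?thesis using c by (simp add: field_simps)
  qed
  have r_scaleC: "r (a *\<^sub>C g) = a *\<^sub>C r g" for a g
  proof (rule unique)
    show "a *\<^sub>C r g \<in> L" by (intro hilbert_subspace_scaleC L r)
    show "proj L (a *\<^sub>C g) + X (a *\<^sub>C r g) = a *\<^sub>C r g"
      using r(2)[of g] by (simp add: complex_linearD[OF complex_linear_proj[OF L]]
        complex_linearD[OF operators_complex_linear[OF X]] flip: scaleC_add_right)
  qed
  have "bounded_linear r"
  proof (rule bounded_linear_intro[where K = "1 / (1 - c)"])
    show "r (g + h) = r g + r h" for g h
    proof (rule unique)
      show "r g + r h \<in> L" by (intro hilbert_subspace_add L r)
      have "proj L (g + h) + X (r g + r h) = (proj L g + X (r g)) + (proj L h + X (r h))"
        by (simp add: blinfun.add_right)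
      then show "proj L (g + h) + X (r g + r h) = r g + r h" by (simp add: r)
    qed
    show "r (s *\<^sub>R g) = s *\<^sub>R r g" for s g
      using r_scaleC[of "complex_of_real s" g] by (simp add: scaleC_of_real)
    show "norm (r g) \<le> norm g * (1 / (1 - c))" for g
      using r_bound by simp
  qed
  then have R: "blinfun_apply (Blinfun r) = r" by (rule bounded_linear_Blinfun_apply)
  have r_proj: "r (proj L g) = r g" for g
    by (rule unique) (simp_all add: r proj_proj[OF L])
  have inv: "is_inverse_on L (proj L - X) (Blinfun r)"
    unfolding is_inverse_on_def
  proof (intro conjI)
    show "Blinfun r \<in> operators L L"
      by (rule operatorsI_proj) (simp_all add: R L complex_linear_def r_scaleC r_proj r)
    show "(proj L - X) o\<^sub>L Blinfun r = proj L"
    proof (rule blinfun_eqI)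
      fix g
      have "proj L (r g) - X (r g) = proj L g"
        using r(2)[of g] proj_ident[OF L r(1)] by (simp add: algebra_simps)
      then show "((proj L - X) o\<^sub>L Blinfun r) g = proj L g"
        by (simp add: blinfun.diff_left R)
    qed
    show "Blinfun r o\<^sub>L (proj L - X) = proj L"
    proof (rule blinfun_eqI)
      fix x
      have "r (proj L x - X x) = proj L x"
        by (rule unique)
          (simp_all add: proj_in[OF L] blinfun.diff_right proj_proj[OF L] proj_ident[OF L XL]
            operators_proj_right[OF X L])
      then show "(Blinfun r o\<^sub>L (proj L - X)) x = proj L x"
        by (simp add: blinfun.diff_left R)
    qed
  qed
  then show invertible: "invertible_on L (proj L - X)"
    unfolding invertible_on_def using operators_diff[OF operators_proj[OF L] X L] by blast
  have "inverse_on L (proj L - X) = Blinfun r"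
    by (rule is_inverse_on_unique[OF L is_inverse_on_inverse_on[OF L invertible] inv])
  then show "norm (inverse_on L (proj L - X) g) \<le> norm g / (1 - c)"
    by (simp add: R r_bound)
qed

section \<open>Elementary rotations\<close>

definition contraction_sequence :: "(nat \<Rightarrow> 'm::chilbert_space \<Rightarrow>\<^sub>L 'n::chilbert_space) \<Rightarrow> bool" where
  "contraction_sequence \<Gamma> \<longleftrightarrow> (\<forall>k. subspace_contraction (dom_space \<Gamma> k) (cod_space \<Gamma> k) (\<Gamma> k))"

lemma cinner_prod_Pair: "cinner (a, b) p = cinner a (fst p) + cinner b (snd p)"
  "cinner p (a, b) = cinner (fst p) a + cinner (snd p) b"
  by (simp_all add: cinner_prod_def)

lemma norm_prod_power2: "(norm p)\<^sup>2 = (norm (fst p))\<^sup>2 + (norm (snd p))\<^sup>2"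
  by (simp add: norm_prod_def)

lemma fst_scaleC [simp]: "fst (a *\<^sub>C p) = a *\<^sub>C fst p"
  and snd_scaleC [simp]: "snd (a *\<^sub>C p) = a *\<^sub>C snd p"
  by (simp_all add: scaleC_prod_def)

lemma scaleC_Pair: "a *\<^sub>C (x, y) = (a *\<^sub>C x, a *\<^sub>C y)"
  by (simp add: scaleC_prod_def)

lemma inl_op_apply [simp]: "blinfun_apply inl_op x = (x, 0)"
  and inr_op_apply [simp]: "blinfun_apply inr_op y = (0, y)"
  by (simp_all add: inl_op.rep_eq inr_op.rep_eq)

lemma row_op_apply [simp]: "blinfun_apply (row_op A B) p = A (fst p) + B (snd p)"
  by (simp add: row_op_def blinfun.add_left)

lemma block_op_apply_prod: "block_op A B C D p = (A (fst p) + B (snd p), C (fst p) + D (snd p))"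
  by (cases p) (simp add: block_op_apply)

lemma complex_linear_inl_op: "complex_linear inl_op"
  and complex_linear_inr_op: "complex_linear inr_op"
  by (simp_all add: complex_linear_def scaleC_prod_def)

lemma complex_linear_row_op:
  "complex_linear A \<Longrightarrow> complex_linear B \<Longrightarrow> complex_linear (row_op A B)"
  by (simp add: complex_linear_def scaleC_add_right)

context
  fixes \<Gamma> :: "nat \<Rightarrow> 'm::chilbert_space \<Rightarrow>\<^sub>L 'n::chilbert_space"
  assumes contractions: "contraction_sequence \<Gamma>"
begin

lemma contraction_at: "subspace_contraction (dom_space \<Gamma> k) (cod_space \<Gamma> k) (\<Gamma> k)"
  using contractions by (simp add: contraction_sequence_def)

lemma hilbert_subspace_dom_space: "hilbert_subspace (dom_space \<Gamma> k)"
  and hilbert_subspace_cod_space: "hilbert_subspace (cod_space \<Gamma> k)"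
  and schur_parameter_operators: "\<Gamma> k \<in> operators (dom_space \<Gamma> k) (cod_space \<Gamma> k)"
  and norm_schur_parameter_le: "norm (\<Gamma> k) \<le> 1"
  using contraction_at by (simp_all add: subspace_contraction_def)

lemma complex_linear_schur_parameter: "complex_linear (\<Gamma> k)"
  by (rule operators_complex_linear[OF schur_parameter_operators])

lemma adj_schur_parameter_in: "y \<in> cod_space \<Gamma> (Suc k) \<Longrightarrow> adj (\<Gamma> k) y \<in> dom_space \<Gamma> (Suc k)"
  by (simp add: adj_in_defect_space[OF contraction_at])

lemma defect_in: "defect \<Gamma> k x \<in> dom_space \<Gamma> (Suc k)"
  and codefect_in: "codefect \<Gamma> k y \<in> cod_space \<Gamma> (Suc k)"
  by (simp_all add: defect_def codefect_def defect_op_in_defect_space[OF contraction_at]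
      defect_op_in_defect_space[OF subspace_contraction_adj[OF contraction_at]])

lemma cod_space_decreasing: "cod_space \<Gamma> (Suc k) \<subseteq> cod_space \<Gamma> k"
  using defect_space_subset[OF subspace_contraction_adj[OF contraction_at]] by simp

lemma defect_proj: "defect \<Gamma> k (proj (dom_space \<Gamma> k) x) = defect \<Gamma> k x"
  by (simp add: defect_def defect_op_proj[OF contraction_at])

lemma codefect_proj: "codefect \<Gamma> k (proj (cod_space \<Gamma> (Suc k)) y) = codefect \<Gamma> k y"
  by (simp add: codefect_def defect_op_proj_defect_space[OF subspace_contraction_adj[OF contraction_at]])

lemma complex_linear_defect: "complex_linear (defect \<Gamma> k)"
  and complex_linear_codefect: "complex_linear (codefect \<Gamma> k)"
  by (simp_all add: defect_def codefect_def complex_linear_defect_op[OF contraction_at]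
      complex_linear_defect_op[OF subspace_contraction_adj[OF contraction_at]])

lemma neg_adj_restrict_apply: "neg_adj_restrict \<Gamma> k y = - adj (\<Gamma> k) (proj (cod_space \<Gamma> (Suc k)) y)"
  by (simp add: neg_adj_restrict_def blinfun.minus_left del: cod_space.simps)

lemma rotation_apply:
  "elementary_rotation \<Gamma> k p = (\<Gamma> k (fst p) + codefect \<Gamma> k (snd p),
      defect \<Gamma> k (fst p) - adj (\<Gamma> k) (proj (cod_space \<Gamma> (Suc k)) (snd p)))"
  by (simp add: elementary_rotation_def block_op_apply_prod neg_adj_restrict_apply del: cod_space.simps)

lemma rotation_scaleC: "elementary_rotation \<Gamma> k (a *\<^sub>C p) = a *\<^sub>C elementary_rotation \<Gamma> k p"
proof -
  have adj_linear: "complex_linear (adj (\<Gamma> k))"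
    by (intro complex_linear_adj complex_linear_schur_parameter)
  show ?thesis
    by (simp add: rotation_apply scaleC_prod_def scaleC_add_right scaleC_diff_right
        complex_linearD[OF complex_linear_schur_parameter] complex_linearD[OF complex_linear_defect]
        complex_linearD[OF complex_linear_codefect] complex_linearD[OF adj_linear]
        complex_linearD[OF complex_linear_proj[OF hilbert_subspace_cod_space]]
        del: cod_space.simps)
qed

lemma rotation_in:
  assumes x: "fst p \<in> dom_space \<Gamma> k"
  shows "fst (elementary_rotation \<Gamma> k p) \<in> cod_space \<Gamma> k"
    and "snd (elementary_rotation \<Gamma> k p) \<in> dom_space \<Gamma> (Suc k)"
proof -
  have "codefect \<Gamma> k (snd p) \<in> cod_space \<Gamma> k"
    using codefect_in cod_space_decreasing by blast
  then show "fst (elementary_rotation \<Gamma> k p) \<in> cod_space \<Gamma> k"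
    using x unfolding rotation_apply fst_conv
    by (intro hilbert_subspace_add hilbert_subspace_cod_space operators_in[OF schur_parameter_operators])
  show "snd (elementary_rotation \<Gamma> k p) \<in> dom_space \<Gamma> (Suc k)"
    unfolding rotation_apply snd_conv
    by (intro hilbert_subspace_diff hilbert_subspace_dom_space defect_in adj_schur_parameter_in
        proj_in hilbert_subspace_cod_space)
qed

lemma rotation_proj:
  "elementary_rotation \<Gamma> k (proj (dom_space \<Gamma> k) x, proj (cod_space \<Gamma> (Suc k)) y)
    = elementary_rotation \<Gamma> k (x, y)"
  by (simp add: rotation_apply defect_proj codefect_proj hilbert_subspace_cod_space
      operators_proj_right[OF schur_parameter_operators hilbert_subspace_dom_space]
      del: cod_space.simps)

text \<open>The cross terms of the two components cancel because \<open>D\<^sub>\<Gamma> \<Gamma>\<^sup>* = \<Gamma>\<^sup>* D\<^sub>\<Gamma>\<^sub>*\<close>.\<close>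

lemma norm_rotation_power2:
  "(norm (elementary_rotation \<Gamma> k (x, y)))\<^sup>2
    = (norm (proj (dom_space \<Gamma> k) x))\<^sup>2 + (norm (proj (cod_space \<Gamma> (Suc k)) y))\<^sup>2"
proof -
  let ?G = "\<Gamma> k" and ?y = "proj (cod_space \<Gamma> (Suc k)) y"
  let ?D = "defect \<Gamma> k" and ?E = "codefect \<Gamma> k"
  note dual = subspace_contraction_adj[OF contraction_at]
  have y: "proj (cod_space \<Gamma> k) ?y = ?y"
    using proj_in[OF hilbert_subspace_cod_space] cod_space_decreasing
    by (intro proj_ident hilbert_subspace_cod_space) blast
  have "inner (?G x) (?E ?y) = inner x (adj ?G (?E ?y))"
    by (simp add: cinner_adj[OF complex_linear_schur_parameter] flip: Re_cinner)
  also have "adj ?G (?E ?y) = ?D (adj ?G ?y)"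
    using defect_op_intertwine[OF dual]
    by (simp add: defect_def codefect_def adj_adj[OF complex_linear_schur_parameter])
  also have "inner x (?D (adj ?G ?y)) = inner (?D x) (adj ?G ?y)"
    by (simp add: defect_def positive_op_inner_symmetric[OF positive_defect_op[OF contraction_at]])
  finally have cross: "inner (?G x) (?E ?y) = inner (?D x) (adj ?G ?y)" .
  have "(norm (elementary_rotation \<Gamma> k (x, y)))\<^sup>2
      = (norm (?G x + ?E ?y))\<^sup>2 + (norm (?D x - adj ?G ?y))\<^sup>2"
    by (simp only: rotation_apply norm_prod_power2 fst_conv snd_conv codefect_proj)
  also have "\<dots> = ((norm (?G x))\<^sup>2 + (norm (?D x))\<^sup>2) + ((norm (adj ?G ?y))\<^sup>2 + (norm (?E ?y))\<^sup>2)"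
    using cross by (simp add: power2_norm_eq_inner inner_add inner_diff inner_commute)
  also have "(norm (?G x))\<^sup>2 + (norm (?D x))\<^sup>2 = (norm (proj (dom_space \<Gamma> k) x))\<^sup>2"
    unfolding defect_def by (rule norm_defect_op[OF contraction_at])
  also have "(norm (adj ?G ?y))\<^sup>2 + (norm (?E ?y))\<^sup>2 = (norm ?y)\<^sup>2"
    using norm_defect_op[OF dual, of k ?y] by (simp only: codefect_def y)
  finally show ?thesis .
qed

lemma norm_rotation_le: "(norm (elementary_rotation \<Gamma> k p))\<^sup>2 \<le> (norm p)\<^sup>2"
proof -
  have "(norm (elementary_rotation \<Gamma> k (fst p, snd p)))\<^sup>2 \<le> (norm (fst p))\<^sup>2 + (norm (snd p))\<^sup>2"
    unfolding norm_rotation_power2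
    by (intro add_mono power_mono norm_proj_le hilbert_subspace_dom_space hilbert_subspace_cod_space) auto
  then show ?thesis by (simp add: norm_prod_power2[of p])
qed

end

section \<open>Finite direct sums in the space of square-summable sequences\<close>

lemma ell2_nth_zero [simp]: "ell2_nth 0 j = 0"
  and ell2_nth_add [simp]: "ell2_nth (x + y) j = ell2_nth x j + ell2_nth y j"
  and ell2_nth_scaleC [simp]: "ell2_nth (a *\<^sub>C x) j = a *\<^sub>C ell2_nth x j"
  by (simp_all add: zero_ell2.rep_eq plus_ell2.rep_eq scaleC_ell2.rep_eq)

lemma ell2_nth_diff [simp]: "ell2_nth (x - y) j = ell2_nth x j - ell2_nth y j"
  unfolding minus_ell2_def plus_ell2.rep_eq uminus_ell2.rep_eq by simp

lemma ell2_nth_sum: "ell2_nth (sum f I) j = (\<Sum>i\<in>I. ell2_nth (f i) j)"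
  by (induction I rule: infinite_finite_induct) simp_all

lemma ell2_eqI: "(\<And>j. ell2_nth x j = ell2_nth y j) \<Longrightarrow> x = y"
  by (metis ell2_nth_inject ext)

lemma ell2_coord_apply [simp]: "blinfun_apply (ell2_coord j) x = ell2_nth x j"
  by (simp add: ell2_coord.rep_eq)

lemma ell2_nth_embed [simp]: "ell2_nth (blinfun_apply (ell2_embed k) a) j = (if j = k then a else 0)"
  by (simp add: ell2_embed.rep_eq ell2_single.rep_eq)

lemma complex_linear_ell2_coord: "complex_linear (ell2_coord j)"
  by (simp add: complex_linear_def)

lemma complex_linear_ell2_embed: "complex_linear (ell2_embed j)"
  unfolding complex_linear_def by (intro allI ell2_eqI) simp

lemma cinner_ell2_embed: "cinner x (ell2_embed k a) = cinner (ell2_nth x k) a"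
proof -
  have "cinner x (ell2_embed k a) = (\<Sum>j. if j = k then cinner (ell2_nth x k) a else 0)"
    unfolding cinner_ell2_def by (intro suminf_cong) simp
  also have "\<dots> = cinner (ell2_nth x k) a"
    by (subst suminf_finite[of "{k}"]) auto
  finally show ?thesis .
qed

lemma norm_ell2_power2: "(norm x)\<^sup>2 = (\<Sum>j. (norm (ell2_nth x j))\<^sup>2)"
  by (simp add: power2_norm_eq_inner inner_ell2_def)

lemma norm_ell2_power2_finite:
  assumes "\<And>j. j > n \<Longrightarrow> ell2_nth x j = 0"
  shows "(norm x)\<^sup>2 = (\<Sum>j\<le>n. (norm (ell2_nth x j))\<^sup>2)"
  unfolding norm_ell2_power2 by (rule suminf_finite) (use assms in auto)

lemma sum_norm_ell2_nth_le: "(\<Sum>j\<le>n. (norm (ell2_nth x j))\<^sup>2) \<le> (norm x)\<^sup>2"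
  unfolding norm_ell2_power2 by (rule sum_le_suminf[OF summable_ell2]) simp_all

lemma ell2_eq_sum_embed:
  assumes "\<And>j. j > n \<Longrightarrow> ell2_nth x j = 0"
  shows "x = (\<Sum>j\<le>n. ell2_embed j (ell2_nth x j))"
proof (rule ell2_eqI)
  fix i
  show "ell2_nth x i = ell2_nth (\<Sum>j\<le>n. ell2_embed j (ell2_nth x j)) i"
    using assms[of i] by (auto simp: ell2_nth_sum)
qed

context
  fixes \<Gamma> :: "nat \<Rightarrow> 'm::chilbert_space \<Rightarrow>\<^sub>L 'n::chilbert_space"
  assumes contractions: "contraction_sequence \<Gamma>"
begin

lemma closed_H_space: "closed (H_space \<Gamma> j)"
  unfolding H_space_def
  by (intro closed_Times complete_imp_closed hilbert_subspace_complete
      hilbert_subspace_dom_space hilbert_subspace_cod_space contractions)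

lemma zero_in_H_space: "0 \<in> H_space \<Gamma> j"
  unfolding H_space_def zero_prod_def
  using hilbert_subspace_zero[OF hilbert_subspace_dom_space[OF contractions]]
    hilbert_subspace_zero[OF hilbert_subspace_cod_space[OF contractions]] by blast

text \<open>A Cauchy sequence of \<open>K\<close> converges in each of its finitely many components.\<close>

lemma hilbert_subspace_K_space: "hilbert_subspace (K_space \<Gamma> n)"
  unfolding hilbert_subspace_def
proof (intro conjI ballI allI)
  show "complete (K_space \<Gamma> n)"
    unfolding complete_def
  proof safe
    fix f :: "nat \<Rightarrow> ('m \<times> 'n) ell2"
    assume f: "\<forall>i. f i \<in> K_space \<Gamma> n" and "Cauchy f"
    have "Cauchy (\<lambda>i. ell2_coord j (f i))" for j
      by (rule bounded_linear.Cauchy[OF blinfun.bounded_linear_right \<open>Cauchy f\<close>])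
    then have "\<exists>l. (\<lambda>i. ell2_coord j (f i)) \<longlonglongrightarrow> l" for j
      using Cauchy_convergent convergentD by blast
    then obtain l where l: "\<And>j. (\<lambda>i. ell2_nth (f i) j) \<longlonglongrightarrow> l j"
      unfolding ell2_coord_apply by metis
    define y where "y = (\<Sum>j\<le>n. ell2_embed j (l j))"
    have "(\<lambda>i. \<Sum>j\<le>n. ell2_embed j (ell2_nth (f i) j)) \<longlonglongrightarrow> y"
      unfolding y_def by (intro tendsto_intros l)
    moreover have "(\<lambda>i. \<Sum>j\<le>n. ell2_embed j (ell2_nth (f i) j)) = f"
      using f by (intro ext ell2_eq_sum_embed[symmetric]) (auto simp: K_space_def)
    ultimately have "f \<longlonglongrightarrow> y" by simp
    moreover have "y \<in> K_space \<Gamma> n"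
    proof -
      have "l j \<in> H_space \<Gamma> j" if "j \<le> n" for j
        by (rule Lim_in_closed_set[OF closed_H_space _ _ l]) (use f that in \<open>auto simp: K_space_def\<close>)
      then show ?thesis by (auto simp: K_space_def y_def ell2_nth_sum)
    qed
    ultimately show "\<exists>l\<in>K_space \<Gamma> n. f \<longlonglongrightarrow> l" by blast
  qed
  show "0 \<in> K_space \<Gamma> n"
    by (simp add: K_space_def zero_in_H_space)
  note subspaces = hilbert_subspace_dom_space[OF contractions] hilbert_subspace_cod_space[OF contractions]
  show "x + y \<in> K_space \<Gamma> n" if "x \<in> K_space \<Gamma> n" "y \<in> K_space \<Gamma> n" for x y
    using that by (auto simp: K_space_def H_space_def mem_Times_iff intro!: hilbert_subspace_add subspaces
      simp del: cod_space.simps)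
  show "c *\<^sub>C x \<in> K_space \<Gamma> n" if "x \<in> K_space \<Gamma> n" for c x
    using that by (auto simp: K_space_def H_space_def mem_Times_iff intro!: hilbert_subspace_scaleC subspaces
      simp del: cod_space.simps)
qed

lemma ell2_embed_in_K_space: "j \<le> n \<Longrightarrow> a \<in> H_space \<Gamma> j \<Longrightarrow> ell2_embed j a \<in> K_space \<Gamma> n"
  by (auto simp: K_space_def zero_in_H_space)

end


section \<open>The truncated CMV-type operator\<close>

lemma even_factor_nth:
  "ell2_nth (even_factor \<Gamma> n x) j = (if j \<le> n then elementary_rotation \<Gamma> (2 * j) (ell2_nth x j) else 0)"
proof -
  have "ell2_nth (even_factor \<Gamma> n x) j
      = (\<Sum>i\<le>n. if j = i then elementary_rotation \<Gamma> (2 * i) (ell2_nth x i) else 0)"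
    by (simp add: even_factor_def blinfun.sum_left ell2_nth_sum)
  then show ?thesis by simp
qed

text \<open>The value of the rotation that acts across the summands \<open>k - 1\<close> and \<open>k\<close>, with the two outputs
  exchanged: the upper one belongs to the second component at \<open>k - 1\<close>, the lower one to the first
  component at \<open>k\<close>.\<close>

definition odd_rotation ::
    "(nat \<Rightarrow> 'm::complex_inner \<Rightarrow>\<^sub>L 'n::complex_inner) \<Rightarrow> ('n \<times> 'm) ell2 \<Rightarrow> nat \<Rightarrow> 'm \<times> 'n" where
  "odd_rotation \<Gamma> y k =
    (let p = elementary_rotation \<Gamma> (2 * k - 1) (snd (ell2_nth y (k - 1)), fst (ell2_nth y k))
     in (snd p, fst p))"

lemma odd_factor_nth_sum:
  "ell2_nth (odd_factor \<Gamma> n y) j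
    = (\<Sum>k\<in>{1..n}. (if j = k then fst (odd_rotation \<Gamma> y k) else 0, if j = k - 1 then snd (odd_rotation \<Gamma> y k) else 0))"
  unfolding odd_factor_def blinfun.sum_left ell2_nth_sum
  by (intro sum.cong refl)
    (auto simp: odd_rotation_def Let_def blinfun.add_left zero_prod_def)

lemma fst_odd_factor_nth:
  "fst (ell2_nth (odd_factor \<Gamma> n y) j) = (if 1 \<le> j \<and> j \<le> n then fst (odd_rotation \<Gamma> y j) else 0)"
  unfolding odd_factor_nth_sum fst_sum fst_conv by simp

lemma snd_odd_factor_nth:
  "snd (ell2_nth (odd_factor \<Gamma> n y) j) = (if j < n then snd (odd_rotation \<Gamma> y (Suc j)) else 0)"
proof -
  have "snd (ell2_nth (odd_factor \<Gamma> n y) j)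
      = (\<Sum>k\<in>{1..n}. if k = Suc j then snd (odd_rotation \<Gamma> y k) else 0)"
    unfolding odd_factor_nth_sum snd_sum snd_conv by (intro sum.cong) auto
  then show ?thesis by auto
qed

lemma odd_factor_nth_beyond: "n < j \<Longrightarrow> ell2_nth (odd_factor \<Gamma> n y) j = 0"
  by (rule prod_eqI) (simp_all add: fst_odd_factor_nth snd_odd_factor_nth)

context
  fixes \<Gamma> :: "nat \<Rightarrow> 'm::chilbert_space \<Rightarrow>\<^sub>L 'n::chilbert_space"
  assumes contractions: "contraction_sequence \<Gamma>"
begin

text \<open>Each component of \<open>y\<close> up to position \<open>n\<close> enters exactly one odd rotation, except for the first component at
  position \<open>0\<close> and the second one at position \<open>n\<close>, which are mapped to zero. The energy of these
  two is therefore available as a surplus; up to a factor \<open>z\<close> they are the output of the system.\<close>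

lemma odd_factor_energy:
  "(norm (odd_factor \<Gamma> n y))\<^sup>2 + (norm (fst (ell2_nth y 0)))\<^sup>2 + (norm (snd (ell2_nth y n)))\<^sup>2
    \<le> (\<Sum>j\<le>n. (norm (ell2_nth y j))\<^sup>2)"
proof -
  \<comment> \<open>The first components at positions \<open>1\<close> to \<open>n\<close> and the second ones at positions \<open>0\<close> to \<open>n - 1\<close>
     are both indexed by the rotations \<open>1\<close> to \<open>n\<close> that involve them.\<close>
  have first: "(\<Sum>j\<le>n. f j) = f 0 + (\<Sum>j\<in>{1..n}. f j)" for f :: "nat \<Rightarrow> real"
    by (simp add: atMost_atLeast0 sum.atLeast_Suc_atMost)
  have last: "(\<Sum>j\<le>n. f j) = (\<Sum>k\<in>{1..n}. f (k - 1)) + f n" for f :: "nat \<Rightarrow> real"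
  proof -
    have "(\<Sum>k\<in>{1..n}. f (k - 1)) = (\<Sum>j<n. f j)"
      by (rule sum.reindex_bij_witness[of _ Suc "\<lambda>k. k - 1"]) auto
    then show ?thesis by (simp flip: lessThan_Suc_atMost)
  qed
  have rotation: "(norm (fst (odd_rotation \<Gamma> y k)))\<^sup>2 + (norm (snd (odd_rotation \<Gamma> y k)))\<^sup>2
      \<le> (norm (snd (ell2_nth y (k - 1))))\<^sup>2 + (norm (fst (ell2_nth y k)))\<^sup>2" for k
    using norm_rotation_le[OF contractions, of "2 * k - 1" "(snd (ell2_nth y (k - 1)), fst (ell2_nth y k))"]
    by (simp add: odd_rotation_def Let_def norm_prod_power2)
  have "(norm (odd_factor \<Gamma> n y))\<^sup>2
      = (\<Sum>j\<le>n. (norm (fst (ell2_nth (odd_factor \<Gamma> n y) j)))\<^sup>2)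
        + (\<Sum>j\<le>n. (norm (snd (ell2_nth (odd_factor \<Gamma> n y) j)))\<^sup>2)"
    by (subst norm_ell2_power2_finite[where n = n])
      (simp_all add: odd_factor_nth_beyond norm_prod_power2 sum.distrib)
  also have "(\<Sum>j\<le>n. (norm (fst (ell2_nth (odd_factor \<Gamma> n y) j)))\<^sup>2)
      = (\<Sum>k\<in>{1..n}. (norm (fst (odd_rotation \<Gamma> y k)))\<^sup>2)"
    unfolding first by (simp add: fst_odd_factor_nth)
  also have "(\<Sum>j\<le>n. (norm (snd (ell2_nth (odd_factor \<Gamma> n y) j)))\<^sup>2)
      = (\<Sum>k\<in>{1..n}. (norm (snd (odd_rotation \<Gamma> y k)))\<^sup>2)"
    unfolding last by (auto simp: snd_odd_factor_nth intro!: sum.cong)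
  also have "(\<Sum>k\<in>{1..n}. (norm (fst (odd_rotation \<Gamma> y k)))\<^sup>2) + (\<Sum>k\<in>{1..n}. (norm (snd (odd_rotation \<Gamma> y k)))\<^sup>2)
      \<le> (\<Sum>k\<in>{1..n}. (norm (snd (ell2_nth y (k - 1))))\<^sup>2) + (\<Sum>k\<in>{1..n}. (norm (fst (ell2_nth y k)))\<^sup>2)"
    unfolding sum.distrib[symmetric] by (rule sum_mono) (rule rotation)
  finally have "(norm (odd_factor \<Gamma> n y))\<^sup>2
      \<le> (\<Sum>k\<in>{1..n}. (norm (snd (ell2_nth y (k - 1))))\<^sup>2) + (\<Sum>k\<in>{1..n}. (norm (fst (ell2_nth y k)))\<^sup>2)" .
  moreover have "(\<Sum>j\<le>n. (norm (ell2_nth y j))\<^sup>2)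
      = (\<Sum>j\<le>n. (norm (fst (ell2_nth y j)))\<^sup>2) + (\<Sum>j\<le>n. (norm (snd (ell2_nth y j)))\<^sup>2)"
    by (simp add: norm_prod_power2 sum.distrib)
  ultimately show ?thesis
    using first[of "\<lambda>j. (norm (fst (ell2_nth y j)))\<^sup>2"] last[of "\<lambda>j. (norm (snd (ell2_nth y j)))\<^sup>2"]
    by linarith
qed

lemma S_op_energy:
  "(norm (S_op \<Gamma> n x))\<^sup>2 + (norm (fst (elementary_rotation \<Gamma> 0 (ell2_nth x 0))))\<^sup>2
      + (norm (snd (elementary_rotation \<Gamma> (2 * n) (ell2_nth x n))))\<^sup>2 \<le> (norm x)\<^sup>2"
proof -
  have "(\<Sum>j\<le>n. (norm (ell2_nth (even_factor \<Gamma> n x) j))\<^sup>2) \<le> (\<Sum>j\<le>n. (norm (ell2_nth x j))\<^sup>2)"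
    by (intro sum_mono) (simp add: even_factor_nth norm_rotation_le[OF contractions])
  also have "\<dots> \<le> (norm x)\<^sup>2" by (rule sum_norm_ell2_nth_le)
  finally show ?thesis
    using odd_factor_energy[of n "even_factor \<Gamma> n x"] by (simp add: even_factor_nth S_op_def)
qed

lemma norm_S_op_le: "norm (S_op \<Gamma> n x) \<le> norm x"
proof -
  have "(norm (S_op \<Gamma> n x))\<^sup>2 \<le> (norm x)\<^sup>2"
    using S_op_energy[of n x] by (smt (verit) zero_le_power2)
  then show ?thesis by (rule power2_le_imp_le) simp
qed

lemma fst_S_op_nth_0: "fst (ell2_nth (S_op \<Gamma> n x) 0) = 0"
  by (simp add: S_op_def fst_odd_factor_nth)

lemma snd_S_op_nth_last: "snd (ell2_nth (S_op \<Gamma> n x) n) = 0"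
  by (simp add: S_op_def snd_odd_factor_nth)

lemma complex_linear_rotation: "complex_linear (elementary_rotation \<Gamma> k)"
  by (simp add: complex_linear_def rotation_scaleC[OF contractions])

lemma complex_linear_S_op: "complex_linear (S_op \<Gamma> n)"
proof -
  have "complex_linear (even_factor \<Gamma> n)"
    unfolding even_factor_def
    by (intro complex_linear_intros complex_linear_rotation complex_linear_ell2_embed complex_linear_ell2_coord)
  moreover have "complex_linear (fst_blinfun :: ('n \<times> 'm) \<Rightarrow>\<^sub>L 'n)"
    "complex_linear (snd_blinfun :: ('n \<times> 'm) \<Rightarrow>\<^sub>L 'm)"
    by (simp_all add: complex_linear_def)
  then have "complex_linear (odd_factor \<Gamma> n)"
    unfolding odd_factor_def
    by (intro complex_linear_intros complex_linear_rotation complex_linear_ell2_embed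
        complex_linear_ell2_coord complex_linear_row_op complex_linear_inl_op complex_linear_inr_op)
  ultimately show ?thesis
    unfolding S_op_def by (intro complex_linear_compose)
qed

text \<open>A vector is orthogonal to \<open>K\<close> only if each of its components up to \<open>n\<close> is orthogonal to the
  corresponding summand, and there the even rotations vanish.\<close>

lemma S_op_operators: "S_op \<Gamma> n \<in> operators (K_space \<Gamma> n) (K_space \<Gamma> n)"
proof (rule operatorsI[OF complex_linear_S_op])
  fix x assume x: "x \<in> K_space \<Gamma> n"
  define y where "y = even_factor \<Gamma> n x"
  have y: "fst (ell2_nth y j) \<in> cod_space \<Gamma> (2 * j)" "snd (ell2_nth y j) \<in> dom_space \<Gamma> (Suc (2 * j))"
    if "j \<le> n" for j
  proof -
    have "fst (ell2_nth x j) \<in> dom_space \<Gamma> (2 * j)"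
      using x that by (auto simp: K_space_def H_space_def mem_Times_iff)
    from rotation_in[OF contractions this] that
    show "fst (ell2_nth y j) \<in> cod_space \<Gamma> (2 * j)" "snd (ell2_nth y j) \<in> dom_space \<Gamma> (Suc (2 * j))"
      by (simp_all add: y_def even_factor_nth del: dom_space.simps)
  qed
  have odd: "snd (odd_rotation \<Gamma> y (Suc j)) \<in> cod_space \<Gamma> (Suc (2 * j))"
    "fst (odd_rotation \<Gamma> y (Suc j)) \<in> dom_space \<Gamma> (2 * Suc j)" if "j \<le> n" for j
    using rotation_in[OF contractions, of "(snd (ell2_nth y j), fst (ell2_nth y (Suc j)))" "Suc (2 * j)"] y[OF that]
    by (simp_all add: odd_rotation_def Let_def del: dom_space.simps cod_space.simps)
  have zero: "0 \<in> dom_space \<Gamma> k" "0 \<in> cod_space \<Gamma> k" for k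
    using hilbert_subspace_zero hilbert_subspace_dom_space hilbert_subspace_cod_space contractions by blast+
  have "ell2_nth (S_op \<Gamma> n x) j \<in> H_space \<Gamma> j" if "j \<le> n" for j
  proof -
    have "fst (ell2_nth (S_op \<Gamma> n x) j) \<in> dom_space \<Gamma> (2 * j)"
      using odd(2)[of "j - 1"] that zero
      by (cases j) (simp_all add: S_op_def fst_odd_factor_nth y_def del: dom_space.simps)
    moreover have "snd (ell2_nth (S_op \<Gamma> n x) j) \<in> cod_space \<Gamma> (Suc (2 * j))"
      using odd(1)[OF that] zero by (simp add: S_op_def snd_odd_factor_nth y_def del: cod_space.simps)
    ultimately show ?thesis by (simp add: H_space_def mem_Times_iff)
  qed
  then show "S_op \<Gamma> n x \<in> K_space \<Gamma> n"
    by (simp add: K_space_def S_op_def odd_factor_nth_beyond)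
next
  fix x assume x: "\<And>y. y \<in> K_space \<Gamma> n \<Longrightarrow> cinner x y = 0"
  have "elementary_rotation \<Gamma> (2 * j) (ell2_nth x j) = 0" if "j \<le> n" for j
  proof -
    note subspaces = hilbert_subspace_dom_space[OF contractions] hilbert_subspace_cod_space[OF contractions]
    have H: "cinner (ell2_nth x j) a = 0" if "a \<in> H_space \<Gamma> j" for a
      using x[OF ell2_embed_in_K_space[OF contractions \<open>j \<le> n\<close> that]] by (simp add: cinner_ell2_embed)
    have orth: "cinner (fst (ell2_nth x j)) u + cinner (snd (ell2_nth x j)) v = 0"
      if "u \<in> dom_space \<Gamma> (2 * j)" "v \<in> cod_space \<Gamma> (Suc (2 * j))" for u v
      using H[of "(u, v)"] that by (simp add: H_space_def cinner_prod_Pair del: cod_space.simps)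
    have "proj (dom_space \<Gamma> (2 * j)) (fst (ell2_nth x j)) = 0"
      using orth[OF _ hilbert_subspace_zero] by (intro proj_eq_zero) (simp_all add: subspaces del: cod_space.simps)
    moreover have "proj (cod_space \<Gamma> (Suc (2 * j))) (snd (ell2_nth x j)) = 0"
      using orth[OF hilbert_subspace_zero] by (intro proj_eq_zero) (simp_all add: subspaces del: cod_space.simps)
    ultimately show ?thesis
      using rotation_proj[OF contractions, of "2 * j" "fst (ell2_nth x j)" "snd (ell2_nth x j)"]
      by (simp add: zero_prod_def[symmetric] del: cod_space.simps)
  qed
  then have "even_factor \<Gamma> n x = 0"
    by (intro ell2_eqI) (simp add: even_factor_nth)
  then show "S_op \<Gamma> n x = 0" by (simp add: S_op_def)
qed

end

section \<open>The transfer function of the truncated operator\<close>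

text \<open>The embedding of the external inputs into the state space; for \<open>n = 0\<close> both entries belong to the
  same summand.\<close>

definition input_op :: "nat \<Rightarrow> ('m::complex_inner \<times> 'n::complex_inner) \<Rightarrow>\<^sub>L ('m \<times> 'n) ell2" where
  "input_op n = row_op (ell2_embed 0 o\<^sub>L inl_op) (ell2_embed n o\<^sub>L inr_op)"

lemma input_op_nth:
  "ell2_nth (input_op n p) j = (if j = 0 then fst p else 0, if j = n then snd p else 0)"
  by (auto simp: input_op_def zero_prod_def)

lemma complex_linear_input_op: "complex_linear (input_op n)"
  unfolding input_op_def
  by (intro complex_linear_row_op complex_linear_compose complex_linear_ell2_embed
      complex_linear_inl_op complex_linear_inr_op)

lemma cinner_input_op: "cinner x (input_op n p) = cinner (fst (ell2_nth x 0)) (fst p) + cinner (snd (ell2_nth x n)) (snd p)"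
  by (simp add: input_op_def cinner_add_right cinner_ell2_embed cinner_prod_Pair)

lemma norm_input_op: "(norm (input_op n p))\<^sup>2 = (norm p)\<^sup>2"
proof -
  have "cinner (input_op n p) (input_op n p) = cinner p p"
    by (simp add: cinner_input_op input_op_nth cinner_prod_def)
  then show ?thesis by (simp only: cinner_self of_real_eq_iff)
qed

text \<open>The function \<open>q(z)\<close> sends an input to the two components of the first and of the last summand that
  the even rotations produce from the state and that do not enter the odd rotations.\<close>

lemma q_fun_apply:
  "q_fun \<Gamma> n z p = (fst (elementary_rotation \<Gamma> 0 (ell2_nth (R_op \<Gamma> n z (input_op n p)) 0)),
      z *\<^sub>C snd (elementary_rotation \<Gamma> (2 * n) (ell2_nth (R_op \<Gamma> n z (input_op n p)) n)))"
  by (simp add: q_fun_def block_op_apply_prod theta_fun_def c_fun_def b_fun_def a_fun_def input_op_def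
      elementary_rotation_def blinfun.add_right scaleC_add_right algebra_simps)

lemma a_fun_apply: "a_fun \<Gamma> n z w = snd (q_fun \<Gamma> n z (0, w))"
  and theta_c_apply: "theta_fun \<Gamma> n z h + c_fun \<Gamma> n z w = fst (q_fun \<Gamma> n z (h, w))"
  and b_a_apply: "b_fun \<Gamma> n z h + a_fun \<Gamma> n z w = snd (q_fun \<Gamma> n z (h, w))"
  by (simp_all add: q_fun_def block_op_apply)

context
  fixes \<Gamma> :: "nat \<Rightarrow> 'm::chilbert_space \<Rightarrow>\<^sub>L 'n::chilbert_space" and n :: nat
  assumes contractions: "contraction_sequence \<Gamma>"
begin

private abbreviation (input) "K \<equiv> K_space \<Gamma> n"
private abbreviation (input) "S \<equiv> S_op \<Gamma> n"
private abbreviation (input) "R \<equiv> R_op \<Gamma> n"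
private abbreviation (input) "last_dom \<equiv> dom_space \<Gamma> (2 * n + 1)"
private abbreviation (input) "last_cod \<equiv> cod_space \<Gamma> (2 * n + 1)"

private lemma K: "hilbert_subspace K"
  by (rule hilbert_subspace_K_space[OF contractions])

private lemma S: "S \<in> operators K K"
  by (rule S_op_operators[OF contractions])

private lemma zS: "z *\<^sub>C S \<in> operators K K"
  by (rule operators_scaleC[OF S K])

lemma norm_scaleC_S_op_le: "norm ((z *\<^sub>C S) x) \<le> cmod z * norm x"
  using norm_S_op_le[OF contractions, of n x] by (simp add: norm_scaleC mult_left_mono)

lemma invertible_on_resolvent: "z \<in> ball 0 1 \<Longrightarrow> invertible_on K (proj K - z *\<^sub>C S)"
  using invertible_on_proj_diff(1)[OF K zS _ _ norm_scaleC_S_op_le] by simp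

lemma norm_R_op_le: "z \<in> ball 0 1 \<Longrightarrow> norm (R z x) \<le> norm x / (1 - cmod z)"
  using invertible_on_proj_diff(2)[OF K zS _ _ norm_scaleC_S_op_le] by (simp add: R_op_def)

lemma R_op_operators: "z \<in> ball 0 1 \<Longrightarrow> R z \<in> operators K K"
  unfolding R_op_def by (rule inverse_on_operators[OF K invertible_on_resolvent])

lemma R_op_in: "z \<in> ball 0 1 \<Longrightarrow> R z x \<in> K"
  by (rule operators_range[OF R_op_operators K])

lemma R_op_equation:
  assumes "z \<in> ball 0 1"
  shows "R z x = proj K x + z *\<^sub>C S (R z x)"
  using inverse_on_right[OF K invertible_on_resolvent[OF assms], of x]
    proj_ident[OF K R_op_in[OF assms, of x]]
  by (simp add: R_op_def blinfun.diff_left algebra_simps)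

lemma R_op_eqI: "z \<in> ball 0 1 \<Longrightarrow> x \<in> K \<Longrightarrow> x - z *\<^sub>C S x = g \<Longrightarrow> R z g = x"
  unfolding R_op_def
  by (rule inverse_on_eqI[OF K invertible_on_resolvent]) (simp_all add: blinfun.diff_left proj_ident[OF K])

text \<open>Together with continuity this gives the difference quotient \<open>R(w) S R(z)\<close> of the resolvent.\<close>

lemma resolvent_identity:
  assumes z: "z \<in> ball 0 1" and w: "w \<in> ball 0 1"
  shows "R w x = R z x + (w - z) *\<^sub>C R w (S (R z x))"
proof -
  note lin = operators_complex_linear[OF R_op_operators[OF w]]
  have "R w (R z x - w *\<^sub>C S (R z x)) = R z x"
    by (rule R_op_eqI[OF w R_op_in[OF z] refl])
  moreover have "R z x - w *\<^sub>C S (R z x) = proj K x - (w - z) *\<^sub>C S (R z x)"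
    using R_op_equation[OF z, of x] by (simp add: scaleC_diff_left algebra_simps)
  ultimately show ?thesis
    by (simp add: blinfun.diff_right complex_linearD[OF lin] operators_proj_right[OF R_op_operators[OF w] K]
        algebra_simps)
qed

lemma R_op_continuous:
  assumes z: "z \<in> ball 0 1"
  shows "(R \<longlongrightarrow> R z) (at z)"
proof -
  have near: "\<forall>\<^sub>F w in at z. w \<in> ball 0 1"
    using z by (intro eventually_at_in_open') auto
  have bound: "norm (R w - R z) \<le> cmod (w - z) * (1 / (1 - cmod w) * (1 / (1 - cmod z)))"
    if w: "w \<in> ball 0 1" for w
  proof (rule norm_blinfun_bound)
    show "0 \<le> cmod (w - z) * (1 / (1 - cmod w) * (1 / (1 - cmod z)))"
      using w z by simp
    fix x
    have "norm ((R w - R z) x) = cmod (w - z) * norm (R w (S (R z x)))"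
      using resolvent_identity[OF z w, of x] by (simp add: blinfun.diff_left norm_scaleC)
    also have "\<dots> \<le> cmod (w - z) * (norm (S (R z x)) / (1 - cmod w))"
      by (intro mult_left_mono norm_R_op_le[OF w]) simp
    also have "\<dots> \<le> cmod (w - z) * ((norm x / (1 - cmod z)) / (1 - cmod w))"
      using w order_trans[OF norm_S_op_le[OF contractions] norm_R_op_le[OF z]]
      by (intro mult_left_mono divide_right_mono) simp_all
    finally show "norm ((R w - R z) x) \<le> cmod (w - z) * (1 / (1 - cmod w) * (1 / (1 - cmod z))) * norm x"
      by (simp add: mult_ac)
  qed
  have "((\<lambda>w. cmod (w - z) * (1 / (1 - cmod w) * (1 / (1 - cmod z)))) \<longlongrightarrow>
      cmod (z - z) * (1 / (1 - cmod z) * (1 / (1 - cmod z)))) (at z)"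
    using z by (intro tendsto_intros) auto
  then have "((\<lambda>w. R w - R z) \<longlongrightarrow> 0) (at z)"
    by (intro Lim_null_comparison[OF eventually_mono[OF near bound]]) simp_all
  then show ?thesis by (rule LIM_zero_cancel)
qed

lemma complex_linear_q_fun:
  assumes z: "z \<in> ball 0 1"
  shows "complex_linear (q_fun \<Gamma> n z)"
  unfolding complex_linear_def
proof (intro allI)
  fix c p
  have "R z (input_op n (c *\<^sub>C p)) = c *\<^sub>C R z (input_op n p)"
    by (simp only: complex_linearD[OF complex_linear_input_op]
        complex_linearD[OF operators_complex_linear[OF R_op_operators[OF z]]])
  then show "q_fun \<Gamma> n z (c *\<^sub>C p) = c *\<^sub>C q_fun \<Gamma> n z p"
    by (simp add: q_fun_apply rotation_scaleC[OF contractions] scaleC_Pair scaleC_scaleC mult.commute)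
qed

lemma input_op_in_K_space:
  assumes "snd p \<in> last_cod"
  shows "input_op n p \<in> K"
proof -
  have "0 \<in> dom_space \<Gamma> k" "0 \<in> cod_space \<Gamma> k" for k
    using hilbert_subspace_zero hilbert_subspace_dom_space hilbert_subspace_cod_space contractions by blast+
  then show ?thesis
    using assms by (auto simp: K_space_def H_space_def input_op_nth zero_prod_def
        simp del: dom_space.simps(2) cod_space.simps)
qed

text \<open>For \<open>x = R(z) g\<close> with an input \<open>g\<close>, the vector \<open>S x\<close> is orthogonal to \<open>g\<close>, so that
  \<open>\<parallel>x\<parallel>\<^sup>2 = \<parallel>g\<parallel>\<^sup>2 + |z|\<^sup>2 \<parallel>S x\<parallel>\<^sup>2\<close>; the energy balance of \<open>S\<close> then bounds the output by the input.\<close>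

lemma output_energy:
  assumes z: "z \<in> ball 0 1" and p: "snd p \<in> last_cod"
  defines "x \<equiv> R z (input_op n p)"
  shows "(norm (fst (elementary_rotation \<Gamma> 0 (ell2_nth x 0))))\<^sup>2
    + (norm (snd (elementary_rotation \<Gamma> (2 * n) (ell2_nth x n))))\<^sup>2 \<le> (norm p)\<^sup>2"
proof -
  let ?g = "input_op n p"
  have x: "x = ?g + z *\<^sub>C S x"
    using R_op_equation[OF z, of ?g] proj_ident[OF K input_op_in_K_space[OF p]] by (simp add: x_def)
  have "cinner (S x) ?g = 0"
    by (simp add: cinner_input_op fst_S_op_nth_0[OF contractions] snd_S_op_nth_last[OF contractions])
  then have "cinner (z *\<^sub>C S x) ?g = 0" by (simp add: cinner_scaleC_left)
  then have "inner (z *\<^sub>C S x) ?g = 0" by (simp flip: Re_cinner)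
  then have "(norm (?g + z *\<^sub>C S x))\<^sup>2 = (norm ?g)\<^sup>2 + (norm (z *\<^sub>C S x))\<^sup>2"
    by (simp add: power2_norm_eq_inner inner_add inner_commute)
  then have "(norm x)\<^sup>2 = (norm p)\<^sup>2 + (norm (z *\<^sub>C S x))\<^sup>2"
    by (simp only: norm_input_op flip: x)
  moreover have "(norm (z *\<^sub>C S x))\<^sup>2 \<le> (norm (S x))\<^sup>2"
    using z by (intro power_mono) (simp_all add: norm_scaleC mult_left_le_one_le)
  ultimately show ?thesis
    using S_op_energy[OF contractions, of n x] by linarith
qed

text \<open>An input in the last component that is orthogonal to the defect space is orthogonal to \<open>K\<close>, so
  the resolvent annihilates it.\<close>

lemma q_fun_proj:
  assumes z: "z \<in> ball 0 1"
  shows "q_fun \<Gamma> n z (h, proj last_cod w) = q_fun \<Gamma> n z (h, w)"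
proof -
  note cod = hilbert_subspace_cod_space[OF contractions]
  have "R z (input_op n (0, w - proj last_cod w)) = 0"
  proof (rule operators_zero[OF R_op_operators[OF z]])
    fix y assume "y \<in> K"
    then have "snd (ell2_nth y n) \<in> last_cod"
      by (auto simp: K_space_def H_space_def mem_Times_iff)
    then have "cinner (w - proj last_cod w) (snd (ell2_nth y n)) = 0"
      by (rule proj_orthogonal[OF cod])
    then have "cinner y (input_op n (0, w - proj last_cod w)) = 0"
      unfolding cinner_input_op by (subst (2) cinner_commute) simp
    then show "cinner (input_op n (0, w - proj last_cod w)) y = 0"
      by (subst cinner_commute) simp
  qed
  moreover have "R z (input_op n (h, w))
      = R z (input_op n (h, proj last_cod w)) + R z (input_op n (0, w - proj last_cod w))"
    unfolding blinfun.add_right[symmetric] by simp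
  ultimately show ?thesis by (simp only: q_fun_apply add_0_right)
qed

text \<open>The factor \<open>z\<close> in the second output gives the strict bound \<open>|z|\<close> for \<open>a(z)\<close>, on which the
  invertibility of \<open>I - a(z) \<Theta>\<^sub>2\<^sub>n\<^sub>+\<^sub>1(z)\<close> rests.\<close>

lemma norm_q_fun_le:
  assumes z: "z \<in> ball 0 1"
  shows "norm (snd (q_fun \<Gamma> n z p)) \<le> cmod z * norm p"
    and "norm (q_fun \<Gamma> n z p) \<le> norm p"
proof -
  obtain h w where p: "p = (h, w)" by (cases p)
  define p' where "p' = (h, proj last_cod w)"
  define x where "x = R z (input_op n p')"
  define u v where "u = fst (elementary_rotation \<Gamma> 0 (ell2_nth x 0))"
    and "v = snd (elementary_rotation \<Gamma> (2 * n) (ell2_nth x n))"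
  have q: "q_fun \<Gamma> n z p = (u, z *\<^sub>C v)"
    unfolding p u_def v_def x_def p'_def q_fun_proj[OF z, symmetric, of h w] by (rule q_fun_apply)
  have "(norm u)\<^sup>2 + (norm v)\<^sup>2 \<le> (norm p')\<^sup>2"
    unfolding u_def v_def x_def
    by (rule output_energy[OF z]) (simp only: p'_def snd_conv proj_in[OF hilbert_subspace_cod_space[OF contractions]])
  also have "\<dots> \<le> (norm p)\<^sup>2"
    using norm_proj_le[OF hilbert_subspace_cod_space[OF contractions], of "2 * n + 1" w]
    by (simp add: p p'_def norm_prod_power2 power_mono del: cod_space.simps)
  finally have uv: "(norm u)\<^sup>2 + (norm v)\<^sup>2 \<le> (norm p)\<^sup>2" .
  then have "(norm v)\<^sup>2 \<le> (norm p)\<^sup>2" by (smt (verit) zero_le_power2)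
  then have v: "norm v \<le> norm p" by (rule power2_le_imp_le) simp
  then show "norm (snd (q_fun \<Gamma> n z p)) \<le> cmod z * norm p"
    by (simp add: q norm_scaleC mult_left_mono)
  have "(norm (z *\<^sub>C v))\<^sup>2 \<le> (norm v)\<^sup>2"
    using z by (intro power_mono) (simp_all add: norm_scaleC mult_left_le_one_le)
  then have "(norm (q_fun \<Gamma> n z p))\<^sup>2 \<le> (norm p)\<^sup>2"
    using uv unfolding q norm_prod_power2[of "(u, _)"] fst_conv snd_conv by linarith
  then show "norm (q_fun \<Gamma> n z p) \<le> norm p" by (rule power2_le_imp_le) simp
qed

lemma q_fun_snd_in:
  assumes z: "z \<in> ball 0 1"
  shows "snd (q_fun \<Gamma> n z p) \<in> last_dom"
proof -
  have "fst (ell2_nth (R z (input_op n p)) n) \<in> dom_space \<Gamma> (2 * n)"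
    using R_op_in[OF z] by (auto simp: K_space_def H_space_def mem_Times_iff)
  from rotation_in(2)[OF contractions this] show ?thesis
    unfolding q_fun_apply snd_conv
    by (intro hilbert_subspace_scaleC hilbert_subspace_dom_space contractions)
      (simp del: dom_space.simps)
qed

lemma q_fun_operators:
  assumes z: "z \<in> ball 0 1"
  shows "q_fun \<Gamma> n z \<in> operators (UNIV \<times> last_cod) (UNIV \<times> last_dom)"
proof (rule operatorsI[OF complex_linear_q_fun[OF z]])
  show "q_fun \<Gamma> n z p \<in> UNIV \<times> last_dom" for p
    using q_fun_snd_in[OF z] by (simp add: mem_Times_iff)
next
  fix p :: "'m \<times> 'n" assume orth: "\<And>y. y \<in> UNIV \<times> last_cod \<Longrightarrow> cinner p y = 0"
  note cod = hilbert_subspace_cod_space[OF contractions]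
  have "cinner (fst p) (fst p) = 0"
    using orth[of "(fst p, 0)"] hilbert_subspace_zero[OF cod] by (simp add: cinner_prod_Pair del: cod_space.simps)
  moreover have "proj last_cod (snd p) = 0"
  proof (rule proj_eq_zero[OF cod])
    show "cinner (snd p) v = 0" if "v \<in> last_cod" for v
      using orth[of "(0, v)"] that by (simp add: cinner_prod_Pair del: cod_space.simps)
  qed
  ultimately show "q_fun \<Gamma> n z p = 0"
    using q_fun_proj[OF z, of "fst p" "snd p"]
    by (cases p) (simp add: zero_prod_def[symmetric] del: cod_space.simps)
qed

lemma q_fun_holomorphic:
  assumes z: "z \<in> ball 0 1"
  shows "\<exists>D. ((\<lambda>w. inverse (w - z) *\<^sub>C (q_fun \<Gamma> n w - q_fun \<Gamma> n z)) \<longlongrightarrow> D) (at z)"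
proof -
  define I where "I = (input_op n :: ('m \<times> 'n) \<Rightarrow>\<^sub>L _)"
  define U :: "('m \<times> 'n) ell2 \<Rightarrow>\<^sub>L ('n \<times> 'm)"
    where "U = inl_op o\<^sub>L (fst_blinfun o\<^sub>L (elementary_rotation \<Gamma> 0 o\<^sub>L ell2_coord 0))"
  define V :: "('m \<times> 'n) ell2 \<Rightarrow>\<^sub>L ('n \<times> 'm)"
    where "V = inr_op o\<^sub>L (snd_blinfun o\<^sub>L (elementary_rotation \<Gamma> (2 * n) o\<^sub>L ell2_coord n))"
  have q: "q_fun \<Gamma> n w p = U (R w (I p)) + w *\<^sub>C V (R w (I p))" for w p
    by (simp add: q_fun_apply U_def V_def I_def scaleC_Pair)
  have U: "U (a *\<^sub>C x) = a *\<^sub>C U x" and V: "V (a *\<^sub>C x) = a *\<^sub>C V x" for a x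
    by (simp_all add: U_def V_def rotation_scaleC[OF contractions] scaleC_Pair)
  \<comment> \<open>The difference quotient with the pole at \<open>w = z\<close> removed by the resolvent identity.\<close>
  define E where "E w = (U o\<^sub>L (R w o\<^sub>L (S o\<^sub>L (R z o\<^sub>L I)))) + (V o\<^sub>L (R w o\<^sub>L I))
      + ((z *\<^sub>C V) o\<^sub>L (R w o\<^sub>L (S o\<^sub>L (R z o\<^sub>L I))))" for w
  have quotient: "inverse (w - z) *\<^sub>C (q_fun \<Gamma> n w - q_fun \<Gamma> n z) = E w"
    if w: "w \<in> ball 0 1" "w \<noteq> z" for w
  proof (rule blinfun_eqI)
    fix p
    define a b d where "a = R z (I p)" and "b = R w (I p)" and "d = R w (S (R z (I p)))"
    have b: "b = a + (w - z) *\<^sub>C d"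
      unfolding a_def b_def d_def by (rule resolvent_identity[OF z w(1)])
    have "q_fun \<Gamma> n w p - q_fun \<Gamma> n z p = (U b - U a) + (w *\<^sub>C V b - z *\<^sub>C V a)"
      by (simp add: q a_def b_def)
    also have "U b - U a = (w - z) *\<^sub>C U d"
      by (simp add: b blinfun.add_right U)
    also have "w *\<^sub>C V b - z *\<^sub>C V a = (w - z) *\<^sub>C V b + z *\<^sub>C (V b - V a)"
      by (simp add: scaleC_diff_left scaleC_diff_right)
    also have "V b - V a = (w - z) *\<^sub>C V d"
      by (simp add: b blinfun.add_right V)
    also have "z *\<^sub>C (w - z) *\<^sub>C V d = (w - z) *\<^sub>C z *\<^sub>C V d"
      by (simp add: scaleC_scaleC mult.commute)
    finally have "q_fun \<Gamma> n w p - q_fun \<Gamma> n z p = (w - z) *\<^sub>C (U d + V b + z *\<^sub>C V d)"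
      by (simp add: scaleC_add_right)
    then have "inverse (w - z) *\<^sub>C (q_fun \<Gamma> n w p - q_fun \<Gamma> n z p) = U d + V b + z *\<^sub>C V d"
      using w(2) by (simp add: scaleC_scaleC)
    then show "(inverse (w - z) *\<^sub>C (q_fun \<Gamma> n w - q_fun \<Gamma> n z)) p = E w p"
      by (simp add: E_def blinfun.diff_left blinfun.add_left b_def d_def)
  qed
  have "(E \<longlongrightarrow> E z) (at z)"
    unfolding E_def
    by (intro tendsto_add bounded_bilinear.tendsto[OF bounded_bilinear_blinfun_compose]
        tendsto_const R_op_continuous[OF z])
  moreover have "\<forall>\<^sub>F w in at z. E w = inverse (w - z) *\<^sub>C (q_fun \<Gamma> n w - q_fun \<Gamma> n z)"
    using eventually_at_in_open[of "ball 0 1" z] z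
    by (auto elim!: eventually_mono simp: quotient)
  ultimately have "((\<lambda>w. inverse (w - z) *\<^sub>C (q_fun \<Gamma> n w - q_fun \<Gamma> n z)) \<longlongrightarrow> E z) (at z)"
    by (rule Lim_transform_eventually)
  then show ?thesis by blast
qed

lemma q_fun_schur_class: "q_fun \<Gamma> n \<in> schur_class (UNIV \<times> last_cod) (UNIV \<times> last_dom)"
  unfolding schur_class_def
  using q_fun_operators q_fun_holomorphic norm_q_fun_le(2)
  by (auto intro!: norm_blinfun_bound)

lemma a_fun_operators:
  assumes z: "z \<in> ball 0 1"
  shows "a_fun \<Gamma> n z \<in> operators last_cod last_dom"
proof (rule operatorsI_proj[OF _ hilbert_subspace_cod_space[OF contractions]])
  show "complex_linear (a_fun \<Gamma> n z)"
    unfolding complex_linear_def a_fun_apply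
    using complex_linearD[OF complex_linear_q_fun[OF z], of _ "(0, _)"] by (simp add: scaleC_Pair)
  show "a_fun \<Gamma> n z (proj last_cod w) = a_fun \<Gamma> n z w" for w
    unfolding a_fun_apply q_fun_proj[OF z] ..
  show "a_fun \<Gamma> n z w \<in> last_dom" for w
    unfolding a_fun_apply by (rule q_fun_snd_in[OF z])
qed

lemma norm_a_fun_le: "z \<in> ball 0 1 \<Longrightarrow> norm (a_fun \<Gamma> n z w) \<le> cmod z * norm w"
  using norm_q_fun_le(1)[of z "(0, w)"] by (simp add: a_fun_apply norm_Pair)

end

section \<open>The Schur algorithm as a feedback connection\<close>

text \<open>The defect spaces of one step are the domains of the next, so that the subspaces are closed and
  the parameters contractive by a joint induction.\<close>

lemma contraction_sequence_schur_algorithm: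
  fixes \<Theta> :: "complex \<Rightarrow> 'm::chilbert_space \<Rightarrow>\<^sub>L 'n::chilbert_space"
  assumes \<Theta>: "\<Theta> \<in> schur_class UNIV UNIV" and schur: "schur_algorithm \<Theta> \<Theta>s \<Gamma>"
  shows "contraction_sequence \<Gamma>"
    and "\<Theta>s k \<in> schur_class (dom_space \<Gamma> k) (cod_space \<Gamma> k)"
proof -
  have class_k: "\<Theta>s k \<in> schur_class (dom_space \<Gamma> k) (cod_space \<Gamma> k)" for k
  proof (cases k)
    case 0
    have "\<Theta>s 0 = \<Theta>" using schur unfolding schur_algorithm_def by blast
    then show ?thesis using \<Theta> 0 by simp
  next
    case (Suc i)
    then show ?thesis using schur unfolding schur_algorithm_def by blast
  qed
  then show "\<Theta>s k \<in> schur_class (dom_space \<Gamma> k) (cod_space \<Gamma> k)" .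
  have "\<Gamma> k = \<Theta>s k 0" for k
    using schur unfolding schur_algorithm_def by blast
  then have \<Gamma>: "\<Gamma> k \<in> operators (dom_space \<Gamma> k) (cod_space \<Gamma> k) \<and> norm (\<Gamma> k) \<le> 1" for k
    using class_k[of k] by (auto simp: schur_class_def)
  have "subspace_contraction (dom_space \<Gamma> k) (cod_space \<Gamma> k) (\<Gamma> k)" for k
  proof (induction k)
    case 0
    then show ?case using \<Gamma>[of 0] by (simp add: subspace_contraction_def hilbert_subspace_UNIV)
  next
    case (Suc k)
    have "hilbert_subspace (dom_space \<Gamma> (Suc k))"
      using hilbert_subspace_defect_space[OF Suc.IH] by simp
    moreover have "hilbert_subspace (cod_space \<Gamma> (Suc k))"
      using hilbert_subspace_defect_space[OF subspace_contraction_adj[OF Suc.IH]] by simp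
    ultimately show ?case
      using \<Gamma>[of "Suc k"] unfolding subspace_contraction_def by blast
  qed
  then show "contraction_sequence \<Gamma>" by (simp add: contraction_sequence_def)
qed

context
  fixes \<Theta> :: "complex \<Rightarrow> 'm::chilbert_space \<Rightarrow>\<^sub>L 'n::chilbert_space" and \<Theta>s \<Gamma> and z :: complex
  assumes \<Theta>: "\<Theta> \<in> schur_class UNIV UNIV" and schur: "schur_algorithm \<Theta> \<Theta>s \<Gamma>"
    and z: "z \<in> ball 0 1"
begin

private lemma contractions: "contraction_sequence \<Gamma>"
  by (rule contraction_sequence_schur_algorithm(1)[OF \<Theta> schur])

private lemmas dom = hilbert_subspace_dom_space[OF contractions]
  and cod = hilbert_subspace_cod_space[OF contractions]

lemma associated_function_operators: "\<Theta>s k z \<in> operators (dom_space \<Gamma> k) (cod_space \<Gamma> k)"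
  and norm_associated_function_le: "norm (\<Theta>s k z) \<le> 1"
  using contraction_sequence_schur_algorithm(2)[OF \<Theta> schur, of k] z by (auto simp: schur_class_def)

lemma invertible_on_schur_denominator:
  "invertible_on (dom_space \<Gamma> (Suc k))
    (proj (dom_space \<Gamma> (Suc k)) + z *\<^sub>C (adj (\<Gamma> k) o\<^sub>L \<Theta>s (Suc k) z))"
proof -
  let ?X = "- (z *\<^sub>C (adj (\<Gamma> k) o\<^sub>L \<Theta>s (Suc k) z))"
  have linear: "complex_linear (\<Gamma> k)"
    by (rule complex_linear_schur_parameter[OF contractions])
  note \<Theta>op = associated_function_operators[of "Suc k"]
  have "?X \<in> operators (dom_space \<Gamma> (Suc k)) (dom_space \<Gamma> (Suc k))"
  proof (rule operators_minus[OF operators_scaleC[OF _ dom] dom], rule operatorsI)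
    show "complex_linear (adj (\<Gamma> k) o\<^sub>L \<Theta>s (Suc k) z)"
      by (intro complex_linear_compose complex_linear_adj linear operators_complex_linear[OF \<Theta>op])
    show "(adj (\<Gamma> k) o\<^sub>L \<Theta>s (Suc k) z) x \<in> dom_space \<Gamma> (Suc k)" for x
      using adj_schur_parameter_in[OF contractions operators_range[OF \<Theta>op dom]] by simp
    show "(adj (\<Gamma> k) o\<^sub>L \<Theta>s (Suc k) z) x = 0"
      if "\<And>y. y \<in> dom_space \<Gamma> (Suc k) \<Longrightarrow> cinner x y = 0" for x
      using operators_zero[OF \<Theta>op that] by simp
  qed
  moreover have "norm (?X x) \<le> cmod z * norm x" for x
  proof -
    have "norm (adj (\<Gamma> k) (\<Theta>s (Suc k) z x)) \<le> norm (\<Theta>s (Suc k) z x)"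
      using norm_adj_le[OF linear] norm_schur_parameter_le[OF contractions, of k]
      by (intro norm_blinfun_apply_le) linarith
    also have "\<dots> \<le> norm x"
      by (rule norm_blinfun_apply_le[OF norm_associated_function_le])
    finally show ?thesis
      by (simp add: blinfun.minus_left norm_scaleC mult_left_mono)
  qed
  ultimately have "invertible_on (dom_space \<Gamma> (Suc k)) (proj (dom_space \<Gamma> (Suc k)) - ?X)"
    using z by (intro invertible_on_proj_diff(1)[OF dom, where c = "cmod z"]) auto
  then show ?thesis by (simp only: diff_minus_eq_add)
qed

text \<open>The internal signals of the cascade of rotations that is produced by the Schur algorithm.\<close>

primrec schur_state :: "'m \<Rightarrow> nat \<Rightarrow> 'm" where
  "schur_state h 0 = h"
| "schur_state h (Suc k) =
    inverse_on (dom_space \<Gamma> (Suc k))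
      (proj (dom_space \<Gamma> (Suc k)) + z *\<^sub>C (adj (\<Gamma> k) o\<^sub>L \<Theta>s (Suc k) z))
      (defect \<Gamma> k (schur_state h k))"

lemma schur_state_in: "schur_state h k \<in> dom_space \<Gamma> k"
  using operators_range[OF inverse_on_operators[OF dom invertible_on_schur_denominator] dom]
  by (cases k) simp_all

text \<open>One step of the Schur algorithm says that \<open>\<Theta>\<^sub>k(z)\<close> arises from the rotation of \<open>\<Gamma>\<^sub>k\<close> by
  feeding its second output back into its second input through \<open>z \<Theta>\<^sub>k\<^sub>+\<^sub>1(z)\<close>.\<close>

lemma rotation_schur_state:
  "elementary_rotation \<Gamma> k (schur_state h k, z *\<^sub>C \<Theta>s (Suc k) z (schur_state h (Suc k)))
    = (\<Theta>s k z (schur_state h k), schur_state h (Suc k))"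
proof -
  let ?x = "schur_state h k" and ?x' = "schur_state h (Suc k)"
  let ?w = "\<Theta>s (Suc k) z ?x'"
  have linear: "complex_linear (adj (\<Gamma> k))"
    by (intro complex_linear_adj complex_linear_schur_parameter[OF contractions])
  have w: "z *\<^sub>C ?w \<in> cod_space \<Gamma> (Suc k)"
    by (intro hilbert_subspace_scaleC cod operators_range[OF associated_function_operators dom])
  let ?V = "inverse_on (dom_space \<Gamma> (Suc k))
      (proj (dom_space \<Gamma> (Suc k)) + z *\<^sub>C (adj (\<Gamma> k) o\<^sub>L \<Theta>s (Suc k) z))"
  have "\<Theta>s k z = \<Gamma> k + z *\<^sub>C (codefect \<Gamma> k o\<^sub>L \<Theta>s (Suc k) z o\<^sub>L ?V o\<^sub>L defect \<Gamma> k)"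
    using schur z unfolding schur_algorithm_def by blast
  then have "\<Theta>s k z ?x = (\<Gamma> k + z *\<^sub>C (codefect \<Gamma> k o\<^sub>L \<Theta>s (Suc k) z o\<^sub>L ?V o\<^sub>L defect \<Gamma> k)) ?x"
    by (rule arg_cong)
  then have "\<Theta>s k z ?x = \<Gamma> k ?x + z *\<^sub>C codefect \<Gamma> k ?w"
    by (simp add: blinfun.add_left del: dom_space.simps cod_space.simps)
  moreover have "defect \<Gamma> k ?x = ?x' + z *\<^sub>C adj (\<Gamma> k) ?w"
    using inverse_on_right[OF dom invertible_on_schur_denominator, of k "defect \<Gamma> k ?x"]
      proj_ident[OF dom schur_state_in, of "Suc k" h] proj_ident[OF dom defect_in[OF contractions], of k ?x]
    by (simp add: blinfun.add_left del: dom_space.simps cod_space.simps)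
  ultimately show ?thesis
    by (simp add: rotation_apply[OF contractions] proj_ident[OF cod w] complex_linearD[OF linear]
        complex_linearD[OF complex_linear_codefect[OF contractions]] del: schur_state.simps cod_space.simps)
qed

text \<open>Of the two rotations that lead from \<open>x\<^sub>2\<^sub>j\<close> to \<open>x\<^sub>2\<^sub>j\<^sub>+\<^sub>2\<close> only the odd one produces new entries of the
  state, and these are multiplied by \<open>z\<close> in the state equation; hence the powers of \<open>z\<close>.\<close>

definition schur_vector :: "nat \<Rightarrow> 'm \<Rightarrow> ('m \<times> 'n) ell2" where
  "schur_vector n h = (\<Sum>j\<le>n. ell2_embed j
    (z ^ j *\<^sub>C (schur_state h (2 * j), z *\<^sub>C \<Theta>s (Suc (2 * j)) z (schur_state h (Suc (2 * j))))))"

lemma schur_vector_nth: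
  "ell2_nth (schur_vector n h) j = (if j \<le> n then
    z ^ j *\<^sub>C (schur_state h (2 * j), z *\<^sub>C \<Theta>s (Suc (2 * j)) z (schur_state h (Suc (2 * j)))) else 0)"
proof -
  have "ell2_nth (schur_vector n h) j = (\<Sum>i\<le>n. if j = i then
      z ^ i *\<^sub>C (schur_state h (2 * i), z *\<^sub>C \<Theta>s (Suc (2 * i)) z (schur_state h (Suc (2 * i)))) else 0)"
    unfolding schur_vector_def ell2_nth_sum ell2_nth_embed ..
  then show ?thesis by simp
qed

lemma schur_vector_in_K_space: "schur_vector n h \<in> K_space \<Gamma> n"
proof -
  have "z ^ j *\<^sub>C (schur_state h (2 * j), z *\<^sub>C \<Theta>s (Suc (2 * j)) z (schur_state h (Suc (2 * j)))) \<in> H_space \<Gamma> j" for j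
    unfolding H_space_def scaleC_Pair
    by (intro SigmaI hilbert_subspace_scaleC dom cod schur_state_in
        operators_range[OF associated_function_operators dom])
  then show ?thesis by (simp add: K_space_def schur_vector_nth)
qed

lemma even_factor_schur_vector:
  assumes "j \<le> n"
  shows "ell2_nth (even_factor \<Gamma> n (schur_vector n h)) j
    = z ^ j *\<^sub>C (\<Theta>s (2 * j) z (schur_state h (2 * j)), schur_state h (Suc (2 * j)))"
  using assms unfolding even_factor_nth schur_vector_nth
  by (simp only: if_True rotation_scaleC[OF contractions] rotation_schur_state)

lemma odd_rotation_schur_vector:
  assumes "j < n"
  shows "odd_rotation \<Gamma> (even_factor \<Gamma> n (schur_vector n h)) (Suc j)
    = z ^ j *\<^sub>C (schur_state h (2 * Suc j), \<Theta>s (Suc (2 * j)) z (schur_state h (Suc (2 * j))))"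
proof -
  let ?y = "even_factor \<Gamma> n (schur_vector n h)"
  have "(snd (ell2_nth ?y j), fst (ell2_nth ?y (Suc j)))
      = z ^ j *\<^sub>C (schur_state h (Suc (2 * j)), z *\<^sub>C \<Theta>s (Suc (Suc (2 * j))) z (schur_state h (Suc (Suc (2 * j)))))"
    using assms by (simp add: even_factor_schur_vector scaleC_Pair scaleC_scaleC mult.commute
        del: schur_state.simps)
  then have "elementary_rotation \<Gamma> (Suc (2 * j)) (snd (ell2_nth ?y j), fst (ell2_nth ?y (Suc j)))
      = z ^ j *\<^sub>C (\<Theta>s (Suc (2 * j)) z (schur_state h (Suc (2 * j))), schur_state h (Suc (Suc (2 * j))))"
    by (simp only: rotation_scaleC[OF contractions] rotation_schur_state)
  then show ?thesis
    by (simp add: odd_rotation_def Let_def scaleC_Pair del: schur_state.simps)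
qed

lemma schur_vector_equation:
  "schur_vector n h - z *\<^sub>C S_op \<Gamma> n (schur_vector n h)
    = input_op n (h, z ^ n *\<^sub>C z *\<^sub>C \<Theta>s (Suc (2 * n)) z (schur_state h (Suc (2 * n))))"
proof (rule ell2_eqI)
  fix j
  let ?x = "schur_vector n h"
  let ?y = "even_factor \<Gamma> n ?x"
  show "ell2_nth (?x - z *\<^sub>C S_op \<Gamma> n ?x) j = ell2_nth
      (input_op n (h, z ^ n *\<^sub>C z *\<^sub>C \<Theta>s (Suc (2 * n)) z (schur_state h (Suc (2 * n))))) j"
  proof (rule prod_eqI)
    have "fst (ell2_nth ?x j) - z *\<^sub>C fst (ell2_nth (odd_factor \<Gamma> n ?y) j) = (if j = 0 then h else 0)"
    proof (cases j)
      case 0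
      then show ?thesis by (simp add: schur_vector_nth fst_odd_factor_nth scaleC_Pair)
    next
      case (Suc i)
      then show ?thesis
        by (simp add: schur_vector_nth fst_odd_factor_nth odd_rotation_schur_vector
            scaleC_scaleC del: schur_state.simps)
    qed
    then show "fst (ell2_nth (?x - z *\<^sub>C S_op \<Gamma> n ?x) j) = fst (ell2_nth
        (input_op n (h, z ^ n *\<^sub>C z *\<^sub>C \<Theta>s (Suc (2 * n)) z (schur_state h (Suc (2 * n))))) j)"
      by (simp add: S_op_def input_op_nth)
    have "snd (ell2_nth ?x j) - z *\<^sub>C snd (ell2_nth (odd_factor \<Gamma> n ?y) j)
        = (if j = n then z ^ n *\<^sub>C z *\<^sub>C \<Theta>s (Suc (2 * n)) z (schur_state h (Suc (2 * n))) else 0)"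
      by (simp add: schur_vector_nth snd_odd_factor_nth odd_rotation_schur_vector
          scaleC_scaleC mult.commute del: schur_state.simps)
    then show "snd (ell2_nth (?x - z *\<^sub>C S_op \<Gamma> n ?x) j) = snd (ell2_nth
        (input_op n (h, z ^ n *\<^sub>C z *\<^sub>C \<Theta>s (Suc (2 * n)) z (schur_state h (Suc (2 * n))))) j)"
      by (simp add: S_op_def input_op_nth del: schur_state.simps)
  qed
qed

text \<open>The last component of the input in this equation is \<open>\<Theta>\<^sub>2\<^sub>n\<^sub>+\<^sub>1(z)\<close> applied to the second output,
  and the first output is \<open>\<Theta>(z) h\<close>.\<close>

lemma transfer_with_feedback:
  obtains y where "y \<in> dom_space \<Gamma> (2 * n + 1)"
    "q_fun \<Gamma> n z (h, \<Theta>s (2 * n + 1) z y) = (\<Theta> z h, y)"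
proof
  let ?x = "schur_state h (Suc (2 * n))"
  let ?y = "z *\<^sub>C z ^ n *\<^sub>C ?x"
  show "?y \<in> dom_space \<Gamma> (2 * n + 1)"
    using schur_state_in[of h "Suc (2 * n)"]
    by (simp add: hilbert_subspace_scaleC dom[of "Suc (2 * n)", simplified])
  have feedback: "\<Theta>s (2 * n + 1) z ?y = z ^ n *\<^sub>C z *\<^sub>C \<Theta>s (Suc (2 * n)) z ?x"
    using complex_linearD[OF operators_complex_linear[OF associated_function_operators]]
    by (simp add: scaleC_scaleC mult.commute)
  have x: "R_op \<Gamma> n z (input_op n (h, \<Theta>s (2 * n + 1) z ?y)) = schur_vector n h"
    unfolding feedback
    by (rule R_op_eqI[OF contractions z schur_vector_in_K_space schur_vector_equation])
  have "\<Theta>s 0 = \<Theta>" using schur unfolding schur_algorithm_def by blast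
  then show "q_fun \<Gamma> n z (h, \<Theta>s (2 * n + 1) z ?y) = (\<Theta> z h, ?y)"
    using even_factor_schur_vector[of 0 n h] even_factor_schur_vector[of n n h]
    unfolding q_fun_apply x even_factor_nth
    by (simp add: scaleC_Pair del: schur_state.simps(2))
qed

lemma invertible_on_feedback:
  shows "invertible_on (cod_space \<Gamma> (2 * n + 1))
      (proj (cod_space \<Gamma> (2 * n + 1)) - (\<Theta>s (2 * n + 1) z o\<^sub>L a_fun \<Gamma> n z))"
    and "invertible_on (dom_space \<Gamma> (2 * n + 1))
      (proj (dom_space \<Gamma> (2 * n + 1)) - (a_fun \<Gamma> n z o\<^sub>L \<Theta>s (2 * n + 1) z))"
proof -
  note a = a_fun_operators[OF contractions z, of n]
  note \<Theta>op = associated_function_operators[of "2 * n + 1"]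
  note \<Theta>_le = norm_blinfun_apply_le[OF norm_associated_function_le[of "2 * n + 1"]]
  have "norm ((\<Theta>s (2 * n + 1) z o\<^sub>L a_fun \<Gamma> n z) x) \<le> cmod z * norm x" for x
    using order_trans[OF \<Theta>_le norm_a_fun_le[OF contractions z]] by simp
  then show "invertible_on (cod_space \<Gamma> (2 * n + 1))
      (proj (cod_space \<Gamma> (2 * n + 1)) - (\<Theta>s (2 * n + 1) z o\<^sub>L a_fun \<Gamma> n z))"
    using z by (intro invertible_on_proj_diff(1)[OF cod operators_compose[OF \<Theta>op a], where c = "cmod z"]) auto
  have "norm ((a_fun \<Gamma> n z o\<^sub>L \<Theta>s (2 * n + 1) z) x) \<le> cmod z * norm x" for x
    using order_trans[OF norm_a_fun_le[OF contractions z] mult_left_mono[OF \<Theta>_le]] by simp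
  then show "invertible_on (dom_space \<Gamma> (2 * n + 1))
      (proj (dom_space \<Gamma> (2 * n + 1)) - (a_fun \<Gamma> n z o\<^sub>L \<Theta>s (2 * n + 1) z))"
    using z by (intro invertible_on_proj_diff(1)[OF dom operators_compose[OF a \<Theta>op], where c = "cmod z"]) auto
qed

text \<open>Both formulas eliminate the feedback signal, the first one solving for the input
  \<open>w = \<Theta>\<^sub>2\<^sub>n\<^sub>+\<^sub>1(z) y\<close> and the second one for the output \<open>y\<close>.\<close>

lemma linear_fractional_formulas:
  shows "\<Theta> z = theta_fun \<Gamma> n z
      + (c_fun \<Gamma> n z
        o\<^sub>L inverse_on (cod_space \<Gamma> (2 * n + 1))
            (proj (cod_space \<Gamma> (2 * n + 1)) - (\<Theta>s (2 * n + 1) z o\<^sub>L a_fun \<Gamma> n z))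
        o\<^sub>L \<Theta>s (2 * n + 1) z o\<^sub>L b_fun \<Gamma> n z)" (is "_ = _ + (_ o\<^sub>L inverse_on ?cod ?A o\<^sub>L ?T o\<^sub>L _)")
    and "\<Theta> z = theta_fun \<Gamma> n z
      + (c_fun \<Gamma> n z o\<^sub>L \<Theta>s (2 * n + 1) z
        o\<^sub>L inverse_on (dom_space \<Gamma> (2 * n + 1))
            (proj (dom_space \<Gamma> (2 * n + 1)) - (a_fun \<Gamma> n z o\<^sub>L \<Theta>s (2 * n + 1) z))
        o\<^sub>L b_fun \<Gamma> n z)" (is "_ = _ + (_ o\<^sub>L _ o\<^sub>L inverse_on ?dom ?B o\<^sub>L _)")
proof -
  have solved: "\<exists>y. \<Theta> z h = theta_fun \<Gamma> n z h + c_fun \<Gamma> n z (?T y)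
      \<and> inverse_on ?cod ?A (?T (b_fun \<Gamma> n z h)) = ?T y \<and> inverse_on ?dom ?B (b_fun \<Gamma> n z h) = y" for h
  proof -
    obtain y where y: "y \<in> ?dom" "q_fun \<Gamma> n z (h, ?T y) = (\<Theta> z h, y)"
      using transfer_with_feedback .
    have out: "b_fun \<Gamma> n z h = y - a_fun \<Gamma> n z (?T y)"
      using b_a_apply[of \<Gamma> n z h "?T y"] y(2) by (simp add: algebra_simps)
    have w: "?T y \<in> ?cod"
      by (rule operators_in[OF associated_function_operators y(1)])
    have "inverse_on ?cod ?A (?T (b_fun \<Gamma> n z h)) = ?T y"
      by (rule inverse_on_eqI[OF cod invertible_on_feedback(1) w])
        (simp only: blinfun.diff_left blinfun.diff_right blinfun_apply_blinfun_compose out proj_ident[OF cod w])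
    moreover have "inverse_on ?dom ?B (b_fun \<Gamma> n z h) = y"
      by (rule inverse_on_eqI[OF dom invertible_on_feedback(2) y(1)])
        (simp only: blinfun.diff_left blinfun_apply_blinfun_compose out proj_ident[OF dom y(1)])
    ultimately show ?thesis
      using theta_c_apply[of \<Gamma> n z h "?T y"] y(2) by auto
  qed
  show "\<Theta> z = theta_fun \<Gamma> n z + (c_fun \<Gamma> n z o\<^sub>L inverse_on ?cod ?A o\<^sub>L ?T o\<^sub>L b_fun \<Gamma> n z)"
  proof (rule blinfun_eqI)
    show "\<Theta> z h = (theta_fun \<Gamma> n z + (c_fun \<Gamma> n z o\<^sub>L inverse_on ?cod ?A o\<^sub>L ?T o\<^sub>L b_fun \<Gamma> n z)) h" for h
      using solved[of h] unfolding blinfun.add_left blinfun_apply_blinfun_compose by metis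
  qed
  show "\<Theta> z = theta_fun \<Gamma> n z + (c_fun \<Gamma> n z o\<^sub>L ?T o\<^sub>L inverse_on ?dom ?B o\<^sub>L b_fun \<Gamma> n z)"
  proof (rule blinfun_eqI)
    show "\<Theta> z h = (theta_fun \<Gamma> n z + (c_fun \<Gamma> n z o\<^sub>L ?T o\<^sub>L inverse_on ?dom ?B o\<^sub>L b_fun \<Gamma> n z)) h" for h
      using solved[of h] unfolding blinfun.add_left blinfun_apply_blinfun_compose by metis
  qed
qed

end

section \<open>The linear fractional representation\<close>

theorem theorem4p9:
  fixes \<Theta> :: "complex \<Rightarrow> 'm::separable_chilbert_space \<Rightarrow>\<^sub>L 'n::separable_chilbert_space"
    and \<Theta>s :: "nat \<Rightarrow> complex \<Rightarrow> 'm \<Rightarrow>\<^sub>L 'n"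
    and \<Gamma> :: "nat \<Rightarrow> 'm \<Rightarrow>\<^sub>L 'n"
    and n :: nat
  assumes "\<Theta> \<in> schur_class UNIV UNIV"
    and "schur_algorithm \<Theta> \<Theta>s \<Gamma>"
    and "dom_space \<Gamma> (2 * n + 1) \<noteq> {0}"
    and "cod_space \<Gamma> (2 * n + 1) \<noteq> {0}"
  shows "q_fun \<Gamma> n \<in> schur_class (UNIV \<times> cod_space \<Gamma> (2 * n + 1)) (UNIV \<times> dom_space \<Gamma> (2 * n + 1))
    \<and> (\<forall>z\<in>ball 0 1.
        invertible_on (K_space \<Gamma> n) (proj (K_space \<Gamma> n) - z *\<^sub>C S_op \<Gamma> n)
      \<and> invertible_on (cod_space \<Gamma> (2 * n + 1))
          (proj (cod_space \<Gamma> (2 * n + 1)) - (\<Theta>s (2 * n + 1) z o\<^sub>L a_fun \<Gamma> n z))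
      \<and> invertible_on (dom_space \<Gamma> (2 * n + 1))
          (proj (dom_space \<Gamma> (2 * n + 1)) - (a_fun \<Gamma> n z o\<^sub>L \<Theta>s (2 * n + 1) z))
      \<and> \<Theta> z = theta_fun \<Gamma> n z
          + (c_fun \<Gamma> n z
            o\<^sub>L inverse_on (cod_space \<Gamma> (2 * n + 1))
                (proj (cod_space \<Gamma> (2 * n + 1)) - (\<Theta>s (2 * n + 1) z o\<^sub>L a_fun \<Gamma> n z))
            o\<^sub>L \<Theta>s (2 * n + 1) z o\<^sub>L b_fun \<Gamma> n z)
      \<and> \<Theta> z = theta_fun \<Gamma> n z
          + (c_fun \<Gamma> n z o\<^sub>L \<Theta>s (2 * n + 1) z
            o\<^sub>L inverse_on (dom_space \<Gamma> (2 * n + 1))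
                (proj (dom_space \<Gamma> (2 * n + 1)) - (a_fun \<Gamma> n z o\<^sub>L \<Theta>s (2 * n + 1) z))
            o\<^sub>L b_fun \<Gamma> n z))"
proof (intro conjI ballI)
  note contractions = contraction_sequence_schur_algorithm(1)[OF assms(1,2)]
  show "q_fun \<Gamma> n \<in> schur_class (UNIV \<times> cod_space \<Gamma> (2 * n + 1)) (UNIV \<times> dom_space \<Gamma> (2 * n + 1))"
    by (rule q_fun_schur_class[OF contractions])
  fix z :: complex assume z: "z \<in> ball 0 1"
  show "invertible_on (K_space \<Gamma> n) (proj (K_space \<Gamma> n) - z *\<^sub>C S_op \<Gamma> n)"
    by (rule invertible_on_resolvent[OF contractions z])
qed (rule invertible_on_feedback[OF assms(1,2)] linear_fractional_formulas[OF assms(1,2)], assumption)+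

end
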